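(* Let $X$ be a set and $\Omega$ a semigroup. With respect to the monomial order $\leq_{\mathrm{db}}$ on $\mathfrak{M}(\Omega_R\sqcup\Omega_S,X)$: (a) the set $\mathbb{S}_{SF}$ consisting of all elements $$\lfloor u\rfloor^R_\alpha\lfloor v\rfloor^R_\beta-\big\lfloor\lfloor u\rfloor^R_\alpha v\big\rfloor^R_{\alpha\beta}-\big\lfloor u\lfloor v\rfloor^S_\beta\big\rfloor^R_{\alpha\beta},\qquad \lfloor u\rfloor^S_\alpha\lfloor v\rfloor^S_\beta-\big\lfloor\lfloor u\rfloor^R_\alpha v\big\rfloor^S_{\alpha\beta}-\big\lfloor u\lfloor v\rfloor^S_\beta\big\rfloor^S_{\alpha\beta},$$ with $u,v\in\mathfrak{M}(\Omega_R\sqcup\Omega_S,X)$ and $\alpha,\beta\in\Omega$, is a Gröbner-Shirshov basis in $\mathbf{k}\mathfrak{M}(\Omega_R\sqcup\Omega_S,X)$; (b) the set $$\mathrm{Irr}(\mathbb{S}_{SF})=\{w\in\mathfrak{M}(\Omega_R\sqcup\Omega_S,X)\mid w\neq q|_{\overline{s}}\text{ for any }q\in\mathfrak{M}^\star(\Omega_R\sqcup\Omega_S,X)\text{ and any }s\in\mathbb{S}_{SF}\}$$ is a $\mathbf{k}$-basis of the free Rota-Baxter system family algebra $\mathbf{k}\mathfrak{M}(\Omega_R\sqcup\Omega_S,X)/\mathrm{Id}(\mathbb{S}_{SF})$ on $X$.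
   Context: $\mathbf{k}$ is a fixed commutative unitary ring; algebras are unitary associative $\mathbf{k}$-algebras. **Rota-Baxter system family algebra.** For a semigroup $\Omega$, this is an algebra $A$ with linear operators $R_\omega,S_\omega:A\to A$ ($\omega\in\Omega$) such that for all $a,b\in A$, $\alpha,\beta\in\Omega$: $R_\alpha(a)R_\beta(b)=R_{\alpha\beta}(R_\alpha(a)b+aS_\beta(b))$ and $S_\alpha(a)S_\beta(b)=S_{\alpha\beta}(R_\alpha(a)b+aS_\beta(b))$. **Bracketed words.** For a set $X$ and nonempty set $\Lambda$, let $M(Y)$ be the free monoid on $Y$ and, for $\omega\in\Lambda$, let $\lfloor Y\rfloor_\omega=\{\lfloor y\rfloor_\omega\mid y\in Y\}$ be a disjoint copy of $Y$ (disjoint for different $\omega$). Set $\mathfrak{M}_0=M(X)$, $\mathfrak{M}_n=M(X\sqcup\bigsqcup_{\omega\in\Lambda}\lfloor\mathfrak{M}_{n-1}\rfloor_\omega)$, with the natural inclusions $\mathfrak{M}_{n-1}\hookrightarrow\mathfrak{M}_n$, and $\mathfrak{M}(\Lambda,X)=\bigcup_n\mathfrak{M}_n$, a monoid with identity $1$. $\mathbf{k}\mathfrak{M}(\Lambda,X)$ is the free module on it, with multiplication extended linearly and linear operators $w\mapsto\lfloor w\rfloor_\omega$; it is the free algebra on $X$ equipped with a family of linear operators indexed by $\Lambda$. Elements of $X\sqcup\bigsqcup_\omega\lfloor\mathfrak{M}(\Lambda,X)\rfloor_\omega$ are called prime; if $u=u_1\cdots u_n$ with $u_i$ prime, the breadth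 is $|u|=n$ (and $|1|=0$). $\mathfrak{M}^\star(\Lambda,X)$ is the set of words in $\mathfrak{M}(\Lambda,X\sqcup\{\star\})$ in which $\star$ occurs exactly once; $q|_u$ is obtained from $q$ by replacing $\star$ by $u$, extended linearly in $u$. $\mathrm{Id}(\mathbb{S})$ is the two-sided ideal, closed under all operators $\lfloor\,\rfloor_\omega$, generated by $\mathbb{S}$. Here $\Omega_R,\Omega_S$ are two disjoint copies of $\Omega$, $\Lambda=\Omega_R\sqcup\Omega_S$, and $\lfloor\,\rfloor^R_\omega$, $\lfloor\,\rfloor^S_\omega$ ($\omega\in\Omega$) denote the operators indexed by the copies of $\omega$ in $\Omega_R$, $\Omega_S$. In the quotient, the operators $R_\omega,S_\omega$ are those induced by $\lfloor\,\rfloor_\omega^R,\lfloor\,\rfloor_\omega^S$. **The order $\leq_{\mathrm{db}}$.** Fix well orders $\leq_X$ on $X$ and $\leq_\Omega$ on the set of operators $\{\lfloor\,\rfloor^R_\omega,\lfloor\,\rfloor^S_\omega\mid\omega\in\Omega\}$. Let $\deg(u)$ be the total number of occurrences in $u$ of letters of $X$ and of operators, counted with multiplicity. For $u=u_1\cdots u_m$, $v=v_1\cdots v_n$ with prime factors $u_i,v_j$, $u\leq_{\mathrm{db}}v$ is defined recursively by lexicographic comparison of $(\deg(u),|u|,u_1,\dots,u_m)$ and $(\deg(v),|v|,v_1,\dots,v_n)$, i.e. first by degree, then by breadth, then by prime factors lexicographically; two prime elements of equal degree are compared as follows: elements of $X$ by $\leq_X$; an element of $X$ is smaller than any bracket $\lfloor\tilde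 v\rfloor$; two brackets $\lfloor\tilde u\rfloor^{\ast_1}_\alpha,\lfloor\tilde v\rfloor^{\ast_2}_\beta$ by lexicographic comparison of $(\lfloor\,\rfloor^{\ast_1}_\alpha,\tilde u)$ and $(\lfloor\,\rfloor^{\ast_2}_\beta,\tilde v)$, using $\leq_\Omega$ and then $\leq_{\mathrm{db}}$. **Gröbner-Shirshov basis.** A monomial order is a well order $\leq$ on $\mathfrak{M}(\Lambda,X)$ such that $u<v$ implies $q|_u<q|_v$ for all $q\in\mathfrak{M}^\star(\Lambda,X)$. Given one, $\overline{f}$ denotes the leading monomial of $f\neq0$; $f$ is monic if its leading coefficient is $1$. Let $f,g$ be distinct monic elements. If $w=\overline{f}u=v\overline{g}$ for words $u,v,w$ with $\max\{|\overline f|,|\overline g|\}<|w|<|\overline f|+|\overline g|$, then $fu-vg$ is an intersection composition of $f,g$ with ambiguity $w$. If $w=\overline f=q|_{\overline g}$ with $q\in\mathfrak{M}^\star(\Lambda,X)$, then $f-q|_g$ is an including composition with ambiguity $w$. For a set $\mathbb{S}$ of monic elements, a composition $h$ with ambiguity $w$ is trivial modulo $(\mathbb{S},w)$ if $h=\sum_ic_iq_i|_{s_i}$ (finite sum) with $c_i\in\mathbf{k}\setminus\{0\}$, $q_i\in\mathfrak{M}^\star(\Lambda,X)$, $s_i\in\mathbb{S}$, $q_i|_{\overline{s_i}}<w$. $\mathbb{S}$ is a Gröbner-Shirshov basis if all intersection and including compositions of all pairs $f,g\in\mathbb{S}$ are trivial modulo $(\mathbb{S},w)$. *)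

theory Defs
  imports
    "HOL-Library.Poly_Mapping"
    "HOL-Algebra.Module"
    "HOL-Algebra.QuotRing"
begin

section \<open>Bracketed words\<close>

text \<open>
  A bracketed word is the list of its prime factors, so that the breadth of a word is its
  length and the product of words is concatenation.  The type comprises the words over all
  letters of type \<open>'x\<close>; the words over a set \<open>X\<close> of letters (possibly empty) are singled
  out below.
\<close>

datatype ('l, 'x) bprime = Letter 'x | Bracket 'l "('l, 'x) bprime list"

type_synonym ('l, 'x) bword = "('l, 'x) bprime list"

text \<open>
  \<open>stage X n\<close> is the \<open>n\<close>-th step of the construction of the words over \<open>X\<close>; \<open>lists Y\<close> is
  the free monoid on \<open>Y\<close>.
\<close>

primrec stage :: "'x set \<Rightarrow> nat \<Rightarrow> ('l, 'x) bword set" where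
  "stage X 0 = lists (Letter ` X)"
| "stage X (Suc n) = lists (Letter ` X \<union> (\<Union>l. Bracket l ` stage X n))"

definition bwords :: "'x set \<Rightarrow> ('l, 'x) bword set" where
  "bwords X = (\<Union>n. stage X n)"

text \<open>Words with a hole: the letter \<open>None\<close> plays the role of the additional letter \<open>\<star>\<close>.\<close>

fun holes_prime :: "('l, 'x option) bprime \<Rightarrow> nat" where
  "holes_prime (Letter None) = 1"
| "holes_prime (Letter (Some x)) = 0"
| "holes_prime (Bracket l q) = sum_list (map holes_prime q)"

definition star_words :: "'x set \<Rightarrow> ('l, 'x option) bword set" where
  "star_words X = {q \<in> bwords (insert None (Some ` X)). sum_list (map holes_prime q) = 1}"

fun plug_prime :: "('l, 'x) bword \<Rightarrow> ('l, 'x option) bprime \<Rightarrow> ('l, 'x) bword" where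
  "plug_prime u (Letter None) = u"
| "plug_prime u (Letter (Some x)) = [Letter x]"
| "plug_prime u (Bracket l q) = [Bracket l (concat (map (plug_prime u) q))]"

definition plug :: "('l, 'x option) bword \<Rightarrow> ('l, 'x) bword \<Rightarrow> ('l, 'x) bword" where
  "plug q u = concat (map (plug_prime u) q)"


section \<open>The algebra of bracketed words\<close>

text \<open>
  The product of \<^typ>\<open>'a \<Rightarrow>\<^sub>0 'b\<close> is the one of the monoid algebra, for an additively
  written monoid of exponents; hence concatenation of lists is made available as \<open>+\<close>.
\<close>

instantiation list :: (type) monoid_add
begin

definition zero_list :: "'a list" where "zero_list = []"
definition plus_list :: "'a list \<Rightarrow> 'a list \<Rightarrow> 'a list" where "plus_list = append"

instance by standard (simp_all add: zero_list_def plus_list_def)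

end

type_synonym ('l, 'x, 'k) bpoly = "('l, 'x) bword \<Rightarrow>\<^sub>0 'k"

definition wmon :: "('l, 'x) bword \<Rightarrow> ('l, 'x, 'k::comm_ring_1) bpoly" where
  "wmon w = Poly_Mapping.single w 1"

definition lin_ext ::
    "(('l, 'x) bword \<Rightarrow> ('l, 'x) bword) \<Rightarrow> ('l, 'x, 'k::comm_ring_1) bpoly \<Rightarrow> ('l, 'x, 'k) bpoly" where
  "lin_ext \<phi> f =
     (\<Sum>w\<in>Poly_Mapping.keys f. Poly_Mapping.single (\<phi> w) (Poly_Mapping.lookup f w))"

definition bpoly_scale :: "'k \<Rightarrow> ('l, 'x, 'k::comm_ring_1) bpoly \<Rightarrow> ('l, 'x, 'k) bpoly" where
  "bpoly_scale c f = Poly_Mapping.map ((*) c) f"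

definition bracket_op :: "'l \<Rightarrow> ('l, 'x, 'k::comm_ring_1) bpoly \<Rightarrow> ('l, 'x, 'k) bpoly" where
  "bracket_op l = lin_ext (\<lambda>w. [Bracket l w])"

definition scalar_ring :: "'k::comm_ring_1 ring" where
  "scalar_ring =
     \<lparr>carrier = UNIV, monoid.mult = (*), one = 1, ring.zero = 0, add = (+)\<rparr>"

definition word_algebra :: "'x set \<Rightarrow> ('k::comm_ring_1, ('l, 'x, 'k) bpoly) module" where
  "word_algebra X =
     \<lparr>carrier = {f. Poly_Mapping.keys f \<subseteq> bwords X},
      monoid.mult = (*), one = 1, ring.zero = 0, add = (+), smult = bpoly_scale\<rparr>"

definition operated_ideal :: "'x set \<Rightarrow> ('l, 'x, 'k::comm_ring_1) bpoly set \<Rightarrow> bool" where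
  "operated_ideal X I \<longleftrightarrow>
     ideal I (word_algebra X) \<and> (\<forall>l. \<forall>f\<in>I. bracket_op l f \<in> I)"

definition op_ideal :: "'x set \<Rightarrow> ('l, 'x, 'k::comm_ring_1) bpoly set \<Rightarrow> ('l, 'x, 'k) bpoly set" where
  "op_ideal X \<S> = \<Inter>{I. operated_ideal X I \<and> \<S> \<subseteq> I}"


section \<open>Groebner-Shirshov bases\<close>

text \<open>Orders are reflexive relations on \<open>bwords X\<close>.\<close>

definition monomial_order :: "'x set \<Rightarrow> ('l, 'x) bword rel \<Rightarrow> bool" where
  "monomial_order X r \<longleftrightarrow>
     well_order_on (bwords X) r \<and>
     (\<forall>q\<in>star_words X. \<forall>u v. (u, v) \<in> r \<and> u \<noteq> v \<longrightarrow>
        (plug q u, plug q v) \<in> r \<and> plug q u \<noteq> plug q v)"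

definition lead_mon :: "('l, 'x) bword rel \<Rightarrow> ('l, 'x, 'k::comm_ring_1) bpoly \<Rightarrow> ('l, 'x) bword" where
  "lead_mon r f =
     (THE w. w \<in> Poly_Mapping.keys f \<and> (\<forall>v\<in>Poly_Mapping.keys f. (v, w) \<in> r))"

definition monic :: "('l, 'x) bword rel \<Rightarrow> ('l, 'x, 'k::comm_ring_1) bpoly \<Rightarrow> bool" where
  "monic r f \<longleftrightarrow> f \<noteq> 0 \<and> Poly_Mapping.lookup f (lead_mon r f) = 1"

definition intersection_comp ::
    "'x set \<Rightarrow> ('l, 'x) bword rel \<Rightarrow> ('l, 'x, 'k::comm_ring_1) bpoly \<Rightarrow> ('l, 'x, 'k) bpoly \<Rightarrow>
     ('l, 'x) bword \<Rightarrow> ('l, 'x, 'k) bpoly \<Rightarrow> bool" where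
  "intersection_comp X r f g w h \<longleftrightarrow>
     (\<exists>u\<in>bwords X. \<exists>v\<in>bwords X.
        w = lead_mon r f @ u \<and> w = v @ lead_mon r g \<and>
        max (length (lead_mon r f)) (length (lead_mon r g)) < length w \<and>
        length w < length (lead_mon r f) + length (lead_mon r g) \<and>
        h = f * wmon u - wmon v * g)"

definition including_comp ::
    "'x set \<Rightarrow> ('l, 'x) bword rel \<Rightarrow> ('l, 'x, 'k::comm_ring_1) bpoly \<Rightarrow> ('l, 'x, 'k) bpoly \<Rightarrow>
     ('l, 'x) bword \<Rightarrow> ('l, 'x, 'k) bpoly \<Rightarrow> bool" where
  "including_comp X r f g w h \<longleftrightarrow>
     (\<exists>q\<in>star_words X.
        w = lead_mon r f \<and> w = plug q (lead_mon r g) \<and>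
        h = f - lin_ext (plug q) g)"

definition trivial_mod ::
    "'x set \<Rightarrow> ('l, 'x) bword rel \<Rightarrow> ('l, 'x, 'k::comm_ring_1) bpoly set \<Rightarrow> ('l, 'x) bword \<Rightarrow>
     ('l, 'x, 'k) bpoly \<Rightarrow> bool" where
  "trivial_mod X r \<S> w h \<longleftrightarrow>
     (\<exists>ts. (\<forall>(c, q, s)\<in>set ts. c \<noteq> 0 \<and> q \<in> star_words X \<and> s \<in> \<S> \<and>
              (plug q (lead_mon r s), w) \<in> r \<and> plug q (lead_mon r s) \<noteq> w) \<and>
           h = (\<Sum>(c, q, s)\<leftarrow>ts. bpoly_scale c (lin_ext (plug q) s)))"

definition GS_basis ::
    "'x set \<Rightarrow> ('l, 'x) bword rel \<Rightarrow> ('l, 'x, 'k::comm_ring_1) bpoly set \<Rightarrow> bool" where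
  "GS_basis X r \<S> \<longleftrightarrow>
     \<S> \<subseteq> carrier (word_algebra X) \<and> (\<forall>s\<in>\<S>. monic r s) \<and>
     (\<forall>f\<in>\<S>. \<forall>g\<in>\<S>. f \<noteq> g \<longrightarrow>
        (\<forall>w h. intersection_comp X r f g w h \<or> including_comp X r f g w h \<longrightarrow>
           trivial_mod X r \<S> w h))"

definition Irr ::
    "'x set \<Rightarrow> ('l, 'x) bword rel \<Rightarrow> ('l, 'x, 'k::comm_ring_1) bpoly set \<Rightarrow> ('l, 'x) bword set" where
  "Irr X r \<S> = {w \<in> bwords X. \<forall>q\<in>star_words X. \<forall>s\<in>\<S>. w \<noteq> plug q (lead_mon r s)}"


section \<open>The order \<open>\<le>\<^sub>d\<^sub>b\<close>\<close>

fun deg_prime :: "('l, 'x) bprime \<Rightarrow> nat" where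
  "deg_prime (Letter x) = 1"
| "deg_prime (Bracket l w) = Suc (sum_list (map deg_prime w))"

definition wdeg :: "('l, 'x) bword \<Rightarrow> nat" where
  "wdeg w = sum_list (map deg_prime w)"

text \<open>
  The strict order, defined simultaneously for words and for prime elements.  Two prime
  factors are compared as words of breadth one, i.e. first by degree.
\<close>

inductive db_less :: "'x rel \<Rightarrow> 'l rel \<Rightarrow> ('l, 'x) bword \<Rightarrow> ('l, 'x) bword \<Rightarrow> bool"
  and db_less_prime :: "'x rel \<Rightarrow> 'l rel \<Rightarrow> ('l, 'x) bprime \<Rightarrow> ('l, 'x) bprime \<Rightarrow> bool"
  for rX :: "'x rel" and rL :: "'l rel"
where
  degree:
    "wdeg u < wdeg v \<Longrightarrow> db_less rX rL u v"
| breadth: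
    "wdeg u = wdeg v \<Longrightarrow> length u < length v \<Longrightarrow> db_less rX rL u v"
| factors:
    "wdeg (z @ p # s) = wdeg (z @ q # t) \<Longrightarrow> length s = length t \<Longrightarrow> db_less_prime rX rL p q \<Longrightarrow>
     db_less rX rL (z @ p # s) (z @ q # t)"
| prime_degree:
    "deg_prime p < deg_prime q \<Longrightarrow> db_less_prime rX rL p q"
| letters:
    "(x, y) \<in> rX \<Longrightarrow> x \<noteq> y \<Longrightarrow> db_less_prime rX rL (Letter x) (Letter y)"
| letter_bracket:
    "deg_prime (Letter x :: ('l, 'x) bprime) = deg_prime (Bracket l w) \<Longrightarrow>
     db_less_prime rX rL (Letter x) (Bracket l w)"
| operators:
    "deg_prime (Bracket l u) = deg_prime (Bracket m v) \<Longrightarrow> (l, m) \<in> rL \<Longrightarrow> l \<noteq> m \<Longrightarrow>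
     db_less_prime rX rL (Bracket l u) (Bracket m v)"
| contents:
    "deg_prime (Bracket l u) = deg_prime (Bracket l v) \<Longrightarrow> db_less rX rL u v \<Longrightarrow>
     db_less_prime rX rL (Bracket l u) (Bracket l v)"

definition db_order :: "'x set \<Rightarrow> 'x rel \<Rightarrow> 'l rel \<Rightarrow> ('l, 'x) bword rel" where
  "db_order X rX rL =
     {(u, v). u \<in> bwords X \<and> v \<in> bwords X \<and> (u = v \<or> db_less rX rL u v)}"


section \<open>Rota-Baxter system family algebras\<close>

text \<open>The locale \<^locale>\<open>algebra\<close> is about commutative algebras.\<close>

locale assoc_algebra = module K A + ring A for K (structure) and A (structure) +
  assumes smult_mult_left:
      "\<lbrakk>c \<in> carrier K; a \<in> carrier A; b \<in> carrier A\<rbrakk> \<Longrightarrow>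
       (c \<odot>\<^bsub>A\<^esub> a) \<otimes>\<^bsub>A\<^esub> b = c \<odot>\<^bsub>A\<^esub> (a \<otimes>\<^bsub>A\<^esub> b)"
    and smult_mult_right:
      "\<lbrakk>c \<in> carrier K; a \<in> carrier A; b \<in> carrier A\<rbrakk> \<Longrightarrow>
       a \<otimes>\<^bsub>A\<^esub> (c \<odot>\<^bsub>A\<^esub> b) = c \<odot>\<^bsub>A\<^esub> (a \<otimes>\<^bsub>A\<^esub> b)"

definition linear_op :: "('k, 'm) ring_scheme \<Rightarrow> ('k, 'a, 'n) module_scheme \<Rightarrow> ('a \<Rightarrow> 'a) \<Rightarrow> bool" where
  "linear_op K A P \<longleftrightarrow>
     P \<in> carrier A \<rightarrow> carrier A \<and>
     (\<forall>a\<in>carrier A. \<forall>b\<in>carrier A. P (a \<oplus>\<^bsub>A\<^esub> b) = P a \<oplus>\<^bsub>A\<^esub> P b) \<and>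
     (\<forall>c\<in>carrier K. \<forall>a\<in>carrier A. P (c \<odot>\<^bsub>A\<^esub> a) = c \<odot>\<^bsub>A\<^esub> P a)"

locale rb_system_family = assoc_algebra K A for K (structure) and A (structure) +
  fixes R S :: "'o::semigroup_mult \<Rightarrow> 'a \<Rightarrow> 'a"
  assumes linear_R: "linear_op K A (R \<omega>)"
    and linear_S: "linear_op K A (S \<omega>)"
    and RR: "\<lbrakk>a \<in> carrier A; b \<in> carrier A\<rbrakk> \<Longrightarrow>
      R \<alpha> a \<otimes>\<^bsub>A\<^esub> R \<beta> b = R (\<alpha> * \<beta>) (R \<alpha> a \<otimes>\<^bsub>A\<^esub> b \<oplus>\<^bsub>A\<^esub> a \<otimes>\<^bsub>A\<^esub> S \<beta> b)"
    and SS: "\<lbrakk>a \<in> carrier A; b \<in> carrier A\<rbrakk> \<Longrightarrow>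
      S \<alpha> a \<otimes>\<^bsub>A\<^esub> S \<beta> b = S (\<alpha> * \<beta>) (R \<alpha> a \<otimes>\<^bsub>A\<^esub> b \<oplus>\<^bsub>A\<^esub> a \<otimes>\<^bsub>A\<^esub> S \<beta> b)"

definition rbsf_hom ::
    "('k, 'm) ring_scheme \<Rightarrow>
     ('k, 'a, 'n) module_scheme \<Rightarrow> ('o \<Rightarrow> 'a \<Rightarrow> 'a) \<Rightarrow> ('o \<Rightarrow> 'a \<Rightarrow> 'a) \<Rightarrow>
     ('k, 'b, 'p) module_scheme \<Rightarrow> ('o \<Rightarrow> 'b \<Rightarrow> 'b) \<Rightarrow> ('o \<Rightarrow> 'b \<Rightarrow> 'b) \<Rightarrow> ('a \<Rightarrow> 'b) set" where
  "rbsf_hom K A R S B R' S' =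
     {\<phi> \<in> ring_hom A B.
        (\<forall>c\<in>carrier K. \<forall>a\<in>carrier A. \<phi> (c \<odot>\<^bsub>A\<^esub> a) = c \<odot>\<^bsub>B\<^esub> \<phi> a) \<and>
        (\<forall>\<omega>. \<forall>a\<in>carrier A. \<phi> (R \<omega> a) = R' \<omega> (\<phi> a) \<and> \<phi> (S \<omega> a) = S' \<omega> (\<phi> a))}"

text \<open>
  The type argument fixes the type of the elements of the test algebras \<open>B\<close> in the universal
  property.  The condition \<open>\<phi> \<in> extensional (carrier A)\<close> only normalises \<open>\<phi>\<close> outside the
  carrier, so that uniqueness is uniqueness on the carrier.
\<close>

definition free_rbsf ::
    "'b itself \<Rightarrow> ('k, 'm) ring_scheme \<Rightarrow> ('k, 'a, 'n) module_scheme \<Rightarrow>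
     ('o::semigroup_mult \<Rightarrow> 'a \<Rightarrow> 'a) \<Rightarrow> ('o \<Rightarrow> 'a \<Rightarrow> 'a) \<Rightarrow> 'x set \<Rightarrow> ('x \<Rightarrow> 'a) \<Rightarrow> bool" where
  "free_rbsf TYPE('b) K A R S X \<iota> \<longleftrightarrow>
     rb_system_family K A R S \<and> \<iota> \<in> X \<rightarrow> carrier A \<and>
     (\<forall>(B :: ('k, 'b) module) R' S' f.
        rb_system_family K B R' S' \<and> f \<in> X \<rightarrow> carrier B \<longrightarrow>
        (\<exists>!\<phi>. \<phi> \<in> extensional (carrier A) \<and> \<phi> \<in> rbsf_hom K A R S B R' S' \<and>
               (\<forall>x\<in>X. \<phi> (\<iota> x) = f x)))"


section \<open>Quotients and bases\<close>

definition quot_algebra :: "('k, 'a, 'm) module_scheme \<Rightarrow> 'a set \<Rightarrow> ('k, 'a set) module" where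
  "quot_algebra A I =
     ring.extend (A Quot I) (module.fields (\<lambda>c C. \<Union>a\<in>C. I +>\<^bsub>A\<^esub> (c \<odot>\<^bsub>A\<^esub> a)))"

definition quot_op :: "('a, 'm) ring_scheme \<Rightarrow> 'a set \<Rightarrow> ('a \<Rightarrow> 'a) \<Rightarrow> 'a set \<Rightarrow> 'a set" where
  "quot_op A I P C = (\<Union>a\<in>C. I +>\<^bsub>A\<^esub> P a)"

text \<open>
  A basis is given as a family \<open>b\<close> indexed by \<open>J\<close>; linear independence includes that the
  family is injective (unless the ring of scalars is trivial).
\<close>

definition module_basis ::
    "('k, 'm) ring_scheme \<Rightarrow> ('k, 'a, 'n) module_scheme \<Rightarrow> 'i set \<Rightarrow> ('i \<Rightarrow> 'a) \<Rightarrow> bool" where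
  "module_basis K M J b \<longleftrightarrow>
     b \<in> J \<rightarrow> carrier M \<and>
     (\<forall>m\<in>carrier M. \<exists>F c. finite F \<and> F \<subseteq> J \<and> c \<in> F \<rightarrow> carrier K \<and>
        m = (\<Oplus>\<^bsub>M\<^esub>i\<in>F. c i \<odot>\<^bsub>M\<^esub> b i)) \<and>
     (\<forall>F c. finite F \<and> F \<subseteq> J \<and> c \<in> F \<rightarrow> carrier K \<and>
        (\<Oplus>\<^bsub>M\<^esub>i\<in>F. c i \<odot>\<^bsub>M\<^esub> b i) = \<zero>\<^bsub>M\<^esub> \<longrightarrow> (\<forall>i\<in>F. c i = \<zero>\<^bsub>K\<^esub>))"


section \<open>The defining relations\<close>

text \<open>
  The operators are indexed by the disjoint union of two copies of the semigroup: \<open>Inl \<omega>\<close>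
  stands for the copy of \<open>\<omega>\<close> giving \<open>R\<^sub>\<omega>\<close> and \<open>Inr \<omega>\<close> for the one giving \<open>S\<^sub>\<omega>\<close>.
\<close>

abbreviation BR :: "'o \<Rightarrow> ('o + 'o, 'x) bword \<Rightarrow> ('o + 'o, 'x) bword" where
  "BR \<omega> u \<equiv> [Bracket (Inl \<omega>) u]"

abbreviation BS :: "'o \<Rightarrow> ('o + 'o, 'x) bword \<Rightarrow> ('o + 'o, 'x) bword" where
  "BS \<omega> u \<equiv> [Bracket (Inr \<omega>) u]"

definition S_SF :: "'x set \<Rightarrow> ('o::semigroup_mult + 'o, 'x, 'k::comm_ring_1) bpoly set" where
  "S_SF X =
     {wmon (BR \<alpha> u @ BR \<beta> v) - wmon (BR (\<alpha> * \<beta>) (BR \<alpha> u @ v)) - wmon (BR (\<alpha> * \<beta>) (u @ BS \<beta> v))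
        | u v \<alpha> \<beta>. u \<in> bwords X \<and> v \<in> bwords X} \<union>
     {wmon (BS \<alpha> u @ BS \<beta> v) - wmon (BS (\<alpha> * \<beta>) (BR \<alpha> u @ v)) - wmon (BS (\<alpha> * \<beta>) (u @ BS \<beta> v))
        | u v \<alpha> \<beta>. u \<in> bwords X \<and> v \<in> bwords X}"

end

theory Submission
  imports Defs
begin

text \<open>Three observations shape the argument. Both sides of a relation have the same degree,
  while the breadth drops from two to one; so the product of two brackets is the leading monomial,
  and most comparisons with an ambiguity are settled by breadth alone. A reduction preserves the
  kind: two R-brackets collapse to an R-bracket, two S-brackets to an S-bracket. Hence a collapse
  never changes whether a neighbouring factor can react, and all interaction stays at the junction
  of two words. Finally, inside the new bracket the left factor always becomes an R-bracket and the
  right one an S-bracket, whatever the outer kind; this is why the three-bracket computation closes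
  up, both for \<open>\<diamondop>\<close> and for the intersection compositions.

  The product \<open>dia\<close> is defined on all words, also on those that contain reducible
  parts. Associativity can then be proved by induction on the degree without carrying a condition of
  reducedness, and \<open>nf\<close> is a plain recursion over words. What confluence expresses for
  a rewriting system is here the associativity of \<open>\<diamondop>\<close>. The universal
  property is a separate matter: words are evaluated in a test algebra, and the kernel of the
  evaluation is an operated ideal.\<close>

text \<open>
  The order compares degree first, so it is well-founded by induction on the degree; being also
  total, it is a well order.  All compositions are resolved by hand: an intersection has the form
  \<open>\<lfloor>u\<rfloor>\<^sub>l\<lfloor>v\<rfloor>\<^sub>m\<lfloor>z\<rfloor>\<^sub>n\<close> with operators of one kind, an inclusion takes place inside one of the two
  brackets of a leading monomial.

  The basis is obtained without the composition-diamond lemma.  Rewriting at the junction of two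
  words gives a bilinear product \<open>\<diamondop>\<close> which is associative and for which the brackets satisfy the
  Rota-Baxter relations.  Hence the linear map \<open>nf\<close> sending concatenation to \<open>\<diamondop>\<close>, and commuting
  with the brackets, kills the ideal.  It fixes the irreducible words, so they are independent in
  the quotient; every \<open>f\<close> is congruent to \<open>nf f\<close>, a combination of irreducible words, so they
  span.
\<close>

section \<open>Bracketed words\<close>

lemma stage_mono: "stage X n \<subseteq> stage X (Suc n)"
proof (induction n)
  case 0
  show ?case unfolding stage.simps by (rule lists_mono) blast
next
  case (Suc n)
  then show ?case unfolding stage.simps(2) by (intro lists_mono Un_mono UN_mono image_mono) auto
qed

lemma stage_mono': "m \<le> n \<Longrightarrow> stage X m \<subseteq> stage X n"
  by (rule lift_Suc_mono_le[of "stage X"]) (rule stage_mono)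

text \<open>Membership in some stage turns out to be a condition on the letters alone, so it can be
  read off from the set function of the datatype.\<close>

definition bprimes :: "'x set \<Rightarrow> ('l, 'x) bprime set" where
  "bprimes X = {p. set2_bprime p \<subseteq> X}"

lemma in_stage_imp: "w \<in> stage X n \<Longrightarrow> set w \<subseteq> bprimes X"
proof (induction n arbitrary: w)
  case (Suc n)
  then show ?case by (fastforce simp: bprimes_def lists_eq_set)
qed (auto simp: bprimes_def lists_eq_set)

text \<open>The stages increase, so finitely many factors lie in a common one.\<close>

lemma list_in_stage: "(\<And>p. p \<in> set w \<Longrightarrow> \<exists>n. [p] \<in> stage X n) \<Longrightarrow> \<exists>n. w \<in> stage X n"
proof (induction w)
  case (Cons p w)
  obtain m where m: "[p] \<in> stage X m" using Cons.prems by auto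
  obtain n where n: "w \<in> stage X n" using Cons by auto
  have "[p] \<in> stage X (max m n)" "w \<in> stage X (max m n)"
    using m n stage_mono'[of m "max m n" X] stage_mono'[of n "max m n" X] by auto
  then have "p # w \<in> stage X (max m n)" by (cases "max m n") auto
  then show ?case by blast
qed (auto intro: exI[of _ 0])

lemma prime_in_stage: "p \<in> bprimes X \<Longrightarrow> \<exists>n. [p] \<in> stage X n"
proof (induction p)
  case (Letter x)
  then show ?case by (auto simp: bprimes_def intro!: exI[of _ 0])
next
  case (Bracket l w)
  have "\<exists>n. w \<in> stage X n"
    by (rule list_in_stage) (use Bracket in \<open>auto simp: bprimes_def\<close>)
  then obtain n where "w \<in> stage X n" ..
  then have "[Bracket l w] \<in> stage X (Suc n)" by auto
  then show ?case by blast
qed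

text \<open>Every word has finite nesting depth, hence sits in some stage as soon as its letters are
  allowed. From here on the stages are no longer mentioned.\<close>

lemma bwords_eq: "bwords (X :: 'x set) = (lists (bprimes X) :: ('l, 'x) bword set)"
proof (intro equalityI subsetI)
  fix w :: "('l, 'x) bword" assume "w \<in> bwords X"
  then show "w \<in> lists (bprimes X)" by (auto simp: bwords_def lists_eq_set dest: in_stage_imp)
next
  fix w :: "('l, 'x) bword" assume "w \<in> lists (bprimes X)"
  then show "w \<in> bwords X" unfolding bwords_def
    using list_in_stage[of w X] prime_in_stage[of _ X] by (simp add: lists_eq_set) blast
qed

lemma Letter_in_bprimes [simp]: "Letter x \<in> bprimes X \<longleftrightarrow> x \<in> X"
  and Bracket_in_bprimes [simp]: "Bracket l w \<in> bprimes X \<longleftrightarrow> w \<in> bwords X"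
  by (auto simp: bprimes_def bwords_eq lists_eq_set)

lemma Nil_in_bwords [simp]: "[] \<in> bwords X"
  and Cons_in_bwords [simp]: "p # w \<in> bwords X \<longleftrightarrow> p \<in> bprimes X \<and> w \<in> bwords X"
  and append_in_bwords [simp]: "u @ w \<in> bwords X \<longleftrightarrow> u \<in> bwords X \<and> w \<in> bwords X"
  by (auto simp: bwords_eq)

lemma in_bwords_primes: "p \<in> set w \<Longrightarrow> w \<in> bwords X \<Longrightarrow> p \<in> bprimes X"
  by (auto simp: bwords_eq)

text \<open>The induction rule of the nested datatype speaks of primes and of the members of lists.
  This form treats the content of the first bracket and the remaining word at once, which is how
  functions on words recurse.\<close>

lemma bword_induct [consumes 1, case_names Nil Letter Bracket]:
  assumes "w \<in> bwords X" and "P []"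
    and "\<And>x w. x \<in> X \<Longrightarrow> w \<in> bwords X \<Longrightarrow> P w \<Longrightarrow> P (Letter x # w)"
    and "\<And>l u w. u \<in> bwords X \<Longrightarrow> w \<in> bwords X \<Longrightarrow> P u \<Longrightarrow> P w \<Longrightarrow> P (Bracket l u # w)"
  shows "P w"
  using assms(1)
proof (induction w rule: measure_induct_rule[where f = "\<lambda>w. sum_list (map size w)"])
  case (less w)
  show ?case
  proof (cases w)
    case Nil then show ?thesis using assms(2) by simp
  next
    case (Cons p v)
    have v: "P v" "v \<in> bwords X" using less Cons by (cases p; simp)+
    show ?thesis
    proof (cases p)
      case (Letter x) then show ?thesis using assms(3) v less.prems Cons by auto
    next
      case (Bracket l u)
      \<comment> \<open>\<open>size_list\<close> additionally counts the list cells, so it bounds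
        the measure; the enclosing bracket makes the decrease strict.\<close>
      have "sum_list (map size u) \<le> size_list size u" by (induction u) auto
      then have "P u" using less Cons Bracket by auto
      then show ?thesis using assms(4) v less.prems Cons Bracket by auto
    qed
  qed
qed


lemma bword_induct_UNIV [case_names Nil Letter Bracket]:
  assumes "P []" "\<And>x w. P w \<Longrightarrow> P (Letter x # w)" "\<And>l u w. P u \<Longrightarrow> P w \<Longrightarrow> P (Bracket l u # w)"
  shows "P (w :: ('l, 'x) bword)"
proof -
  have "w \<in> bwords UNIV" by (auto simp: bwords_eq lists_eq_set bprimes_def)
  then show ?thesis by (induction rule: bword_induct) (use assms in auto)
qed


section \<open>The order on words\<close>

lemma wdeg_simps [simp]:
  "wdeg [] = 0" "wdeg (p # w) = deg_prime p + wdeg w" "wdeg (u @ v) = wdeg u + wdeg v"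
  by (auto simp: wdeg_def)

lemma deg_prime_Bracket [simp]: "deg_prime (Bracket l w) = Suc (wdeg w)"
  by (simp add: wdeg_def)

declare deg_prime.simps(2) [simp del]

lemma deg_prime_pos [simp]: "0 < deg_prime p"
  by (cases p) auto

lemma db_less_prime_deg: "db_less_prime rX rL p q \<Longrightarrow> deg_prime p \<le> deg_prime q"
  by (cases rule: db_less_prime.cases) auto

lemma db_less_deg: "db_less rX rL u v \<Longrightarrow> wdeg u \<le> wdeg v"
  by (cases rule: db_less.cases) auto

text \<open>A common context adds the same degree and the same breadth to both words and merely
  shifts the position of the first difference.\<close>

lemma db_less_context:
  assumes "db_less rX rL u v" shows "db_less rX rL (a @ u @ b) (a @ v @ b)"
  using assms
proof (cases rule: db_less.cases)
  case (factors z p s q t)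
  then show ?thesis
    using db_less_db_less_prime.factors[of "a @ z" p "s @ b" q "t @ b" rX rL] by simp
qed (simp_all add: db_less_db_less_prime.degree db_less_db_less_prime.breadth)

text \<open>The rule \<open>contents\<close> compares brackets of equal degree only; contents of
  different degree are decided by \<open>degree\<close> on the bracketed words.\<close>

lemma db_less_Bracket:
  assumes "db_less rX rL u v" shows "db_less rX rL [Bracket l u] [Bracket l v]"
proof -
  consider "wdeg u < wdeg v" | "wdeg u = wdeg v" using db_less_deg[OF assms] by linarith
  then show ?thesis
  proof cases
    case 2
    then have "db_less_prime rX rL (Bracket l u) (Bracket l v)"
      using assms by (intro contents) auto
    then show ?thesis using factors[of "[]" "Bracket l u" "[]" "Bracket l v" "[]"] 2 by simp
  qed (simp add: degree)
qed

section \<open>Replacing the hole, and its compatibility with the order\<close>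

abbreviation holes :: "('l, 'x option) bword \<Rightarrow> nat" where
  "holes q \<equiv> sum_list (map holes_prime q)"

lemma plug_simps [simp]:
  "plug [] u = []"
  "plug (Letter None # q) u = u @ plug q u"
  "plug (Letter (Some x) # q) u = Letter x # plug q u"
  "plug (Bracket l q' # q) u = Bracket l (plug q' u) # plug q u"
  "plug (q1 @ q2) u = plug q1 u @ plug q2 u"
  by (simp_all add: plug_def)

lemma star_induct [case_names Nil Hole Letter Bracket]:
  assumes "P []"
    and "\<And>q. P q \<Longrightarrow> P (Letter None # q)"
    and "\<And>x q. P q \<Longrightarrow> P (Letter (Some x) # q)"
    and "\<And>l q' q. P q' \<Longrightarrow> P q \<Longrightarrow> P (Bracket l q' # q)"
  shows "P (q :: ('l, 'x option) bword)"
proof (induction q rule: bword_induct_UNIV)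
  case (Letter x w)
  then show ?case using assms by (cases x) auto
qed (use assms in auto)

lemma plug_no_hole: "holes q = 0 \<Longrightarrow> plug q u = plug q v"
  by (induction q rule: star_induct) auto

lemma plug_in_bwords:
  "q \<in> bwords (insert None (Some ` X)) \<Longrightarrow> u \<in> bwords X \<Longrightarrow> plug q u \<in> bwords X"
  by (induction q rule: star_induct) auto

lemma star_plug_in_bwords: "q \<in> star_words X \<Longrightarrow> u \<in> bwords X \<Longrightarrow> plug q u \<in> bwords X"
  by (simp add: star_words_def plug_in_bwords)

text \<open>Induction along the path to the hole: at each level exactly one part contains the hole,
  and all others take the same value for \<open>u\<close> and \<open>v\<close>, so they form a
  context.\<close>

lemma db_less_plug:
  assumes "db_less rX rL u v"
  shows "holes q = 1 \<Longrightarrow> db_less rX rL (plug q u) (plug q v)"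
proof (induction q rule: star_induct)
  case (Hole q)
  then have "plug q u = plug q v" by (intro plug_no_hole) simp
  then show ?case using db_less_context[OF assms, of "[]" "plug q v"] by simp
next
  case (Letter x q)
  then have "db_less rX rL (plug q u) (plug q v)" by simp
  from db_less_context[OF this, of "[Letter x]" "[]"] show ?case by simp
next
  case (Bracket l q' q)
  then consider "holes q' = 1" "holes q = 0" | "holes q' = 0" "holes q = 1" by fastforce
  then show ?case
  proof cases
    case 1
    then have "plug q u = plug q v" by (intro plug_no_hole) simp
    then show ?thesis
      using 1 Bracket db_less_context[OF db_less_Bracket[of rX rL "plug q' u" "plug q' v" l],
        of "[]" "plug q v"] by simp
  next
    case 2
    then have "plug q' u = plug q' v" by (intro plug_no_hole) simp
    then show ?thesis
      using 2 Bracket db_less_context[of rX rL "plug q u" "plug q v" "[Bracket l (plug q' v)]" "[]"]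
      by simp
  qed
qed auto

section \<open>Totality of the order\<close>

text \<open>Words of equal degree and breadth are decided at their first differing factor.
  Comparability is assumed only for the factors of \<open>u\<close>, because inside the induction on
  primes it is known only for the factors of the bracket's content.\<close>

lemma db_less_total_words:
  assumes "\<And>p q. p \<in> set u \<Longrightarrow> q \<in> bprimes X \<Longrightarrow> p \<noteq> q \<Longrightarrow>
             db_less_prime rX rL p q \<or> db_less_prime rX rL q p"
    and "v \<in> bwords X" "u \<noteq> v"
  shows "db_less rX rL u v \<or> db_less rX rL v u"
proof -
  consider "wdeg u < wdeg v \<or> wdeg v < wdeg u"
    | "wdeg u = wdeg v" "length u < length v \<or> length v < length u"
    | "wdeg u = wdeg v" "length u = length v" by linarith
  then show ?thesis
  proof cases
    case 3
    obtain z p s q t where uv: "u = z @ p # s" "v = z @ q # t" "p \<noteq> q" "length s = length t"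
      using same_length_different[OF assms(3) 3(2)] 3(2)
      by (metis append_Cons append_Nil add_left_cancel length_append length_Cons nat.inject)
    then have "db_less_prime rX rL p q \<or> db_less_prime rX rL q p"
      using assms(1)[of p q] assms(2) by auto
    then show ?thesis using uv 3 factors[of z p s q t rX rL] factors[of z q t p s rX rL] by auto
  qed (auto intro: degree breadth)
qed

lemma db_less_prime_total:
  assumes "total_on X rX" "total_on UNIV rL"
  shows "p \<in> bprimes X \<Longrightarrow> q \<in> bprimes X \<Longrightarrow> p \<noteq> q \<Longrightarrow>
           db_less_prime rX rL p q \<or> db_less_prime rX rL q p"
proof (induction p arbitrary: q)
  case (Letter x)
  show ?case
  proof (cases q)
    case (Letter y)
    then show ?thesis using Letter.prems \<open>total_on X rX\<close>
      by (auto simp: total_on_def intro: letters)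
  next
    case (Bracket l w)
    \<comment> \<open>A letter has degree one, so it ties in degree only with the bracket of the
      empty word.\<close>
    then show ?thesis by (cases "wdeg w = 0") (auto intro: letter_bracket prime_degree)
  qed
next
  case (Bracket l u)
  show ?case
  proof (cases q)
    case (Letter y)
    then show ?thesis by (cases "wdeg u = 0") (auto intro: letter_bracket prime_degree)
  next
    case q: (Bracket m v)
    consider "wdeg u < wdeg v \<or> wdeg v < wdeg u" | "wdeg u = wdeg v" "l \<noteq> m"
      | "wdeg u = wdeg v" "l = m" by linarith
    then show ?thesis
    proof cases
      case 1 then show ?thesis using q by (auto intro: prime_degree)
    next
      case 2 then show ?thesis using q \<open>total_on UNIV rL\<close>
        by (auto simp: total_on_def intro!: operators)
    next
      case 3
      then have "db_less rX rL u v \<or> db_less rX rL v u"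
        by (intro db_less_total_words[of u X])
          (use Bracket q in \<open>auto intro!: Bracket.IH dest: in_bwords_primes\<close>)
      then show ?thesis using 3 q by (auto intro: contents)
    qed
  qed
qed

lemma db_less_total:
  assumes "total_on X rX" "total_on UNIV rL" "u \<in> bwords X" "v \<in> bwords X" "u \<noteq> v"
  shows "db_less rX rL u v \<or> db_less rX rL v u"
  by (rule db_less_total_words[of u X])
    (use assms in_bwords_primes db_less_prime_total[OF assms(1,2)] in blast)+

section \<open>Well-foundedness of the order\<close>

text \<open>Among the elements of least degree of a nonempty set choose a minimal one of that level.
  A predecessor has no larger degree, so inside the set it would lie on the same level.\<close>

lemma wf_graded:
  fixes d :: "'a \<Rightarrow> nat"
  assumes mono: "\<And>x y. (x, y) \<in> r \<Longrightarrow> d x \<le> d y"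
    and level: "\<And>n. wf {(x, y) \<in> r. d x = n \<and> d y = n}"
  shows "wf r"
  unfolding wf_eq_minimal
proof (intro allI impI)
  fix Q :: "'a set" and x assume "x \<in> Q"
  then obtain y where y: "y \<in> Q" "\<forall>z\<in>Q. d y \<le> d z"
    using arg_min_nat_lemma[of "\<lambda>x. x \<in> Q" x d] by blast
  obtain z where z: "z \<in> Q" "d z = d y"
    "\<And>x. (x, z) \<in> {(x', y') \<in> r. d x' = d y \<and> d y' = d y} \<Longrightarrow> x \<notin> {x \<in> Q. d x = d y}"
    using wfE_min[OF level[of "d y"], of y "{x \<in> Q. d x = d y}"] y(1)
    by (metis (mono_tags, lifting) mem_Collect_eq)
  have "x \<notin> Q" if "(x, z) \<in> r" for x
    using that z y mono[OF that] by force
  with z(1) show "\<exists>z\<in>Q. \<forall>y. (y, z) \<in> r \<longrightarrow> y \<notin> Q" by blast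
qed

definition word_rel :: "'x set \<Rightarrow> 'x rel \<Rightarrow> 'l rel \<Rightarrow> ('l, 'x) bword rel" where
  "word_rel X rX rL = {(u, v). u \<in> bwords X \<and> v \<in> bwords X \<and> db_less rX rL u v}"

definition prime_rel :: "'x set \<Rightarrow> 'x rel \<Rightarrow> 'l rel \<Rightarrow> ('l, 'x) bprime rel" where
  "prime_rel X rX rL = {(p, q). p \<in> bprimes X \<and> q \<in> bprimes X \<and> db_less_prime rX rL p q}"

text \<open>A bracket of degree n has content of degree n - 1, so on one level the primes embed into
  a lexicographic product of well-founded relations.\<close>

lemma wf_prime_level:
  fixes rX :: "'x rel" and rL :: "'l rel"
  assumes "wf (rX - Id)" "wf (rL - Id)"
    and "\<And>m. m < n \<Longrightarrow> wf {(u, v) \<in> word_rel X rX rL. wdeg u = m \<and> wdeg v = m}"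
  shows "wf {(p, q) \<in> prime_rel X rX rL. deg_prime p = n \<and> deg_prime q = n}" (is "wf ?R")
proof (cases n)
  case 0
  then have "?R = {}" by auto
  then show ?thesis by (simp only: wf_def) simp
next
  case (Suc m)
  \<comment> \<open>The tag 0 or 1 puts letters before brackets. For equal tags the
    \<open>undefined\<close> entries coincide, so the lexicographic comparison passes over
    them.\<close>
  define key where "key p = (case p of Letter x \<Rightarrow> (0 :: nat, x, undefined, undefined)
    | Bracket l w \<Rightarrow> (1, undefined, l, w))" for p :: "('l, 'x) bprime"
  let ?W = "{(u, v) \<in> word_rel X rX rL. wdeg u = m \<and> wdeg v = m}"
  let ?L = "less_than <*lex*> (rX - Id) <*lex*> (rL - Id) <*lex*> ?W"
  have "wf ?L" using assms Suc by (intro wf_lex_prod) auto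
  then have "wf (inv_image ?L key)" by (rule wf_inv_image)
  moreover have "?R \<subseteq> inv_image ?L key"
  proof (rule subrelI)
    fix p q assume "(p, q) \<in> ?R"
    then have *: "(p, q) \<in> prime_rel X rX rL" "deg_prime p = n" "deg_prime q = n" by auto
    then have "db_less_prime rX rL p q" by (simp add: prime_rel_def)
    then show "(p, q) \<in> inv_image ?L key"
      by cases (use * Suc in \<open>auto simp: key_def in_inv_image prime_rel_def word_rel_def\<close>)
  qed
  ultimately show ?thesis by (rule wf_subset)
qed

text \<open>Lexicographic comparison of lists of unbounded length need not be well-founded;
  comparing the breadth first makes it the order \<open>lenlex\<close>, which is. The factors of a
  word of degree n have degree at most n.\<close>

lemma wf_word_level:
  assumes "\<And>m. m \<le> n \<Longrightarrow> wf {(p, q) \<in> prime_rel X rX rL. deg_prime p = m \<and> deg_prime q = m}"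
  shows "wf {(u, v) \<in> word_rel X rX rL. wdeg u = n \<and> wdeg v = n}" (is "wf ?R")
proof -
  let ?P = "{(p, q) \<in> prime_rel X rX rL. deg_prime p \<le> n \<and> deg_prime q \<le> n}"
  have "wf ?P"
  proof (rule wf_graded[where d = deg_prime])
    fix m
    show "wf {(x, y) \<in> ?P. deg_prime x = m \<and> deg_prime y = m}"
      by (cases "m \<le> n") (auto intro: wf_subset[OF assms])
  qed (auto simp: prime_rel_def dest: db_less_prime_deg)
  then have "wf (lenlex ?P)" by (rule wf_lenlex)
  moreover have "?R \<subseteq> lenlex ?P"
  proof (rule subrelI)
    fix u v assume "(u, v) \<in> ?R"
    then have *: "(u, v) \<in> word_rel X rX rL" "wdeg u = n" "wdeg v = n" by auto
    then have "db_less rX rL u v" by (simp add: word_rel_def)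
    then show "(u, v) \<in> lenlex ?P"
    proof cases
      case (factors z p s q t)
      then have "(p, q) \<in> ?P"
        using * by (auto simp: word_rel_def prime_rel_def)
      then show ?thesis using factors by (auto simp: lenlex_conv lex_conv)
    qed (use * in \<open>auto simp: lenlex_conv\<close>)
  qed
  ultimately show ?thesis by (rule wf_subset)
qed

text \<open>Words of degree n reduce to primes of degree at most n, and these to contents of degree
  less than n; this closes the induction.\<close>

lemma wf_word_rel:
  assumes "wf (rX - Id)" "wf (rL - Id)"
  shows "wf (word_rel X rX rL)"
proof (rule wf_graded[where d = wdeg])
  fix n
  show "wf {(u, v) \<in> word_rel X rX rL. wdeg u = n \<and> wdeg v = n}"
  proof (induction n rule: less_induct)
    case (less n)
    show ?case
      by (rule wf_word_level, rule wf_prime_level) (use assms less in auto)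
  qed
qed (auto simp: word_rel_def dest: db_less_deg)

text \<open>Transitivity comes for free: by totality its failure would produce a cycle of length at
  most three. This spares a transitivity proof for the mutually inductive
  \<open>db_less\<close>.\<close>

lemma well_order_on_wf_total:
  assumes "wf s" "s \<subseteq> A \<times> A" "total_on A s"
  shows "well_order_on A (s \<union> Id_on A)"
proof -
  have 1: "(x, x) \<notin> s" for x using assms(1) by auto
  have 2: "(y, x) \<notin> s" if "(x, y) \<in> s" for x y using wf_not_sym[OF assms(1)] that by blast
  have 3: "(x, z) \<in> s" if "(x, y) \<in> s" "(y, z) \<in> s" for x y z
  proof -
    have "(z, x) \<notin> s"
    proof
      assume "(z, x) \<in> s"
      \<comment> \<open>A cycle would be a nonempty set without a minimal element.\<close>
      then obtain m where "m \<in> {x, y, z}" "\<And>y'. (y', m) \<in> s \<Longrightarrow> y' \<notin> {x, y, z}"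
        using wfE_min[OF assms(1), of x "{x, y, z}"] by blast
      then show False using that \<open>(z, x) \<in> s\<close> by blast
    qed
    then show ?thesis using that 2 assms(2,3) by (metis mem_Sigma_iff subsetD total_on_def)
  qed
  have "wf (s \<union> Id_on A - Id)" by (rule wf_subset[OF assms(1)]) auto
  moreover have "trans (s \<union> Id_on A)" by (rule transI) (use 3 in \<open>auto simp: Id_on_iff\<close>)
  moreover have "antisym (s \<union> Id_on A)" by (rule antisymI) (use 2 in \<open>auto simp: Id_on_iff\<close>)
  ultimately show ?thesis unfolding order_on_defs
    using assms(2,3) by (auto simp: refl_on_def total_on_def)
qed

lemma db_order_eq: "db_order X rX rL = word_rel X rX rL \<union> Id_on (bwords X)"
  by (auto simp: db_order_def word_rel_def)

locale db_setup =
  fixes X :: "'x set" and rX :: "'x rel" and rL :: "'l rel"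
  assumes wo_X: "well_order_on X rX" and wo_L: "well_order_on UNIV rL"
begin

abbreviation "ord \<equiv> db_order X rX rL"

lemma db_less_irrefl: "u \<in> bwords X \<Longrightarrow> \<not> db_less rX rL u u"
  using wf_word_rel[of rX rL X] wo_X wo_L unfolding well_order_on_def
  by (metis (mono_tags, lifting) case_prodI mem_Collect_eq wf_not_refl word_rel_def)

lemma ord_strict_iff:
  "(u, v) \<in> ord \<and> u \<noteq> v \<longleftrightarrow> u \<in> bwords X \<and> v \<in> bwords X \<and> db_less rX rL u v"
  using db_less_irrefl by (auto simp: db_order_def)

lemma well_order_db: "well_order_on (bwords X) ord"
  unfolding db_order_eq
proof (rule well_order_on_wf_total)
  show "wf (word_rel X rX rL)" using wf_word_rel wo_X wo_L by (auto simp: well_order_on_def)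
  show "total_on (bwords X) (word_rel X rX rL)"
    using db_less_total[of X rX rL] wo_X wo_L
    by (auto simp: total_on_def[of "bwords X"] word_rel_def well_order_on_def linear_order_on_def)
qed (auto simp: word_rel_def)

theorem monomial_order_db: "monomial_order X ord"
  unfolding monomial_order_def
proof (intro conjI[of "well_order_on _ _"] well_order_db ballI allI impI; unfold ord_strict_iff)
  fix q :: "('l, 'x option) bword" and u v
  assume "q \<in> star_words X" "u \<in> bwords X \<and> v \<in> bwords X \<and> db_less rX rL u v"
  then show "plug q u \<in> bwords X \<and> plug q v \<in> bwords X \<and> db_less rX rL (plug q u) (plug q v)"
    by (auto intro: star_plug_in_bwords db_less_plug simp: star_words_def)
qed

end


section \<open>Linear maps on the algebra of bracketed words\<close>

abbreviation single :: "'a \<Rightarrow> 'b::zero \<Rightarrow> 'a \<Rightarrow>\<^sub>0 'b" where "single \<equiv> Poly_Mapping.single"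
abbreviation keys :: "('a \<Rightarrow>\<^sub>0 'b::zero) \<Rightarrow> 'a set" where "keys \<equiv> Poly_Mapping.keys"
abbreviation lookup :: "('a \<Rightarrow>\<^sub>0 'b::zero) \<Rightarrow> 'a \<Rightarrow> 'b" where "lookup \<equiv> Poly_Mapping.lookup"

lemma wmon_mult: "wmon u * wmon v = wmon (u @ v)"
  by (simp add: wmon_def mult_single plus_list_def)

lemma wmon_Nil: "wmon [] = 1"
  by (simp add: wmon_def zero_list_def flip: single_one)

lemma lookup_wmon: "lookup (wmon w) v = (if v = w then 1 else 0)"
  by (simp add: wmon_def lookup_single when_def)

lemma keys_wmon: "keys (wmon w :: ('l, 'x, 'k::comm_ring_1) bpoly) = {w}"
  by (simp add: wmon_def)

lemma lookup_scale [simp]: "lookup (bpoly_scale c f) w = c * lookup f w"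
  by (simp add: bpoly_scale_def map.rep_eq when_def)

lemma scale_simps [simp]:
  "bpoly_scale 1 f = f" "bpoly_scale 0 f = 0" "bpoly_scale c 0 = 0"
  "bpoly_scale c (bpoly_scale d f) = bpoly_scale (c * d) f"
  by (auto intro!: poly_mapping_eqI simp: algebra_simps)

lemma scale_minus: "bpoly_scale (- c) f = - bpoly_scale c f"
  by (auto intro!: poly_mapping_eqI)

lemma scale_add: "bpoly_scale c (f + g) = bpoly_scale c f + bpoly_scale c g"
  and scale_add_left: "bpoly_scale (c + d) f = bpoly_scale c f + bpoly_scale d f"
  by (auto intro!: poly_mapping_eqI simp: lookup_add algebra_simps)

lemma scale_diff: "bpoly_scale c (f - g) = bpoly_scale c f - bpoly_scale c g"
  by (rule poly_mapping_eqI) (simp add: lookup_minus right_diff_distrib)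

lemma scale_sum: "bpoly_scale c (sum F A) = (\<Sum>a\<in>A. bpoly_scale c (F a))"
  by (induction A rule: infinite_finite_induct) (auto simp: scale_add)

lemma single_eq_scale: "single w c = bpoly_scale c (wmon w)"
  by (auto intro!: poly_mapping_eqI simp: lookup_single lookup_wmon when_def)

lemma keys_scale: "keys (bpoly_scale c f) \<subseteq> keys f"
  by (auto simp: in_keys_iff)

lemma bpoly_expand:
  assumes "finite F" "keys f \<subseteq> F"
  shows "f = (\<Sum>w\<in>F. bpoly_scale (lookup f w) (wmon w))"
proof (rule poly_mapping_eqI)
  fix v
  have "(\<Sum>w\<in>F. lookup f w * lookup (wmon w) v) = (\<Sum>w\<in>F. if w = v then lookup f w else 0)"
    by (intro sum.cong) (auto simp: lookup_wmon)
  also have "\<dots> = lookup f v" using assms by (auto simp: in_keys_iff)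
  finally show "lookup f v = lookup (\<Sum>w\<in>F. bpoly_scale (lookup f w) (wmon w)) v"
    by (simp add: lookup_sum)
qed

lemma bpoly_induct [consumes 1, case_names zero mon add]:
  assumes "keys f \<subseteq> W" and "P 0"
    and mon: "\<And>c w. w \<in> W \<Longrightarrow> P (bpoly_scale c (wmon w))"
    and add: "\<And>f g. keys f \<subseteq> W \<Longrightarrow> keys g \<subseteq> W \<Longrightarrow> P f \<Longrightarrow> P g \<Longrightarrow> P (f + g)"
  shows "P (f :: ('l, 'x, 'k::comm_ring_1) bpoly)"
proof -
  have "P (\<Sum>w\<in>F. bpoly_scale (c w) (wmon w)) \<and> keys (\<Sum>w\<in>F. bpoly_scale (c w) (wmon w)) \<subseteq> W"
    if "finite F" "F \<subseteq> W" for F and c :: "('l, 'x) bword \<Rightarrow> 'k"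
    using that
  proof induction
    case (insert w F)
    let ?g = "\<Sum>w\<in>F. bpoly_scale (c w) (wmon w)"
    have "keys (bpoly_scale (c w) (wmon w)) \<subseteq> W"
      using keys_scale[of "c w" "wmon w"] insert.prems by (auto simp: keys_wmon)
    moreover have "P (bpoly_scale (c w) (wmon w))" using insert.prems by (intro mon) simp
    moreover have "P ?g" "keys ?g \<subseteq> W" using insert.IH insert.prems by simp_all
    ultimately have "P (bpoly_scale (c w) (wmon w) + ?g)" "keys (bpoly_scale (c w) (wmon w) + ?g) \<subseteq> W"
      using add[of "bpoly_scale (c w) (wmon w)" ?g] keys_add[of "bpoly_scale (c w) (wmon w)" ?g] by auto
    then show ?case by (simp only: sum.insert[OF insert.hyps])
  qed (use \<open>P 0\<close> in auto)
  then have "P (\<Sum>w\<in>keys f. bpoly_scale (lookup f w) (wmon w))" using assms(1) by auto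
  then show ?thesis using bpoly_expand[OF finite_keys order_refl, of f] by (rule back_subst[OF _ sym])
qed

lemma bpoly_induct_UNIV [case_names zero mon add]:
  assumes "P 0" "\<And>c w. P (bpoly_scale c (wmon w))" "\<And>f g. P f \<Longrightarrow> P g \<Longrightarrow> P (f + g)"
  shows "P (f :: ('l, 'x, 'k::comm_ring_1) bpoly)"
  by (rule bpoly_induct[of f UNIV]) (use assms in auto)

section \<open>Linear maps determined by their values on words\<close>

definition lin :: "(('l, 'x, 'k::comm_ring_1) bpoly \<Rightarrow> ('m, 'y, 'k) bpoly) \<Rightarrow> bool" where
  "lin F \<longleftrightarrow> (\<forall>f g. F (f + g) = F f + F g) \<and> (\<forall>c f. F (bpoly_scale c f) = bpoly_scale c (F f))"

lemma lin_addD: "lin F \<Longrightarrow> F (f + g) = F f + F g"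
  and lin_scaleD: "lin F \<Longrightarrow> F (bpoly_scale c f) = bpoly_scale c (F f)"
  by (auto simp: lin_def)

lemma lin_zero: "lin F \<Longrightarrow> F 0 = 0"
  using lin_addD[of F 0 0] by simp

lemma lin_uminus: "lin F \<Longrightarrow> F (- f) = - F f"
  using lin_scaleD[of F "-1" f] by (simp add: scale_minus)

lemma lin_diff: "lin F \<Longrightarrow> F (f - g) = F f - F g"
  using lin_addD[of F f "- g"] by (simp add: lin_uminus)

lemma lin_eq_on:
  assumes "lin F" "lin G" "\<And>w. w \<in> W \<Longrightarrow> F (wmon w) = G (wmon w)" "keys f \<subseteq> W"
  shows "F f = G f"
  using assms(4)
  by (induction rule: bpoly_induct) (use assms in \<open>auto simp: lin_zero lin_addD lin_scaleD\<close>)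

text \<open>This rule reduces multilinear identities to words, one argument at a time.\<close>

lemma lin_eqI:
  assumes "lin F" "lin G" "\<And>w. F (wmon w) = G (wmon w)"
  shows "F f = G f"
  by (rule lin_eq_on[OF assms(1,2), where W = UNIV]) (auto simp: assms(3))

text \<open>Scaling is multiplication by a constant, so its compatibility with products follows from
  associativity and from the centrality of constants.\<close>

lemma single_scale_mult: "bpoly_scale c f = single [] c * f"
proof -
  have "lookup (single [] c * f) w = lookup (bpoly_scale c f) w" for w
  proof (induction f rule: bpoly_induct_UNIV)
    case (mon d v)
    show ?case
      by (simp add: single_eq_scale[symmetric] mult_single plus_list_def lookup_single when_def lookup_wmon)
  qed (auto simp: lookup_add algebra_simps)
  then show ?thesis by (metis poly_mapping_eqI)
qed

lemma scale_mult_left: "bpoly_scale c f * g = bpoly_scale c (f * g)"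
  by (simp add: single_scale_mult mult.assoc)

lemma scale_mult_right: "f * bpoly_scale c g = bpoly_scale c (f * g)"
proof -
  have "f * single [] c = single [] c * f"
  proof (induction f rule: bpoly_induct_UNIV)
    case (mon d v)
    show ?case by (simp add: single_eq_scale[symmetric] mult_single plus_list_def mult.commute)
  qed (auto simp: algebra_simps)
  then show ?thesis by (simp add: single_scale_mult flip: mult.assoc)
qed

definition lin_extend :: "(('l, 'x) bword \<Rightarrow> ('m, 'y, 'k::comm_ring_1) bpoly) \<Rightarrow> ('l, 'x, 'k) bpoly \<Rightarrow>
    ('m, 'y, 'k) bpoly" where
  "lin_extend h f = (\<Sum>w\<in>keys f. bpoly_scale (lookup f w) (h w))"

text \<open>Two polynomials and their sum have different supports; summing over a common finite
  superset makes the sums comparable.\<close>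

lemma lin_extend_superset:
  assumes "finite F" "keys f \<subseteq> F" shows "lin_extend h f = (\<Sum>w\<in>F. bpoly_scale (lookup f w) (h w))"
  unfolding lin_extend_def by (rule sum.mono_neutral_left) (use assms in \<open>auto simp: in_keys_iff\<close>)

lemma lin_extend_wmon [simp]: "lin_extend h (wmon w) = h w"
  by (simp add: lin_extend_def keys_wmon lookup_wmon)

lemma lin_lin_extend: "lin (lin_extend h)"
proof -
  have "lin_extend h (f + g) = lin_extend h f + lin_extend h g" for f g
    using keys_add[of f g]
    by (simp add: lin_extend_superset[of "keys f \<union> keys g"] lookup_add scale_add_left sum.distrib)
  moreover have "lin_extend h (bpoly_scale c f) = bpoly_scale c (lin_extend h f)" for c f
    by (simp add: lin_extend_superset[of "keys f"] keys_scale scale_sum)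
  ultimately show ?thesis by (simp add: lin_def)
qed

lemma lin_extend_add_fun: "lin_extend (\<lambda>w. F w + G w) f = lin_extend F f + lin_extend G f"
  and lin_extend_scale_fun: "lin_extend (\<lambda>w. bpoly_scale c (F w)) f = bpoly_scale c (lin_extend F f)"
  by (simp_all add: lin_extend_def scale_add sum.distrib scale_sum mult.commute)

text \<open>Each rule speaks of an expression in a linearly occurring \<open>F f\<close>, so
  linearity of a compound expression is proved by following its syntax with
  \<open>intro\<close>.\<close>

lemma lin_intros:
  "lin (\<lambda>f. f)"
  "lin F \<Longrightarrow> lin (\<lambda>f. lin_extend h (F f))"
  "lin F \<Longrightarrow> lin G \<Longrightarrow> lin (\<lambda>f. F f + G f)"
  "lin F \<Longrightarrow> lin G \<Longrightarrow> lin (\<lambda>f. F f - G f)"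
  "lin F \<Longrightarrow> lin (\<lambda>f. a * F f)"
  "lin F \<Longrightarrow> lin (\<lambda>f. F f * b)"
  by (simp_all add: lin_def lin_addD[OF lin_lin_extend] lin_scaleD[OF lin_lin_extend] scale_add scale_diff
      scale_mult_left scale_mult_right distrib_left distrib_right)

lemma lin_ext_conv: "lin_ext \<phi> = lin_extend (\<lambda>w. wmon (\<phi> w))"
  by (rule ext) (simp add: lin_ext_def lin_extend_def single_eq_scale)

lemma lin_ext_wmon [simp]: "lin_ext \<phi> (wmon w) = wmon (\<phi> w)"
  by (simp add: lin_ext_conv)

lemma lin_lin_ext: "lin F \<Longrightarrow> lin (\<lambda>f. lin_ext \<phi> (F f))"
  unfolding lin_ext_conv by (rule lin_intros)

lemma bracket_op_wmon [simp]: "bracket_op l (wmon w) = wmon [Bracket l w]"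
  by (simp add: bracket_op_def)

lemma lin_bracket_op: "lin F \<Longrightarrow> lin (\<lambda>f. bracket_op l (F f))"
  unfolding bracket_op_def by (rule lin_lin_ext)

lemma keys_ext: "keys (lin_extend h f) \<subseteq> (\<Union>w\<in>keys f. keys (h w))"
proof -
  have "keys (lin_extend h f) \<subseteq> (\<Union>w\<in>keys f. keys (bpoly_scale (lookup f w) (h w)))"
    unfolding lin_extend_def by (rule keys_sum)
  then show ?thesis using keys_scale by blast
qed

lemma keys_lin_ext: "keys (lin_ext \<phi> f :: ('l, 'x, 'k::comm_ring_1) bpoly) \<subseteq> \<phi> ` keys f"
  using keys_ext[of "\<lambda>w. wmon (\<phi> w)" f] by (auto simp: lin_ext_conv keys_wmon)

lemma keys_bracket_op: "keys (bracket_op l f) \<subseteq> (\<lambda>w. [Bracket l w]) ` keys f"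
  unfolding bracket_op_def by (rule keys_lin_ext)

lemma keys_mult': "keys (f * g :: ('l, 'x, 'k::comm_ring_1) bpoly) \<subseteq> {u @ v | u v. u \<in> keys f \<and> v \<in> keys g}"
  using keys_mult[of f g] by (auto simp: plus_list_def)


section \<open>The reduced product\<close>

text \<open>
  The two families of relations differ only in the outer operators, so they are treated as one:
  \<open>toR l\<close> and \<open>toS l\<close> are the operators of the two kinds with the same index as \<open>l\<close>, and
  \<open>opmul l m\<close> is of use only for \<open>l\<close>, \<open>m\<close> of the same kind.
\<close>

definition idx :: "'o + 'o \<Rightarrow> 'o" where "idx = case_sum id id"
definition toR :: "'o + 'o \<Rightarrow> 'o + 'o" where "toR l = Inl (idx l)"
definition toS :: "'o + 'o \<Rightarrow> 'o + 'o" where "toS l = Inr (idx l)"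
definition opmul :: "'o::semigroup_mult + 'o \<Rightarrow> 'o + 'o \<Rightarrow> 'o + 'o" where
  "opmul l m = (if isl l then Inl else Inr) (idx l * idx m)"

text \<open>Associativity of the semigroup enters here. That \<open>toR\<close> and
  \<open>toS\<close> commute with \<open>opmul\<close> reflects that both kinds carry the same
  indices.\<close>

lemma op_simps [simp]:
  "isl (opmul l m) \<longleftrightarrow> isl l" "isl (toR l)" "\<not> isl (toS l)"
  "toR (opmul l m) = opmul (toR l) (toR m)" "toS (opmul l m) = opmul (toS l) (toS m)"
  "opmul (opmul l m) n = opmul l (opmul m n)"
  "toR (toR l) = toR l" "toR (toS l) = toR l" "toS (toR l) = toS l" "toS (toS l) = toS l"
  by (auto simp: opmul_def toR_def toS_def idx_def mult.assoc)

definition rb_rel :: "'o + 'o \<Rightarrow> ('o + 'o, 'x) bword \<Rightarrow> 'o + 'o \<Rightarrow> ('o + 'o, 'x) bword \<Rightarrow>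
    ('o::semigroup_mult + 'o, 'x, 'k::comm_ring_1) bpoly" where
  "rb_rel l u m v = wmon [Bracket l u, Bracket m v]
     - wmon [Bracket (opmul l m) (Bracket (toR l) u # v)]
     - wmon [Bracket (opmul l m) (u @ [Bracket (toS m) v])]"

lemma S_SF_eq:
  "S_SF X = {rb_rel l u m v | l u m v. isl l = isl m \<and> u \<in> bwords X \<and> v \<in> bwords X}" (is "?A = ?B")
proof (intro equalityI subsetI)
  fix f assume "f \<in> ?A"
  then consider u v \<alpha> \<beta> where "u \<in> bwords X" "v \<in> bwords X" "f = rb_rel (Inl \<alpha>) u (Inl \<beta>) v"
    | u v \<alpha> \<beta> where "u \<in> bwords X" "v \<in> bwords X" "f = rb_rel (Inr \<alpha>) u (Inr \<beta>) v"
    by (auto simp: S_SF_def rb_rel_def opmul_def toR_def toS_def idx_def)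
  then show "f \<in> ?B"
  proof cases
    case 1
    then show ?thesis
      by (intro CollectI exI[of _ "Inl \<alpha>"] exI[of _ "Inl \<beta>"] exI[of _ u] exI[of _ v]) simp
  next
    case 2
    then show ?thesis
      by (intro CollectI exI[of _ "Inr \<alpha>"] exI[of _ "Inr \<beta>"] exI[of _ u] exI[of _ v]) simp
  qed
next
  fix f assume "f \<in> ?B"
  then obtain l u m v where *: "isl l = isl m" "u \<in> bwords X" "v \<in> bwords X" "f = rb_rel l u m v"
    by auto
  then consider \<alpha> \<beta> where "l = Inl \<alpha>" "m = Inl \<beta>" | \<alpha> \<beta> where "l = Inr \<alpha>" "m = Inr \<beta>"
    by (cases l; cases m) auto
  then show "f \<in> ?A"
  proof cases
    case 1
    then show ?thesis unfolding S_SF_def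
      by (intro UnI1 CollectI exI[of _ u] exI[of _ v] exI[of _ \<alpha>] exI[of _ \<beta>])
        (use * in \<open>simp add: rb_rel_def opmul_def toR_def toS_def idx_def\<close>)
  next
    case 2
    then show ?thesis unfolding S_SF_def
      by (intro UnI2 CollectI exI[of _ u] exI[of _ v] exI[of _ \<alpha>] exI[of _ \<beta>])
        (use * in \<open>simp add: rb_rel_def opmul_def toR_def toS_def idx_def\<close>)
  qed
qed

text \<open>Two adjacent factors clash when their product has the shape of a leading monomial of
  \<open>S_SF\<close>.\<close>

fun clash :: "('o + 'o, 'x) bprime \<Rightarrow> ('o + 'o, 'x) bprime \<Rightarrow> bool" where
  "clash (Bracket l u) (Bracket m v) \<longleftrightarrow> isl l = isl m"
| "clash _ _ \<longleftrightarrow> False"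

text \<open>
  The product of \<open>a\<close> and \<open>b\<close> with the reduction forced wherever a factor of \<open>a\<close> meets one of \<open>b\<close>.
\<close>

function dia :: "('o + 'o, 'x) bword \<Rightarrow> ('o + 'o, 'x) bword \<Rightarrow> ('o::semigroup_mult
    + 'o, 'x, 'k::comm_ring_1) bpoly" where
  "dia a b = (if a \<noteq> [] \<and> b \<noteq> [] \<and> clash (last a) (hd b) then
     (case last a of Letter x \<Rightarrow> 0 | Bracket l u \<Rightarrow>
     (case hd b of Letter x \<Rightarrow> 0 | Bracket m v \<Rightarrow>
        wmon (butlast a) *
        bracket_op (opmul l m) (dia [Bracket (toR l) u] v + dia u [Bracket (toS m) v]) *
        wmon (tl b)))
     else wmon (a @ b))"
  by pat_completeness auto
termination
\<comment> \<open>Changing the kind of a bracket keeps its degree, and each recursive call drops at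
  least one of the two clashing brackets.\<close>
proof (relation "measure (\<lambda>(a, b). wdeg a + wdeg b)")
  fix a b :: "('o + 'o, 'x) bword" and l u m v
  assume *: "a \<noteq> [] \<and> b \<noteq> [] \<and> clash (last a) (hd b)" "last a = Bracket l u" "hd b = Bracket m v"
  then have "wdeg a = wdeg (butlast a) + wdeg [Bracket l u]" "wdeg b = wdeg [Bracket m v] + wdeg (tl b)"
    by (metis append_butlast_last_id wdeg_simps(3), metis append_Cons append_Nil list.exhaust_sel
        wdeg_simps(3))
  then show "(([Bracket (toR l) u], v), a, b) \<in> measure (\<lambda>(a, b). wdeg a + wdeg b)"
    "((u, [Bracket (toS m) v]), a, b) \<in> measure (\<lambda>(a, b). wdeg a + wdeg b)" by auto
qed auto

declare dia.simps [simp del]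

text \<open>A clash occurs only between brackets, so the values 0 given for letters in
  \<open>dia\<close> never arise; this equation and \<open>dia_concat\<close> replace the
  unconditional \<open>dia.simps\<close>, whose left side matches every product.\<close>

lemma dia_clash:
  assumes "isl l = isl m"
  shows "dia (a @ [Bracket l u]) (Bracket m v # b) =
     wmon a * bracket_op (opmul l m) (dia [Bracket (toR l) u] v + dia u [Bracket (toS m) v]) * wmon b"
  using assms by (subst dia.simps) simp

lemma dia_clash_left:
  assumes "isl l = isl m"
  shows "dia [Bracket l u] (Bracket m v # b) =
     bracket_op (opmul l m) (dia [Bracket (toR l) u] v + dia u [Bracket (toS m) v]) * wmon b"
  using dia_clash[OF assms, of "[]" u v b] by (simp add: wmon_Nil)

lemma dia_clash_single:
  assumes "isl l = isl m"
  shows "dia [Bracket l u] [Bracket m v] =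
     bracket_op (opmul l m) (dia [Bracket (toR l) u] v + dia u [Bracket (toS m) v])"
  using dia_clash[OF assms, of "[]" u v "[]"] by (simp add: wmon_Nil)

lemma dia_concat:
  assumes "\<not> (a \<noteq> [] \<and> b \<noteq> [] \<and> clash (last a) (hd b))"
  shows "dia a b = wmon (a @ b)"
  by (subst dia.simps) (simp only: if_not_P[OF assms])

lemma dia_Nil [simp]: "dia [] b = wmon b" "dia a [] = wmon a"
  by (simp_all add: dia_concat)

lemma clashE:
  assumes "clash p q" obtains l u m v where "p = Bracket l u" "q = Bracket m v" "isl l = isl m"
  using assms by (cases p; cases q) auto

lemma dia_cases:
  obtains (clash) a' l u m v b' where "isl l = isl m" "a = a' @ [Bracket l u]" "b = Bracket m v # b'"
    | (concat) "\<not> (a \<noteq> [] \<and> b \<noteq> [] \<and> clash (last a) (hd b))"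
proof (cases "a \<noteq> [] \<and> b \<noteq> [] \<and> clash (last a) (hd b)")
  case True
  then obtain l u m v where "last a = Bracket l u" "hd b = Bracket m v" "isl l = isl m"
    by (blast elim: clashE)
  then show ?thesis using clash True
    by (metis append_butlast_last_id list.exhaust_sel)
qed (use concat in blast)

definition prd :: "('o::semigroup_mult + 'o, 'x, 'k::comm_ring_1) bpoly \<Rightarrow> ('o + 'o, 'x, 'k) bpoly \<Rightarrow> ('o
    + 'o, 'x, 'k) bpoly"
    (infixl \<open>\<diamondop>\<close> 70) where
  "f \<diamondop> g = lin_extend (\<lambda>a. lin_extend (dia a) g) f"

lemma prd_wmon: "wmon a \<diamondop> wmon b = dia a b"
  by (simp add: prd_def)

lemma lin_prd_left: "lin F \<Longrightarrow> lin (\<lambda>f. F f \<diamondop> g)"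
  unfolding prd_def by (rule lin_intros)

text \<open>The right argument sits inside the function that is extended, so linearity needs
  additivity and homogeneity of \<open>lin_extend\<close> in its function argument.\<close>

lemma lin_prd_right: assumes "lin F" shows "lin (\<lambda>g. f \<diamondop> F g)"
  unfolding prd_def lin_def
  using assms by (simp add: lin_addD[OF lin_lin_extend] lin_scaleD[OF lin_lin_extend] lin_addD[of F]
      lin_scaleD[of F] lin_extend_add_fun lin_extend_scale_fun)

lemmas lin_rules = lin_intros lin_lin_ext lin_bracket_op lin_prd_left lin_prd_right

lemma prd_add: "(f + f') \<diamondop> g = f \<diamondop> g + f' \<diamondop> g" "g \<diamondop> (f + f') = g \<diamondop> f + g \<diamondop> f'"
  by (rule lin_addD[where F = "\<lambda>f. f \<diamondop> g"] lin_addD[where F = "\<lambda>f. g \<diamondop> f"]; intro lin_rules)+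

lemma prd_one [simp]: "1 \<diamondop> f = f" "f \<diamondop> 1 = f"
  by (rule lin_eqI[where f = f]; (intro lin_rules)?; simp add: prd_wmon flip: wmon_Nil)+

text \<open>The recursion of \<open>dia\<close> at two single brackets is exactly the Rota-Baxter
  relation; bilinearity carries it from words to polynomials.\<close>

lemma prd_bracket_op:
  assumes "isl l = isl m"
  shows "bracket_op l f \<diamondop> bracket_op m g =
     bracket_op (opmul l m) (bracket_op (toR l) f \<diamondop> g + f \<diamondop> bracket_op (toS m) g)"
proof (rule lin_eqI[where f = f])
  fix u
  show "bracket_op l (wmon u) \<diamondop> bracket_op m g =
     bracket_op (opmul l m) (bracket_op (toR l) (wmon u) \<diamondop> g + wmon u \<diamondop> bracket_op (toS m) g)"
  proof (rule lin_eqI[where f = g])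
    fix v
    show "bracket_op l (wmon u) \<diamondop> bracket_op m (wmon v) =
     bracket_op (opmul l m) (bracket_op (toR l) (wmon u) \<diamondop> wmon v + wmon u \<diamondop> bracket_op (toS m) (wmon v))"
      using assms by (simp add: prd_wmon dia_clash_single)
  qed (intro lin_rules)+
qed (intro lin_rules)+

text \<open>For a polynomial bracketed as a whole, every term exposes the same operator
  \<open>k\<close> at the junction, so all terms react in the same way. This and its mirror image
  expand the second product in the proof of associativity.\<close>

lemma prd_context_left:
  assumes "isl k = isl n"
  shows "(wmon a * bracket_op k f) \<diamondop> wmon (Bracket n w # c) =
    wmon a * bracket_op (opmul k n) (bracket_op (toR k) f \<diamondop> wmon w + f \<diamondop> wmon [Bracket (toS n) w]) * wmon c"
proof (rule lin_eqI[where f = f])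
  fix z
  show "(wmon a * bracket_op k (wmon z)) \<diamondop> wmon (Bracket n w # c) =
    wmon a * bracket_op (opmul k n) (bracket_op (toR k) (wmon z) \<diamondop> wmon w + wmon z \<diamondop> wmon [Bracket
        (toS n) w]) * wmon c"
    using assms by (simp add: wmon_mult prd_wmon dia_clash)
qed (intro lin_rules)+

lemma prd_context_right:
  assumes "isl l = isl k"
  shows "wmon (a @ [Bracket l u]) \<diamondop> (bracket_op k f * wmon c) =
    wmon a * bracket_op (opmul l k) (wmon [Bracket (toR l) u] \<diamondop> f + wmon u \<diamondop> bracket_op (toS k) f) * wmon c"
proof (rule lin_eqI[where f = f])
  fix z
  show "wmon (a @ [Bracket l u]) \<diamondop> (bracket_op k (wmon z) * wmon c) =
    wmon a * bracket_op (opmul l k) (wmon [Bracket (toR l) u] \<diamondop> wmon z + wmon u \<diamondop> bracket_op (toS k)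
        (wmon z)) * wmon c"
    using assms by (simp add: wmon_mult prd_wmon dia_clash)
qed (intro lin_rules)+

text \<open>Only the last factor of the left argument meets the right one. If \<open>b\<close> were
  empty, a factor of \<open>f\<close> would be exposed instead.\<close>

lemma prd_append_right:
  assumes "b \<noteq> []"
  shows "(f * wmon b) \<diamondop> wmon c = f * (wmon b \<diamondop> wmon c)"
proof (rule lin_eqI[where f = f])
  fix z
  show "(wmon z * wmon b) \<diamondop> wmon c = wmon z * (wmon b \<diamondop> wmon c)"
  proof (cases b c rule: dia_cases)
    case (clash b' l u m v c')
    then have "(wmon z * wmon b) \<diamondop> wmon c = dia ((z @ b') @ [Bracket l u]) (Bracket m v # c')"
      by (simp add: wmon_mult prd_wmon)
    also note dia_clash[OF clash(1)]
    also have "wmon (z @ b') = wmon z * wmon b'" by (simp add: wmon_mult)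
    finally show ?thesis using clash by (simp add: prd_wmon dia_clash mult.assoc)
  next
    case concat
    then have "\<not> (z @ b \<noteq> [] \<and> c \<noteq> [] \<and> clash (last (z @ b)) (hd c))" using assms by simp
    from dia_concat[OF this] show ?thesis using concat by (simp add: wmon_mult prd_wmon dia_concat)
  qed
qed (intro lin_rules)+

lemma dia_append: "b \<noteq> [] \<Longrightarrow> dia (a @ b) c = wmon a * dia b c"
  using prd_append_right[of b "wmon a" c] by (simp add: wmon_mult prd_wmon)

lemma prd_append_left:
  assumes "b \<noteq> []"
  shows "wmon a \<diamondop> (wmon b * f) = (wmon a \<diamondop> wmon b) * f"
proof (rule lin_eqI[where f = f])
  fix z
  show "wmon a \<diamondop> (wmon b * wmon z) = (wmon a \<diamondop> wmon b) * wmon z"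
  proof (cases a b rule: dia_cases)
    case (clash a' l u m v b')
    then have "wmon a \<diamondop> (wmon b * wmon z) = dia (a' @ [Bracket l u]) (Bracket m v # (b' @ z))"
      by (simp add: wmon_mult prd_wmon)
    also note dia_clash[OF clash(1)]
    also have "wmon (b' @ z) = wmon b' * wmon z" by (simp add: wmon_mult)
    finally show ?thesis using clash by (simp add: prd_wmon dia_clash mult.assoc)
  next
    case concat
    then have "\<not> (a \<noteq> [] \<and> b @ z \<noteq> [] \<and> clash (last a) (hd (b @ z)))" using assms by simp
    from dia_concat[OF this] show ?thesis using concat by (simp add: wmon_mult prd_wmon dia_concat)
  qed
qed (intro lin_rules)+

text \<open>
  Only a middle word of breadth one can take part in both products; then both sides expand to the
  same three terms, with smaller instances of associativity inside the brackets.
\<close>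

lemma dia_assoc: "dia a b \<diamondop> wmon c = (wmon a \<diamondop> dia b c :: ('o::semigroup_mult
    + 'o, 'x, 'k::comm_ring_1) bpoly)"
proof (induction "wdeg a + wdeg b + wdeg c" arbitrary: a b c rule: less_induct)
  case less
  consider "b = []" | "length b \<ge> 2" | p where "b = [p]"
    by (cases b rule: list.exhaust; cases "tl b") auto
  then show ?case
  proof cases
    case 1
    then show ?thesis by (simp add: prd_wmon)
  next
    case 2
    then obtain p b' q where b: "b = p # b' @ [q]"
      by (cases b; cases "tl b" rule: rev_cases) auto
    show ?thesis
    proof (cases a b rule: dia_cases)
      case (clash a' l u m v b1)
      then have "b1 \<noteq> []" using b by auto
      show ?thesis
      proof -
        have "(dia a b :: ('o + 'o, 'x, 'k) bpoly) \<diamondop> wmon c =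
          wmon a' * bracket_op (opmul l m) (dia [Bracket (toR l) u] v + dia u [Bracket (toS m) v]) *
              (wmon b1 \<diamondop> wmon c)"
          using clash \<open>b1 \<noteq> []\<close> by (simp add: dia_clash prd_append_right)
        also have "\<dots> = wmon a \<diamondop> (wmon [Bracket m v] * (wmon b1 \<diamondop> wmon c))"
          using clash by (simp add: prd_append_left prd_wmon dia_clash wmon_Nil)
        also have "wmon [Bracket m v] * (wmon b1 \<diamondop> wmon c) = (wmon [Bracket m v] * wmon b1) \<diamondop> wmon c"
          using \<open>b1 \<noteq> []\<close> by (simp add: prd_append_right)
        finally show ?thesis using clash by (simp add: wmon_mult prd_wmon)
      qed
    next
      case concat
      have "(wmon a :: ('o + 'o, 'x, 'k) bpoly) \<diamondop> dia b c = wmon a \<diamondop> (wmon [p] * (wmon (b' @ [q]) \<diamondop> wmon c))"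
        using b by (simp add: prd_wmon dia_append[of "b' @ [q]" "[p]" c, simplified])
      also have "\<dots> = (wmon a \<diamondop> wmon [p]) * (wmon (b' @ [q]) \<diamondop> wmon c)"
        by (simp add: prd_append_left)
      also have "wmon a \<diamondop> wmon [p] = wmon (a @ [p])"
        using concat b by (simp add: prd_wmon dia_concat)
      also have "wmon (a @ [p]) * (wmon (b' @ [q]) \<diamondop> wmon c) = wmon (a @ b) \<diamondop> wmon c"
        using b by (simp add: prd_wmon dia_append[of "b' @ [q]" "a @ [p]" c, simplified])
      finally show ?thesis using concat by (simp add: dia_concat)
    qed
  next
    case b: 3
    show ?thesis
    proof (cases a b rule: dia_cases)
      case (clash a' l u m v b1)
      then have b1: "b1 = []" "p = Bracket m v" using b by auto
      show ?thesis
      proof (cases b c rule: dia_cases)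
        case c: (clash b2 m' v' n w c')
        then have [simp]: "b2 = []" "m' = m" "v' = v" using b b1 by auto
        let ?Z = "dia [Bracket (toR l) u] v + dia u [Bracket (toS m) v] :: ('o + 'o, 'x, 'k) bpoly"
        let ?Z' = "dia [Bracket (toR m) v] w + dia v [Bracket (toS n) w] :: ('o + 'o, 'x, 'k) bpoly"
        have ass: "(dia x y :: ('o + 'o, 'x, 'k) bpoly) \<diamondop> wmon z = wmon x \<diamondop> dia y z"
          if "wdeg x + wdeg y + wdeg z < wdeg a + wdeg b + wdeg c" for x y z
          by (rule less) (rule that)
        have "(dia a b :: ('o + 'o, 'x, 'k) bpoly) \<diamondop> wmon c = (wmon a' * bracket_op (opmul l m) ?Z)
            \<diamondop> wmon (Bracket n w # c')"
          using clash c b1 by (simp add: dia_clash wmon_Nil)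
        also have "\<dots> = wmon a' * bracket_op (opmul (opmul l m) n)
            (bracket_op (toR (opmul l m)) ?Z \<diamondop> wmon w + ?Z \<diamondop> wmon [Bracket (toS n) w]) * wmon c'"
          by (rule prd_context_left) (use clash c in simp)
        \<comment> \<open>Folding this bracket back into a product of two R-brackets makes the
          induction hypothesis applicable. Writing Ru, Rv, Sv, Sw for the brackets of kind R or S,
          the three terms are (Ru Rv) w, (Ru v) Sw and (u Sv) Sw. The S-brackets are folded in the
          same way on the other side.\<close>
        also have "bracket_op (toR (opmul l m)) ?Z = dia [Bracket (toR l) u] [Bracket (toR m) v]"
          by (simp add: dia_clash_single)
        also have "dia [Bracket (toR l) u] [Bracket (toR m) v] \<diamondop> wmon w + ?Z \<diamondop> wmon [Bracket (toS n) w] =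
            wmon [Bracket (toR l) u] \<diamondop> ?Z' + wmon u \<diamondop> dia [Bracket (toS m) v] [Bracket (toS n) w]"
          using clash c by (simp add: prd_add ass)
        also have "(dia [Bracket (toS m) v] [Bracket (toS n) w] :: ('o + 'o, 'x, 'k) bpoly) = bracket_op
            (toS (opmul m n)) ?Z'"
          by (simp add: dia_clash_single)
        also have "wmon a' * bracket_op (opmul (opmul l m) n) (wmon [Bracket (toR l) u] \<diamondop> ?Z'
            + wmon u \<diamondop> bracket_op (toS (opmul m n)) ?Z') * wmon c' = wmon (a' @ [Bracket l u]) \<diamondop>
                (bracket_op (opmul m n) ?Z' * wmon c')"
          by (subst prd_context_right) (use clash in simp_all)
        also have "bracket_op (opmul m n) ?Z' * wmon c' = dia b c"
          using c clash b1 by (simp add: dia_clash_left)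
        finally show ?thesis using clash by simp
      next
        case concat
        have "(dia a b :: ('o + 'o, 'x, 'k) bpoly) \<diamondop> wmon c = (wmon a' * bracket_op (opmul l m)
            (dia [Bracket (toR l) u] v + dia u [Bracket (toS m) v])) \<diamondop> wmon c"
          using clash b1 by (simp add: dia_clash wmon_Nil)
        also have "\<dots> = wmon a' * bracket_op (opmul l m)
            (dia [Bracket (toR l) u] v + dia u [Bracket (toS m) v]) * wmon c"
        proof (rule lin_eqI[where f = "dia [Bracket (toR l) u] v + dia u [Bracket (toS m) v] :: ('o
            + 'o, 'x, 'k) bpoly"])
          fix z
          \<comment> \<open>The new bracket has the kind of the last factor of \<open>b\<close>,
            which does not clash with \<open>c\<close>.\<close>
          have "(dia (a' @ [Bracket (opmul l m) z]) c :: ('o + 'o, 'x, 'k) bpoly) = wmon ((a' @ [Bracket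
              (opmul l m) z]) @ c)"
            by (rule dia_concat) (use concat clash b1 in \<open>auto elim!: clashE\<close>)
          then show "(wmon a' * bracket_op (opmul l m) (wmon z :: ('o + 'o, 'x, 'k) bpoly)) \<diamondop> wmon c =
              wmon a' * bracket_op (opmul l m) (wmon z) * wmon c"
            by (simp add: wmon_mult prd_wmon)
        qed (intro lin_rules)+
        also have "\<dots> = wmon a \<diamondop> (wmon b * wmon c)"
          using clash b1 by (simp add: prd_append_left prd_wmon dia_clash wmon_Nil)
        finally show ?thesis using concat by (simp add: wmon_mult dia_concat)
      qed
    next
      case ab: concat
      then have "(dia a b :: ('o + 'o, 'x, 'k) bpoly) \<diamondop> wmon c = wmon a * (wmon b \<diamondop> wmon c)"
        using b by (simp add: dia_concat prd_append_right flip: wmon_mult)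
      also have "\<dots> = wmon a \<diamondop> dia b c"
      proof (cases b c rule: dia_cases)
        case (clash b2 m v n w c')
        then have [simp]: "b2 = []" using b by auto
        have "(wmon a :: ('o + 'o, 'x, 'k) bpoly) * (wmon b \<diamondop> wmon c) = wmon a * bracket_op (opmul m n)
            (dia [Bracket (toR m) v] w + dia v [Bracket (toS n) w]) * wmon c'"
          using clash by (simp add: prd_wmon dia_clash_left mult.assoc)
        also have "(wmon a :: ('o + 'o, 'x, 'k) bpoly) * bracket_op (opmul m n) (dia [Bracket
            (toR m) v] w + dia v [Bracket (toS n) w]) * wmon c' =
           wmon a \<diamondop> (bracket_op (opmul m n) (dia [Bracket (toR m) v] w + dia v [Bracket (toS n) w])
               * wmon c')"
        proof (rule lin_eqI[where f = "dia [Bracket (toR m) v] w + dia v [Bracket (toS n) w] :: ('o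
            + 'o, 'x, 'k) bpoly"])
          fix z
          \<comment> \<open>The new bracket has the kind of the first factor of \<open>b\<close>,
            which does not clash with \<open>a\<close>.\<close>
          have "(dia a ([Bracket (opmul m n) z] @ c') :: ('o + 'o, 'x, 'k) bpoly) = wmon (a @ [Bracket
              (opmul m n) z] @ c')"
            by (rule dia_concat) (use ab clash in \<open>auto elim!: clashE\<close>)
          then show "wmon a * bracket_op (opmul m n) (wmon z :: ('o + 'o, 'x, 'k) bpoly) * wmon c' =
              wmon a \<diamondop> (bracket_op (opmul m n) (wmon z) * wmon c')"
            by (simp add: wmon_mult prd_wmon)
        qed (intro lin_rules)+
        finally show ?thesis
          using clash by (simp add: dia_clash_left)
      next
        case concat
        then have "(wmon a :: ('o + 'o, 'x, 'k) bpoly) \<diamondop> dia b c = (wmon a \<diamondop> wmon b) * wmon c"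
          using b prd_append_left[of b a "wmon c :: ('o + 'o, 'x, 'k) bpoly"] by
              (simp add: dia_concat wmon_mult)
        then show ?thesis using concat ab by (simp add: prd_wmon dia_concat wmon_mult)
      qed
      finally show ?thesis .
    qed
  qed
qed

lemma prd_assoc: "(f \<diamondop> g) \<diamondop> h = f \<diamondop> (g \<diamondop> h)"
proof (rule lin_eqI[where f = f])
  fix a show "(wmon a \<diamondop> g) \<diamondop> h = wmon a \<diamondop> (g \<diamondop> h)"
  proof (rule lin_eqI[where f = g])
    fix b show "(wmon a \<diamondop> wmon b) \<diamondop> h = wmon a \<diamondop> (wmon b \<diamondop> h)"
    proof (rule lin_eqI[where f = h])
      fix c show "(wmon a \<diamondop> wmon b) \<diamondop> wmon c = wmon a \<diamondop> (wmon b \<diamondop> wmon c)"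
        using dia_assoc[of a b c] by (simp add: prd_wmon)
    qed (intro lin_rules)+
  qed (intro lin_rules)+
qed (intro lin_rules)+


section \<open>Normal forms\<close>

fun nf_prime :: "('o + 'o, 'x) bprime \<Rightarrow> ('o::semigroup_mult + 'o, 'x, 'k::comm_ring_1) bpoly" where
  "nf_prime (Letter x) = wmon [Letter x]"
| "nf_prime (Bracket l w) = bracket_op l (foldr (\<diamondop>) (map nf_prime w) 1)"

definition nf_word :: "('o + 'o, 'x) bword \<Rightarrow> ('o::semigroup_mult + 'o, 'x, 'k::comm_ring_1) bpoly" where
  "nf_word w = foldr (\<diamondop>) (map nf_prime w) 1"

text \<open>The recursion gives the rule for a first factor only; associativity of
  \<open>\<diamondop>\<close> turns it into multiplicativity at every cut of the word.\<close>

lemma nf_word_simps [simp]: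
  "nf_word [] = 1" "nf_word (p # w) = nf_prime p \<diamondop> nf_word w"
  "nf_word (u @ v) = nf_word u \<diamondop> nf_word v"
proof -
  show "nf_word (u @ v) = nf_word u \<diamondop> nf_word v"
    by (induction u) (simp_all add: nf_word_def prd_assoc)
qed (simp_all add: nf_word_def)

lemma nf_prime_Bracket [simp]: "nf_prime (Bracket l w) = bracket_op l (nf_word w)"
  by (simp add: nf_word_def)

declare nf_prime.simps(2) [simp del]

definition nf :: "('o::semigroup_mult + 'o, 'x, 'k::comm_ring_1) bpoly \<Rightarrow> ('o + 'o, 'x, 'k) bpoly" where
  "nf = lin_extend nf_word"

lemma nf_wmon [simp]: "nf (wmon w) = nf_word w"
  by (simp add: nf_def)

lemma lin_nf: "lin F \<Longrightarrow> lin (\<lambda>f. nf (F f))"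
  unfolding nf_def by (rule lin_rules)

lemma nf_mult: "nf (f * g) = nf f \<diamondop> nf g"
proof (rule lin_eqI[where f = f])
  fix u show "nf (wmon u * g) = nf (wmon u) \<diamondop> nf g"
    by (rule lin_eqI[where f = g]; (intro lin_nf lin_rules)?) (simp add: wmon_mult)
qed (intro lin_nf lin_rules)+

lemma nf_bracket_op: "nf (bracket_op l f) = bracket_op l (nf f)"
  by (rule lin_eqI[where f = f]; (intro lin_nf lin_rules)?) simp

lemma prd_zero [simp]: "0 \<diamondop> f = 0" "f \<diamondop> 0 = 0"
  by (simp_all add: lin_zero[OF lin_prd_left[OF lin_intros(1)]] lin_zero[OF lin_prd_right[OF lin_intros(1)]])

lemma bracket_op_zero [simp]: "bracket_op l 0 = 0"
  by (simp add: lin_zero[OF lin_bracket_op[OF lin_intros(1)]])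

lemma nf_zero [simp]: "nf 0 = 0"
  by (simp add: lin_zero[OF lin_nf[OF lin_intros(1)]])

lemma nf_rb_rel:
  assumes "isl l = isl m"
  shows "nf (rb_rel l u m v :: ('o::semigroup_mult + 'o, 'x, 'k::comm_ring_1) bpoly) = 0"
proof -
  have "(nf_word [Bracket l u, Bracket m v] :: ('o + 'o, 'x, 'k) bpoly) =
      nf_word [Bracket (opmul l m) (Bracket (toR l) u # v)] + nf_word [Bracket (opmul l m) (u @ [Bracket
          (toS m) v])]"
    using prd_bracket_op[OF assms]
    by (simp add: lin_addD[OF lin_bracket_op[OF lin_intros(1)]])
  then show ?thesis
    by (simp only: rb_rel_def lin_diff[OF lin_nf[OF lin_intros(1)]] nf_wmon) simp
qed

section \<open>Reduced words\<close>

abbreviation no_clash :: "('o + 'o, 'x) bword \<Rightarrow> bool" where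
  "no_clash \<equiv> successively (\<lambda>p q. \<not> clash p q)"

text \<open>Irreducibility in local terms: no clash between neighbours at any depth. It mentions
  neither an order nor leading monomials; \<open>Irr_eq_red_words\<close> makes the link.\<close>

fun red_prime :: "('o + 'o, 'x) bprime \<Rightarrow> bool" where
  "red_prime (Letter x) \<longleftrightarrow> True"
| "red_prime (Bracket l w) \<longleftrightarrow> (\<forall>p\<in>set w. red_prime p) \<and> no_clash w"

definition red :: "('o + 'o, 'x) bword \<Rightarrow> bool" where
  "red w \<longleftrightarrow> (\<forall>p\<in>set w. red_prime p) \<and> no_clash w"

lemma red_prime_Bracket [simp]: "red_prime (Bracket l w) = red w"
  by (simp add: red_def)

declare red_prime.simps(2) [simp del]

lemma red_Nil [simp]: "red []"
  by (simp add: red_def)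

lemma red_append: "red (u @ v) \<longleftrightarrow> red u \<and> red v \<and> (u = [] \<or> v = [] \<or> \<not> clash (last u) (hd v))"
  by (auto simp: red_def successively_append_iff)

lemma red_single [simp]: "red [p] = red_prime p"
  by (simp add: red_def)

lemma red_Cons: "red (p # w) \<longleftrightarrow> red_prime p \<and> red w \<and> (w = [] \<or> \<not> clash p (hd w))"
  using red_append[of "[p]" w] by simp

lemma nf_word_red: "red w \<Longrightarrow> nf_word w = wmon w"
  by (induction w rule: bword_induct_UNIV) (auto simp: wmon_Nil red_Cons prd_wmon dia_concat)

definition red_words :: "'x set \<Rightarrow> ('o + 'o, 'x) bword set" where
  "red_words X = {w \<in> bwords X. red w}"

text \<open>The collapsed bracket has the kind of both brackets it replaces, so the outer
  neighbours, which clashed with neither, do not clash with it; its content is reduced by induction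
  on the degree.\<close>

lemma keys_dia:
  "a \<in> red_words X \<Longrightarrow> b \<in> red_words X \<Longrightarrow>
     keys (dia a b :: ('o::semigroup_mult + 'o, 'x, 'k::comm_ring_1) bpoly) \<subseteq> red_words X"
proof (induction "wdeg a + wdeg b" arbitrary: a b rule: less_induct)
  case less
  show ?case
  proof (cases a b rule: dia_cases)
    case (clash a' l u m v b')
    let ?Z = "dia [Bracket (toR l) u] v + dia u [Bracket (toS m) v] :: ('o + 'o, 'x, 'k) bpoly"
    have *: "[Bracket (toR l) u] \<in> red_words X" "v \<in> red_words X" "u \<in> red_words X" "[Bracket (toS m) v]
        \<in> red_words X"
      using less.prems clash by (auto simp: red_words_def red_append red_Cons)
    have "keys (dia [Bracket (toR l) u] v :: ('o + 'o, 'x, 'k) bpoly) \<subseteq> red_words X"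
      by (rule less.hyps) (use * clash in auto)
    moreover have "keys (dia u [Bracket (toS m) v] :: ('o + 'o, 'x, 'k) bpoly) \<subseteq> red_words X"
      by (rule less.hyps) (use * clash in auto)
    ultimately have Z: "keys ?Z \<subseteq> red_words X"
      using keys_add[of "dia [Bracket (toR l) u] v :: ('o + 'o, 'x, 'k) bpoly"] by blast
    have "a' @ [Bracket (opmul l m) z] @ b' \<in> red_words X" if "z \<in> keys ?Z" for z
    proof -
      have "\<not> clash (last a') (Bracket (opmul l m) z)" if "a' \<noteq> []"
        using that less.prems(1) clash by (cases "last a'") (auto simp: red_words_def red_append)
      moreover have "\<not> clash (Bracket (opmul l m) z) (hd b')" if "b' \<noteq> []"
        using that less.prems(2) clash by (cases "hd b'") (auto simp: red_words_def red_Cons)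
      ultimately show ?thesis using that Z less.prems clash
        by (auto simp: red_words_def red_append red_Cons)
    qed
    moreover have "keys (dia a b :: ('o + 'o, 'x, 'k) bpoly) \<subseteq> (\<lambda>z. a' @ [Bracket
        (opmul l m) z] @ b') ` keys ?Z"
      using keys_mult'[of "wmon a' * bracket_op (opmul l m) ?Z" "wmon b'"]
        keys_mult'[of "wmon a'" "bracket_op (opmul l m) ?Z"] keys_bracket_op[of "opmul l m" ?Z]
      unfolding clash(2,3) dia_clash[OF clash(1)] by (fastforce simp: keys_wmon)
    ultimately show ?thesis by blast
  next
    case concat
    then show ?thesis using less.prems by (auto simp: dia_concat keys_wmon red_words_def red_append)
  qed
qed

lemma keys_prd:
  assumes "keys f \<subseteq> red_words X" "keys g \<subseteq> red_words X"
  shows "keys (f \<diamondop> g) \<subseteq> red_words X"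
proof -
  have "keys (lin_extend (dia a) g) \<subseteq> red_words X" if "a \<in> keys f" for a
    using keys_ext[of "dia a" g] keys_dia[of a X] that assms by blast
  then show ?thesis unfolding prd_def using keys_ext[of "\<lambda>a. lin_extend (dia a) g" f] by blast
qed

lemma keys_nf_word:
  "w \<in> bwords X \<Longrightarrow> keys (nf_word w :: ('o::semigroup_mult + 'o, 'x, 'k::comm_ring_1) bpoly) \<subseteq> red_words X"
proof (induction rule: bword_induct)
  case Nil
  then show ?case by (simp add: keys_wmon red_words_def flip: wmon_Nil)
next
  case (Letter x w)
  then show ?case
    unfolding nf_word_simps by (intro keys_prd) (auto simp: keys_wmon red_words_def)
next
  case (Bracket l u w)
  have "keys (bracket_op l (nf_word u :: ('o + 'o, 'x, 'k) bpoly)) \<subseteq> red_words X"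
    using keys_bracket_op[of l "nf_word u :: ('o + 'o, 'x, 'k) bpoly"] Bracket(3)
    by (fastforce simp: red_words_def)
  then show ?case using Bracket(4) unfolding nf_word_simps nf_prime_Bracket by (intro keys_prd)
qed

lemma keys_nf: "keys f \<subseteq> bwords X \<Longrightarrow> keys (nf f) \<subseteq> red_words X"
  unfolding nf_def using keys_ext[of nf_word f] keys_nf_word by blast


section \<open>Operated ideals\<close>

definition poly_on :: "'x set \<Rightarrow> ('l, 'x, 'k::comm_ring_1) bpoly set" where
  "poly_on X = {f. keys f \<subseteq> bwords X}"

lemma word_algebra_simps [simp]:
  "carrier (word_algebra X) = poly_on X"
  "f \<otimes>\<^bsub>word_algebra X\<^esub> g = f * g" "\<one>\<^bsub>word_algebra X\<^esub> = 1"
  "f \<oplus>\<^bsub>word_algebra X\<^esub> g = f + g" "\<zero>\<^bsub>word_algebra X\<^esub> = 0"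
  "c \<odot>\<^bsub>word_algebra X\<^esub> f = bpoly_scale c f"
  by (simp_all add: word_algebra_def poly_on_def)

lemma scalar_ring_simps [simp]:
  "carrier scalar_ring = UNIV" "c \<otimes>\<^bsub>scalar_ring\<^esub> d = c * d" "\<one>\<^bsub>scalar_ring\<^esub> = 1"
  "c \<oplus>\<^bsub>scalar_ring\<^esub> d = c + d" "\<zero>\<^bsub>scalar_ring\<^esub> = 0"
  by (simp_all add: scalar_ring_def)

lemma poly_on_closed [simp]:
  "0 \<in> poly_on X" "1 \<in> poly_on X"
  "wmon w \<in> poly_on X \<longleftrightarrow> w \<in> bwords X"
  by (auto simp: poly_on_def keys_wmon simp flip: wmon_Nil)

lemma poly_on_intros [intro]:
  "f \<in> poly_on X \<Longrightarrow> - f \<in> poly_on X"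
  "f \<in> poly_on X \<Longrightarrow> g \<in> poly_on X \<Longrightarrow> f + g \<in> poly_on X"
  "f \<in> poly_on X \<Longrightarrow> g \<in> poly_on X \<Longrightarrow> f - g \<in> poly_on X"
  "f \<in> poly_on X \<Longrightarrow> g \<in> poly_on X \<Longrightarrow> f * g \<in> poly_on X"
  "f \<in> poly_on X \<Longrightarrow> bpoly_scale c f \<in> poly_on X"
  "f \<in> poly_on X \<Longrightarrow> bracket_op l f \<in> poly_on X"
proof -
  show "f \<in> poly_on X \<Longrightarrow> - f \<in> poly_on X"
    by (simp add: poly_on_def subset_iff in_keys_iff)
  show "f \<in> poly_on X \<Longrightarrow> g \<in> poly_on X \<Longrightarrow> f + g \<in> poly_on X"
    using keys_add[of f g] by (auto simp: poly_on_def)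
  show "f \<in> poly_on X \<Longrightarrow> g \<in> poly_on X \<Longrightarrow> f - g \<in> poly_on X"
    using keys_diff[of f g] by (auto simp: poly_on_def)
  show "f \<in> poly_on X \<Longrightarrow> g \<in> poly_on X \<Longrightarrow> f * g \<in> poly_on X"
    using keys_mult'[of f g] by (fastforce simp: poly_on_def)
  show "f \<in> poly_on X \<Longrightarrow> bpoly_scale c f \<in> poly_on X"
    using keys_scale[of c f] by (auto simp: poly_on_def)
  show "f \<in> poly_on X \<Longrightarrow> bracket_op l f \<in> poly_on X"
    using keys_bracket_op[of l f] by (fastforce simp: poly_on_def)
qed

lemma poly_on_induct [consumes 1, case_names zero mon add]:
  assumes "p \<in> poly_on X" "T 0"
    and "\<And>c w. w \<in> bwords X \<Longrightarrow> T (bpoly_scale c (wmon w))"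
    and "\<And>f g. f \<in> poly_on X \<Longrightarrow> g \<in> poly_on X \<Longrightarrow> T f \<Longrightarrow> T g \<Longrightarrow> T (f + g)"
  shows "T (p :: ('l, 'x, 'k::comm_ring_1) bpoly)"
proof -
  have "keys p \<subseteq> bwords X" using assms(1) by (simp add: poly_on_def)
  then show ?thesis by (induction rule: bpoly_induct) (use assms in \<open>auto simp: poly_on_def\<close>)
qed

lemma cring_scalar_ring: "cring (scalar_ring :: 'k::comm_ring_1 ring)"
proof (rule cringI)
  show "abelian_group (scalar_ring :: 'k ring)"
    by (rule abelian_groupI) (auto simp: algebra_simps intro: exI[of _ "- x" for x])
  show "Group.comm_monoid (scalar_ring :: 'k ring)"
    by (rule comm_monoidI) (auto simp: algebra_simps)
qed (simp add: algebra_simps)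

lemma ring_word_algebra: "ring (word_algebra X :: ('k::comm_ring_1, ('l, 'x, 'k) bpoly) module)"
proof (rule ringI)
  show "abelian_group (word_algebra X :: ('k, ('l, 'x, 'k) bpoly) module)"
  proof (rule abelian_groupI)
    fix f :: "('l, 'x, 'k) bpoly" assume "f \<in> carrier (word_algebra X)"
    then have "- f \<in> poly_on X" by auto
    then show "\<exists>g\<in>carrier (word_algebra X). g \<oplus>\<^bsub>word_algebra X\<^esub> f = \<zero>\<^bsub>word_algebra X\<^esub>"
      by (intro bexI[of _ "- f"]) simp_all
  qed (auto simp: add_ac)
  show "Group.monoid (word_algebra X :: ('k, ('l, 'x, 'k) bpoly) module)"
    by (rule monoidI) (auto simp: mult.assoc)
qed (simp_all add: distrib_left distrib_right)

lemma a_inv_word_algebra: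
  assumes "f \<in> poly_on X" shows "\<ominus>\<^bsub>word_algebra X\<^esub> f = - f"
proof -
  interpret ring "word_algebra X" by (rule ring_word_algebra)
  have "f \<in> carrier (word_algebra X)" "- f \<in> carrier (word_algebra X)"
    using assms by auto
  then show ?thesis by (intro minus_equality) auto
qed

text \<open>Closure under negation is multiplication by -1, so it is absent from the list of
  conditions.\<close>

lemma operated_ideal_iff:
  fixes I :: "('l, 'x, 'k::comm_ring_1) bpoly set"
  shows
  "operated_ideal X I \<longleftrightarrow> I \<subseteq> poly_on X \<and> 0 \<in> I \<and> (\<forall>f\<in>I. \<forall>g\<in>I. f + g \<in> I) \<and>
     (\<forall>f\<in>I. \<forall>g\<in>poly_on X. g * f \<in> I \<and> f * g \<in> I) \<and> (\<forall>l. \<forall>f\<in>I. bracket_op l f \<in> I)"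
  (is "?A \<longleftrightarrow> ?B")
proof
  assume ?A
  then interpret ideal I "word_algebra X" by (simp add: operated_ideal_def)
  show ?B
  proof (intro conjI ballI allI)
    show "I \<subseteq> poly_on X" using a_subset by simp
    show "0 \<in> I" using additive_subgroup.zero_closed[OF additive_subgroup_axioms] by simp
    show "f + g \<in> I" if "f \<in> I" "g \<in> I" for f g
      using additive_subgroup.a_closed[OF additive_subgroup_axioms that] by simp
    show "g * f \<in> I" "f * g \<in> I" if "f \<in> I" "g \<in> poly_on X" for f g
      using I_l_closed[of f g] I_r_closed[of f g] that by simp_all
    show "bracket_op l f \<in> I" if "f \<in> I" for l f
      using \<open>?A\<close> that by (simp add: operated_ideal_def)
  qed
next
  assume B: ?B
  then have B': "I \<subseteq> poly_on X" "0 \<in> I" "\<And>f g. f \<in> I \<Longrightarrow> g \<in> I \<Longrightarrow> f + g \<in> I"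
    "\<And>f g. f \<in> I \<Longrightarrow> g \<in> poly_on X \<Longrightarrow> g * f \<in> I"
    "\<And>f g. f \<in> I \<Longrightarrow> g \<in> poly_on X \<Longrightarrow> f * g \<in> I" "\<And>l f. f \<in> I \<Longrightarrow> bracket_op l f \<in> I"
    by simp_all
  have neg: "- f \<in> I" if "f \<in> I" for f
  proof -
    have "- 1 \<in> poly_on X" by (rule poly_on_intros) simp
    from B'(4)[OF that this] show ?thesis by simp
  qed
  have "ideal I (word_algebra X)"
  proof (rule idealI)
    show "ring (word_algebra X :: ('k, ('l, 'x, 'k) bpoly) module)" by (rule ring_word_algebra)
    show "subgroup I (add_monoid (word_algebra X))"
    proof (rule subgroup.intro)
      fix f assume "f \<in> I"
      then have "inv\<^bsub>add_monoid (word_algebra X)\<^esub> f = - f"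
        using a_inv_word_algebra[of f X] B'(1) by (auto simp: a_inv_def)
      then show "inv\<^bsub>add_monoid (word_algebra X)\<^esub> f \<in> I" using neg \<open>f \<in> I\<close> by simp
    qed (use B' in simp_all)
  qed (use B' in simp_all)
  then show ?A using B'(6) by (simp add: operated_ideal_def)
qed

lemma operated_idealD:
  assumes "operated_ideal X I"
  shows "f \<in> I \<Longrightarrow> f \<in> poly_on X" "0 \<in> I" "f \<in> I \<Longrightarrow> g \<in> I \<Longrightarrow> f + g \<in> I"
    "f \<in> I \<Longrightarrow> h \<in> poly_on X \<Longrightarrow> h * f \<in> I" "f \<in> I \<Longrightarrow> h \<in> poly_on X \<Longrightarrow> f * h \<in> I"
    "f \<in> I \<Longrightarrow> bracket_op l f \<in> I" "f \<in> I \<Longrightarrow> - f \<in> I" "f \<in> I \<Longrightarrow> g \<in> I \<Longrightarrow> f - g \<in> I"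
    "f \<in> I \<Longrightarrow> bpoly_scale c f \<in> I"
proof -
  note B = assms[unfolded operated_ideal_iff]
  show sc: "f \<in> I \<Longrightarrow> bpoly_scale c f \<in> I" for c f
  proof -
    assume "f \<in> I"
    \<comment> \<open>Scaling by \<open>c\<close> is multiplication by \<open>c\<close> times the
      unit, so ideals are submodules.\<close>
    moreover have "bpoly_scale c 1 \<in> poly_on X" by (rule poly_on_intros) simp
    ultimately have "bpoly_scale c 1 * f \<in> I" using B by blast
    then show ?thesis by (simp add: scale_mult_left)
  qed
  show neg: "f \<in> I \<Longrightarrow> - f \<in> I" for f using sc[of f "-1"] by (simp add: scale_minus)
  show "f \<in> I \<Longrightarrow> g \<in> I \<Longrightarrow> f - g \<in> I"
    using B neg[of g] by (metis uminus_add_conv_diff)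
qed (use assms[unfolded operated_ideal_iff] in blast)+

text \<open>An intersection of operated ideals is one, provided the family is nonempty; the whole
  algebra belongs to it.\<close>

lemma operated_ideal_op_ideal:
  assumes "S \<subseteq> poly_on X"
  shows "operated_ideal X (op_ideal X S)"
proof -
  have "operated_ideal X (poly_on X)" by (auto simp: operated_ideal_iff)
  then have "op_ideal X S \<subseteq> poly_on X" using assms by (auto simp: op_ideal_def)
  then show ?thesis
    by (auto simp: op_ideal_def operated_ideal_iff[of X "\<Inter>_"] dest: operated_idealD)
qed

lemma op_ideal_least: "operated_ideal X I \<Longrightarrow> S \<subseteq> I \<Longrightarrow> op_ideal X S \<subseteq> I"
  and op_ideal_superset: "S \<subseteq> op_ideal X S"
  by (auto simp: op_ideal_def)

lemma rb_rel_poly_on: "u \<in> bwords X \<Longrightarrow> v \<in> bwords X \<Longrightarrow> rb_rel l u m v \<in> poly_on X"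
  unfolding rb_rel_def by (intro poly_on_intros) simp_all

lemma S_SF_poly_on: "S_SF X \<subseteq> poly_on X"
  unfolding S_SF_eq using rb_rel_poly_on by blast

text \<open>The kernel of \<open>nf\<close> is an operated ideal, because \<open>nf\<close> turns
  products into \<open>\<diamondop>\<close> and commutes with brackets; it contains the
  relations.\<close>

lemma nf_op_ideal:
  assumes "f \<in> op_ideal X (S_SF X)" shows "nf f = 0"
proof -
  have l: "lin (\<lambda>f. nf f)" by (intro lin_nf lin_rules)
  have "operated_ideal X {f \<in> poly_on X. nf f = 0}"
    unfolding operated_ideal_iff
    by (auto simp: lin_addD[OF l] nf_mult nf_bracket_op)
  moreover have "S_SF X \<subseteq> {f \<in> poly_on X. nf f = 0}"
    by (auto simp: S_SF_eq nf_rb_rel rb_rel_poly_on)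
  ultimately show ?thesis using assms op_ideal_least by blast
qed

section \<open>Congruence of words with their normal forms\<close>

context
  fixes X :: "'x set" and I :: "('o::semigroup_mult + 'o, 'x, 'k::comm_ring_1) bpoly set"
  assumes I: "operated_ideal X I" and S: "S_SF X \<subseteq> I"
begin

text \<open>At a clash the relation replaces the two brackets by one bracket around plain
  concatenations; by induction these are congruent to the products in \<open>dia\<close>, and the
  ideal is closed under brackets and contexts.\<close>

lemma dia_cong: "a \<in> bwords X \<Longrightarrow> b \<in> bwords X \<Longrightarrow> wmon (a @ b) - dia a b \<in> I"
proof (induction "wdeg a + wdeg b" arbitrary: a b rule: less_induct)
  case less
  show ?case
  proof (cases a b rule: dia_cases)
    case (clash a' l u m v b')
    let ?k = "opmul l m" and ?Z = "dia [Bracket (toR l) u] v + dia u [Bracket (toS m) v] :: ('o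
        + 'o, 'x, 'k) bpoly"
    let ?z = "wmon (Bracket (toR l) u # v) + wmon (u @ [Bracket (toS m) v]) :: ('o + 'o, 'x, 'k) bpoly"
    have uv: "u \<in> bwords X" "v \<in> bwords X" "a' \<in> bwords X" "b' \<in> bwords X"
      using less.prems clash by auto
    have "wmon ([Bracket (toR l) u] @ v) - dia [Bracket (toR l) u] v \<in> I"
      "wmon (u @ [Bracket (toS m) v]) - dia u [Bracket (toS m) v] \<in> I"
      by (rule less.hyps; use uv clash in auto)+
    then have "(wmon ([Bracket (toR l) u] @ v) - dia [Bracket (toR l) u] v) +
      (wmon (u @ [Bracket (toS m) v]) - dia u [Bracket (toS m) v]) \<in> I"
      by (rule operated_idealD(3)[OF I])
    then have "?z - ?Z \<in> I" by (simp add: algebra_simps)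
    then have "bracket_op ?k (?z - ?Z) \<in> I" by (rule operated_idealD[OF I])
    moreover have "rb_rel l u m v \<in> I" using S clash uv unfolding S_SF_eq by blast
    ultimately have "rb_rel l u m v + bracket_op ?k (?z - ?Z) \<in> I" by (rule operated_idealD(3)[OF I, rotated])
    moreover have "rb_rel l u m v + bracket_op ?k (?z - ?Z) = wmon [Bracket l u, Bracket m v]
        - bracket_op ?k ?Z"
      by (simp add: rb_rel_def lin_diff[OF lin_bracket_op[OF lin_intros(1)]] lin_addD[OF
          lin_bracket_op[OF lin_intros(1)]])
    ultimately have "wmon a' * (wmon [Bracket l u, Bracket m v] - bracket_op ?k ?Z) * wmon b' \<in> I"
      using uv by (simp add: operated_idealD(4,5)[OF I])
    then show ?thesis using clash by (simp add: dia_clash wmon_mult right_diff_distrib left_diff_distrib)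
  next
    case concat
    then show ?thesis by (simp add: dia_concat operated_idealD[OF I])
  qed
qed

lemma prd_cong:
  assumes "f \<in> poly_on X" "g \<in> poly_on X"
  shows "f * g - f \<diamondop> g \<in> I"
proof -
  have l: "lin (\<lambda>f. f * g - f \<diamondop> g)" "lin (\<lambda>g. f * g - f \<diamondop> g)" for f g :: "('o + 'o, 'x, 'k) bpoly"
    by (intro lin_rules)+
  note L = lin_zero[OF l(1)] lin_zero[OF l(2)] lin_addD[OF l(1)] lin_addD[OF l(2)] lin_scaleD[OF l(1)]
      lin_scaleD[OF l(2)]
  have *: "wmon a * g - wmon a \<diamondop> g \<in> I" if "a \<in> bwords X" "keys g \<subseteq> bwords X" for a g
    using that(2)
    by (induction rule: bpoly_induct)
      (use that(1) dia_cong in \<open>auto simp: L wmon_mult prd_wmon intro: operated_idealD[OF I]\<close>)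
  have "keys f \<subseteq> bwords X" using assms by (simp add: poly_on_def)
  then show ?thesis
    by (induction rule: bpoly_induct)
      (use assms * in \<open>auto simp: L poly_on_def intro: operated_idealD[OF I]\<close>)
qed

lemma nf_word_cong: "w \<in> bwords X \<Longrightarrow> wmon w - nf_word w \<in> I"
proof (induction rule: bword_induct)
  case Nil
  then show ?case by (simp add: wmon_Nil operated_idealD[OF I])
next
  case (Letter x w)
  have "nf_word w \<in> poly_on X" using keys_nf_word[OF Letter(2)] by (auto simp: poly_on_def red_words_def)
  then have "(wmon [Letter x] * nf_word w - wmon [Letter x] \<diamondop> nf_word w) \<in> I"
    using Letter by (intro prd_cong) auto
  moreover have "wmon [Letter x] * (wmon w - nf_word w) \<in> I"
    using Letter by (intro operated_idealD(4)[OF I]) auto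
  ultimately have "(wmon [Letter x] * nf_word w - wmon [Letter x] \<diamondop> nf_word w) + wmon [Letter x] *
      (wmon w - nf_word w) \<in> I"
    by (rule operated_idealD(3)[OF I])
  then show ?case by (simp add: right_diff_distrib wmon_mult)
next
  case (Bracket l u w)
  have p: "nf_word w \<in> poly_on X" "nf_word u \<in> poly_on X"
    using keys_nf_word[OF Bracket(1)] keys_nf_word[OF Bracket(2)] by (auto simp: poly_on_def red_words_def)
  then have "(bracket_op l (nf_word u) * nf_word w - bracket_op l (nf_word u) \<diamondop> nf_word w) \<in> I"
    by (intro prd_cong) auto
  moreover have "wmon [Bracket l u] * (wmon w - nf_word w) \<in> I"
    using Bracket by (intro operated_idealD(4)[OF I]) auto
  moreover have "bracket_op l (wmon u - nf_word u) * nf_word w \<in> I"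
    using Bracket p by (intro operated_idealD(5,6)[OF I])
  \<comment> \<open>The three congruences telescope: normalise the tail, then the content of the
    first bracket, then pass from the plain product to \<open>\<diamondop>\<close>.\<close>
  ultimately have "bracket_op l (wmon u - nf_word u) * nf_word w + ((bracket_op l (nf_word u)
      * nf_word w - bracket_op l (nf_word u) \<diamondop> nf_word w)
    + wmon [Bracket l u] * (wmon w - nf_word w)) \<in> I"
    by (intro operated_idealD(3)[OF I])
  then show ?case
    by (simp add: right_diff_distrib left_diff_distrib wmon_mult lin_diff[OF lin_bracket_op[OF
        lin_intros(1)]])
qed

lemma nf_cong:
  assumes "f \<in> poly_on X" shows "f - nf f \<in> I"
proof -
  have l: "lin (\<lambda>f. f - nf f)" by (intro lin_nf lin_rules)
  have "keys f \<subseteq> bwords X" using assms by (simp add: poly_on_def)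
  then show ?thesis
    by (induction rule: bpoly_induct)
      (auto simp: lin_zero[OF l] lin_addD[OF l] lin_scaleD[OF l] nf_word_cong intro: operated_idealD[OF I])
qed

end


section \<open>Words with a hole\<close>

text \<open>Words without a hole, seen among the words with a hole; they supply the surroundings of
  the hole in explicit contexts.\<close>

definition emb :: "('l, 'x) bword \<Rightarrow> ('l, 'x option) bword" where
  "emb = map (map_bprime id Some)"

lemma emb_simps [simp]:
  "emb [] = []" "emb (u @ v) = emb u @ emb v"
  "emb (Letter x # w) = Letter (Some x) # emb w" "emb (Bracket l u # w) = Bracket l (emb u) # emb w"
  by (simp_all add: emb_def)

lemma plug_emb [simp]: "plug (emb w) u = w"
  by (induction w rule: bword_induct_UNIV) auto

lemma holes_emb [simp]: "holes (emb w) = 0"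
  by (induction w rule: bword_induct_UNIV) auto

lemma emb_in_bwords [simp]: "emb w \<in> bwords (insert None (Some ` X)) \<longleftrightarrow> w \<in> bwords X"
  by (induction w rule: bword_induct_UNIV) auto

lemma no_hole_emb: "holes q = 0 \<Longrightarrow> \<exists>w. q = emb w"
proof (induction q rule: star_induct)
  case (Letter x q)
  then obtain w where "q = emb w" by auto
  then show ?case by (intro exI[of _ "Letter x # w"]) simp
next
  case (Bracket l q' q)
  then obtain u w where "q' = emb u" "q = emb w" by auto
  then show ?case by (intro exI[of _ "Bracket l u # w"]) simp
qed (auto intro: exI[of _ "[]"])

lemma star_words_intros [simp]:
  "Letter None # emb b \<in> star_words X \<longleftrightarrow> b \<in> bwords X"
  "Letter (Some x) # q \<in> star_words X \<longleftrightarrow> x \<in> X \<and> q \<in> star_words X"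
  "Bracket l (emb u) # q \<in> star_words X \<longleftrightarrow> u \<in> bwords X \<and> q \<in> star_words X"
  "Bracket l q # emb b \<in> star_words X \<longleftrightarrow> b \<in> bwords X \<and> q \<in> star_words X"
  "[Letter None] \<in> star_words X"
  "[Bracket l q] \<in> star_words X \<longleftrightarrow> q \<in> star_words X"
  "emb a @ q \<in> star_words X \<longleftrightarrow> a \<in> bwords X \<and> q \<in> star_words X"
  "q @ emb b \<in> star_words X \<longleftrightarrow> b \<in> bwords X \<and> q \<in> star_words X"
  "q @ [Bracket l (emb u)] \<in> star_words X \<longleftrightarrow> u \<in> bwords X \<and> q \<in> star_words X"
  by (auto simp: star_words_def)

text \<open>The single hole is either a top-level factor or lies in the content of exactly one
  top-level bracket; all other factors come from ordinary words.\<close>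

lemma star_words_cases:
  assumes "q \<in> star_words X"
  obtains (hole) a b where "a \<in> bwords X" "b \<in> bwords X" "q = emb a @ Letter None # emb b"
    | (bracket) a l q' b where "a \<in> bwords X" "b \<in> bwords X" "q' \<in> star_words X"
        "q = emb a @ Bracket l q' # emb b"
proof -
  have "\<exists>a b. q = emb a @ Letter None # emb b \<or> (\<exists>l q'. holes q' = 1 \<and> q = emb a @ Bracket l q' # emb b)"
    if "holes q = 1"
    using that
  proof (induction q rule: star_induct)
    case (Hole q)
    then obtain b where "q = emb b" using no_hole_emb[of q] by auto
    then show ?case by (intro exI[of _ "[]"] exI[of _ b]) simp
  next
    case (Letter x q)
    then obtain a b where "q = emb a @ Letter None # emb b \<or> (\<exists>l q'. holes q' = 1 \<and> q
        = emb a @ Bracket l q' # emb b)"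
      by auto
    then show ?case by (intro exI[of _ "Letter x # a"] exI[of _ b]) auto
  next
    case (Bracket l q' q)
    have "holes q' + holes q = 1" using Bracket.prems by simp
    then consider "holes q' = 1" "holes q = 0" | "holes q' = 0" "holes q = 1" by linarith
    then show ?case
    proof cases
      case 1
      then obtain b where "q = emb b" using no_hole_emb[of q] by auto
      then show ?thesis using 1 by (intro exI[of _ "[]"] exI[of _ b]) auto
    next
      case 2
      then obtain u where u: "q' = emb u" using no_hole_emb[of q'] by auto
      obtain a b where "q = emb a @ Letter None # emb b \<or> (\<exists>l q'. holes q' = 1 \<and> q
          = emb a @ Bracket l q' # emb b)"
        using Bracket 2 by auto
      then show ?thesis using u by (intro exI[of _ "Bracket l u # a"] exI[of _ b]) auto
    qed
  qed simp
  then show ?thesis using assms hole bracket by (auto simp: star_words_def)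
qed


section \<open>Irreducible words\<close>

locale sf_setup = db_setup X rX rL
  for X :: "'x set" and rX :: "'x rel" and rL :: "('o::semigroup_mult + 'o) rel"
begin

lemma lead_mon_eqI:
  assumes "w \<in> keys f" "\<And>v. v \<in> keys f \<Longrightarrow> v \<noteq> w \<Longrightarrow> db_less rX rL v w" "keys f \<subseteq> bwords X"
  shows "lead_mon ord f = w"
  unfolding lead_mon_def
proof (rule the_equality)
  show "w \<in> keys f \<and> (\<forall>v\<in>keys f. (v, w) \<in> ord)"
    using assms by (auto simp: db_order_def)
next
  fix v assume v: "v \<in> keys f \<and> (\<forall>u\<in>keys f. (u, v) \<in> ord)"
  have "antisym ord" using well_order_db by (simp add: order_on_defs)
  moreover have "(v, w) \<in> ord" "(w, v) \<in> ord" using assms v by (auto simp: db_order_def)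
  ultimately show "v = w" by (rule antisymD)
qed

text \<open>All three monomials of a relation have the same degree, and the brackets on the left
  have breadth one.\<close>

lemma rb_rel_less:
  "db_less rX rL [Bracket (opmul l m) (Bracket (toR l) u # v)] [Bracket l u, Bracket m v]"
  "db_less rX rL [Bracket (opmul l m) (u @ [Bracket (toS m) v])] [Bracket l u, Bracket m v]"
  by (rule breadth; simp)+

lemma lookup_rb_rel: "lookup (rb_rel l u m v) [Bracket l u, Bracket m v] = 1"
  by (simp add: rb_rel_def lookup_minus lookup_wmon)

lemma lead_mon_rb_rel:
  assumes "u \<in> bwords X" "v \<in> bwords X"
  shows "lead_mon ord (rb_rel l u m v :: ('o + 'o, 'x, 'k::comm_ring_1) bpoly) = [Bracket l u, Bracket m v]"
proof (rule lead_mon_eqI)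
  show "[Bracket l u, Bracket m v] \<in> keys (rb_rel l u m v :: ('o + 'o, 'x, 'k) bpoly)"
    by (simp add: in_keys_iff lookup_rb_rel)
  show "keys (rb_rel l u m v :: ('o + 'o, 'x, 'k) bpoly) \<subseteq> bwords X"
    using rb_rel_poly_on[OF assms] by (auto simp: poly_on_def)
next
  fix w assume "w \<in> keys (rb_rel l u m v :: ('o + 'o, 'x, 'k) bpoly)" "w \<noteq> [Bracket l u, Bracket m v]"
  then have "w = [Bracket (opmul l m) (Bracket (toR l) u # v)] \<or> w = [Bracket (opmul l m) (u @ [Bracket
      (toS m) v])]"
    by (auto simp: in_keys_iff rb_rel_def lookup_minus lookup_wmon split: if_splits)
  then show "db_less rX rL w [Bracket l u, Bracket m v]" using rb_rel_less by auto
qed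

lemma not_red_plug: "isl l = isl m \<Longrightarrow> holes q = 1 \<Longrightarrow> \<not> red (plug q [Bracket l u, Bracket m v])"
proof (induction q rule: star_induct)
  case (Bracket k q' q)
  then consider "holes q' = 1" | "holes q = 1" by fastforce
  then show ?case using Bracket by cases (auto simp: red_Cons)
qed (auto simp: red_Cons red_append)

text \<open>The context \<open>q\<close> records the path to a clash: into the first bracket, past
  it, or at the junction of the first two factors.\<close>

lemma not_red_reducible:
  "w \<in> bwords X \<Longrightarrow> \<not> red w \<Longrightarrow> \<exists>q\<in>star_words X. \<exists>l u m v. isl l = isl m \<and> u \<in> bwords X \<and> v \<in> bwords X
     \<and> w = plug q [Bracket l u, Bracket m v]"
proof (induction rule: bword_induct)
  case (Letter x w)
  then have "\<not> red w" by (simp add: red_Cons)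
  then obtain q l u m v where "q \<in> star_words X" "isl l = isl m" "u \<in> bwords X" "v \<in> bwords X" "w
      = plug q [Bracket l u, Bracket m v]"
    using Letter.IH by blast
  then show ?case using Letter.hyps
    by (intro bexI[of _ "Letter (Some x) # q"] exI[of _ l] exI[of _ m] exI[of _ u] exI[of _ v]) auto
next
  case (Bracket k y w)
  consider "\<not> red y" | "\<not> red w" | "w \<noteq> []" "clash (Bracket k y) (hd w)"
    using Bracket.prems by (auto simp: red_Cons)
  then show ?case
  proof cases
    case 1
    then obtain q l u m v where "q \<in> star_words X" "isl l = isl m" "u \<in> bwords X" "v \<in> bwords X" "y
        = plug q [Bracket l u, Bracket m v]"
      using Bracket.IH by blast
    then show ?thesis using Bracket.hyps
      by (intro bexI[of _ "Bracket k q # emb w"] exI[of _ l] exI[of _ m] exI[of _ u] exI[of _ v]) auto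
  next
    case 2
    then obtain q l u m v where "q \<in> star_words X" "isl l = isl m" "u \<in> bwords X" "v \<in> bwords X" "w
        = plug q [Bracket l u, Bracket m v]"
      using Bracket.IH by blast
    then show ?thesis using Bracket.hyps
      by (intro bexI[of _ "Bracket k (emb y) # q"] exI[of _ l] exI[of _ m] exI[of _ u] exI[of _ v]) auto
  next
    case 3
    then obtain m v w' where "w = Bracket m v # w'" "isl k = isl m"
      by (cases w) (auto elim: clashE)
    then show ?thesis using Bracket.hyps
      by (intro bexI[of _ "Letter None # emb w'"] exI[of _ k] exI[of _ m] exI[of _ y] exI[of _ v]) auto
  qed
qed simp

lemma Irr_eq_red_words: "Irr X ord (S_SF X :: ('o + 'o, 'x, 'k::comm_ring_1) bpoly set) = red_words X"
proof (intro equalityI subsetI)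
  fix w assume w: "w \<in> Irr X ord (S_SF X :: ('o + 'o, 'x, 'k) bpoly set)"
  have "red w"
  proof (rule ccontr)
    assume "\<not> red w"
    then obtain q l u m v where *: "q \<in> star_words X" "isl l = isl m" "u \<in> bwords X" "v \<in> bwords X" "w
        = plug q [Bracket l u, Bracket m v]"
      using not_red_reducible[of w] w unfolding Irr_def by blast
    then have "w = plug q (lead_mon ord (rb_rel l u m v :: ('o + 'o, 'x, 'k) bpoly))"
      by (simp add: lead_mon_rb_rel)
    moreover have "(rb_rel l u m v :: ('o + 'o, 'x, 'k) bpoly) \<in> S_SF X" using * unfolding S_SF_eq by blast
    ultimately show False using w * by (auto simp: Irr_def)
  qed
  then show "w \<in> red_words X" using w by (simp add: Irr_def red_words_def)
next
  fix w :: "('o + 'o, 'x) bword" assume w: "w \<in> red_words X"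
  have "w \<noteq> plug q (lead_mon ord s)" if "q \<in> star_words X" "s \<in> (S_SF X :: ('o
      + 'o, 'x, 'k) bpoly set)" for q s
  proof -
    obtain l u m v where "s = rb_rel l u m v" "isl l = isl m" "u \<in> bwords X" "v \<in> bwords X"
      using \<open>s \<in> S_SF X\<close> unfolding S_SF_eq by blast
    then show ?thesis using w not_red_plug[of l m q u v] that(1)
      by (auto simp: lead_mon_rb_rel red_words_def star_words_def)
  qed
  then show "w \<in> Irr X ord (S_SF X :: ('o + 'o, 'x, 'k) bpoly set)" using w by
      (simp add: Irr_def red_words_def)
qed


section \<open>Triviality of the compositions\<close>

abbreviation triv :: "('o + 'o, 'x) bword \<Rightarrow> ('o + 'o, 'x, 'k::comm_ring_1) bpoly \<Rightarrow> bool" where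
  "triv \<equiv> trivial_mod X ord (S_SF X)"

lemma triv_add:
  assumes "triv w f" "triv w g" shows "triv w (f + g)"
proof -
  obtain ts us where
    "\<forall>(c, q, s)\<in>set ts. c \<noteq> 0 \<and> q \<in> star_words X \<and> s \<in> S_SF X \<and> (plug q (lead_mon ord s), w) \<in> ord
        \<and> plug q (lead_mon ord s) \<noteq> w"
    "f = (\<Sum>(c, q, s)\<leftarrow>ts. bpoly_scale c (lin_ext (plug q) s))"
    "\<forall>(c, q, s)\<in>set us. c \<noteq> 0 \<and> q \<in> star_words X \<and> s \<in> S_SF X \<and> (plug q (lead_mon ord s), w) \<in> ord
        \<and> plug q (lead_mon ord s) \<noteq> w"
    "g = (\<Sum>(c, q, s)\<leftarrow>us. bpoly_scale c (lin_ext (plug q) s))"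
    using assms unfolding trivial_mod_def by blast
  then show ?thesis unfolding trivial_mod_def by (intro exI[of _ "ts @ us"]) auto
qed

lemma triv_uminus:
  assumes "triv w f" shows "triv w (- f)"
proof -
  obtain ts where ts:
    "\<forall>(c, q, s)\<in>set ts. c \<noteq> 0 \<and> q \<in> star_words X \<and> s \<in> S_SF X \<and> (plug q (lead_mon ord s), w) \<in> ord
        \<and> plug q (lead_mon ord s) \<noteq> w"
    "f = (\<Sum>(c, q, s)\<leftarrow>ts. bpoly_scale c (lin_ext (plug q) s))"
    using assms unfolding trivial_mod_def by blast
  have "- (\<Sum>(c, q, s)\<leftarrow>us. bpoly_scale c (lin_ext (plug q) s)) =
      (\<Sum>(c, q, s)\<leftarrow>map (\<lambda>(c, q, s). (- c, q, s)) us. bpoly_scale c (lin_ext (plug q) s))" for us ::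
          "('k \<times> ('o + 'o, 'x option) bword \<times> ('o + 'o, 'x, 'k::comm_ring_1) bpoly) list"
    by (induction us) (auto simp: scale_minus)
  then show ?thesis unfolding trivial_mod_def ts(2)
    by (intro exI[of _ "map (\<lambda>(c, q, s). (- c, q, s)) ts"]) (use ts(1) in auto)
qed

lemma triv_diff: "triv w f \<Longrightarrow> triv w g \<Longrightarrow> triv w (f - g)"
  using triv_add[of w f "- g"] triv_uminus[of w g] by simp

lemma lin_ext_rb_rel:
  "lin_ext \<phi> (rb_rel l u m v) = wmon (\<phi> [Bracket l u, Bracket m v])
     - wmon (\<phi> [Bracket (opmul l m) (Bracket (toR l) u # v)])
     - wmon (\<phi> [Bracket (opmul l m) (u @ [Bracket (toS m) v])])"
  by (simp add: rb_rel_def lin_diff[OF lin_lin_ext[OF lin_intros(1)]])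

lemma triv_plug:
  assumes "q \<in> star_words X" "isl l = isl m" "u \<in> bwords X" "v \<in> bwords X" "w \<in> bwords X"
    and "db_less rX rL (plug q [Bracket l u, Bracket m v]) w"
  shows "triv w (lin_ext (plug q) (rb_rel l u m v) :: ('o + 'o, 'x, 'k::comm_ring_1) bpoly)"
proof -
  let ?s = "rb_rel l u m v :: ('o + 'o, 'x, 'k) bpoly"
  have "plug q [Bracket l u, Bracket m v] \<in> bwords X"
    by (rule star_plug_in_bwords) (use assms in auto)
  then have "(plug q (lead_mon ord ?s), w) \<in> ord \<and> plug q (lead_mon ord ?s) \<noteq> w"
    unfolding ord_strict_iff lead_mon_rb_rel[OF assms(3,4)] using assms by simp
  moreover have "?s \<in> S_SF X" using assms unfolding S_SF_eq by blast
  ultimately show ?thesis unfolding trivial_mod_def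
    by (intro exI[of _ "[(1, q, ?s)]"]) (use assms in auto)
qed

lemma triv_rb_rel:
  assumes "isl l = isl m" "u \<in> bwords X" "v \<in> bwords X" "w \<in> bwords X"
    and "db_less rX rL [Bracket l u, Bracket m v] w"
  shows "triv w (rb_rel l u m v)"
  using triv_plug[of "[Letter None]" l m u v w] assms
  by (simp add: lin_ext_rb_rel) (simp add: rb_rel_def)

text \<open>The two ways of reducing a product of three brackets agree after reducing inside the outer brackets.\<close>

lemma triv_intersection:
  assumes "isl l = isl m" "isl m = isl n" "u \<in> bwords X" "v \<in> bwords X" "z \<in> bwords X"
  shows "triv [Bracket l u, Bracket m v, Bracket n z]
    (rb_rel l u m v * wmon [Bracket n z] - wmon [Bracket l u] * rb_rel m v n z :: ('o
        + 'o, 'x, 'k::comm_ring_1) bpoly)"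
    (is "triv ?w ?h")
proof -
  let ?lm = "opmul l m" and ?mn = "opmul m n" and ?lmn = "opmul l (opmul m n)"
  let ?F1 = "rb_rel ?lm (Bracket (toR l) u # v) n z :: ('o + 'o, 'x, 'k) bpoly"
  let ?F2 = "rb_rel ?lm (u @ [Bracket (toS m) v]) n z :: ('o + 'o, 'x, 'k) bpoly"
  let ?F3 = "rb_rel l u ?mn (Bracket (toR m) v # z) :: ('o + 'o, 'x, 'k) bpoly"
  let ?F4 = "rb_rel l u ?mn (v @ [Bracket (toS n) z]) :: ('o + 'o, 'x, 'k) bpoly"
  let ?F5 = "lin_ext (plug [Bracket ?lmn (Letter None # emb z)]) (rb_rel (toR l) u (toR m) v) :: ('o
      + 'o, 'x, 'k) bpoly"
  let ?F6 = "lin_ext (plug [Bracket ?lmn (emb u @ [Letter None])]) (rb_rel (toS m) v (toS n) z) :: ('o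
      + 'o, 'x, 'k) bpoly"
  have w: "?w \<in> bwords X" using assms by simp
  have "triv ?w ?F1" "triv ?w ?F2" "triv ?w ?F3" "triv ?w ?F4"
    by (rule triv_rb_rel; use assms w in \<open>auto intro: breadth\<close>)+
  moreover have "triv ?w ?F5" "triv ?w ?F6"
    by (rule triv_plug; use assms w in \<open>auto intro: breadth\<close>)+
  \<comment> \<open>\<open>?F1\<close> and \<open>?F2\<close> reduce the two terms left by the first
    relation, \<open>?F3\<close> and \<open>?F4\<close> those left by the second. The common term
    with content Ru v Sz cancels; \<open>?F5\<close> reduces Ru Rv and \<open>?F6\<close> reduces Sv
    Sz inside the outer bracket. In equal degree all leading monomials have breadth at most two, the
    ambiguity three.\<close>
  ultimately have "triv ?w (?F3 + ?F4 + ?F5 - ?F1 - ?F2 - ?F6)"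
    by (intro triv_add triv_diff)
  also have "?F3 + ?F4 + ?F5 - ?F1 - ?F2 - ?F6 = ?h"
    unfolding lin_ext_rb_rel by (simp add: rb_rel_def left_diff_distrib right_diff_distrib wmon_mult)
  finally show ?thesis .
qed

text \<open>Inner and outer reduction commute. \<open>?F1\<close> and \<open>?F2\<close> are the
  outer relation with \<open>u\<close> replaced by its two reducts, smaller because the reducts are
  smaller than \<open>u\<close>; \<open>?F3\<close> and \<open>?F4\<close> apply the inner relation
  in the two remaining terms of the outer one, smaller by breadth.\<close>

lemma triv_including_left:
  assumes "isl l = isl m" "isl l' = isl m'" "u' \<in> bwords X" "v' \<in> bwords X" "v \<in> bwords X"
    and q: "q \<in> star_words X" and u: "u = plug q [Bracket l' u', Bracket m' v']"
  shows "triv [Bracket l u, Bracket m v]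
    (rb_rel l u m v - lin_ext (plug (Bracket l q # emb [Bracket m v])) (rb_rel l' u' m' v') :: ('o
        + 'o, 'x, 'k::comm_ring_1) bpoly)"
    (is "triv ?w ?h")
proof -
  let ?A = "plug q [Bracket (opmul l' m') (Bracket (toR l') u' # v')]"
  let ?B = "plug q [Bracket (opmul l' m') (u' @ [Bracket (toS m') v'])]"
  let ?F1 = "rb_rel l ?A m v :: ('o + 'o, 'x, 'k) bpoly"
  let ?F2 = "rb_rel l ?B m v :: ('o + 'o, 'x, 'k) bpoly"
  let ?F3 = "lin_ext (plug [Bracket (opmul l m) (Bracket (toR l) q # emb v)]) (rb_rel l' u' m' v') ::
      ('o + 'o, 'x, 'k) bpoly"
  let ?F4 = "lin_ext (plug [Bracket (opmul l m) (q @ emb [Bracket (toS m) v])]) (rb_rel l' u' m' v') ::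
      ('o + 'o, 'x, 'k) bpoly"
  have AB: "?A \<in> bwords X" "?B \<in> bwords X" "u \<in> bwords X"
    unfolding u by (rule star_plug_in_bwords[OF q]; use assms in simp)+
  have less: "db_less rX rL ?A u" "db_less rX rL ?B u"
    unfolding u using q by (auto intro!: db_less_plug rb_rel_less simp: star_words_def)
  have w: "?w \<in> bwords X" using AB assms by simp
  have "triv ?w ?F1"
    by (rule triv_rb_rel) (use AB assms w db_less_context[OF db_less_Bracket[OF less(1)], of "[]" l
        "[Bracket m v]"] in auto)
  moreover have "triv ?w ?F2"
    by (rule triv_rb_rel) (use AB assms w db_less_context[OF db_less_Bracket[OF less(2)], of "[]" l
        "[Bracket m v]"] in auto)
  moreover have "triv ?w ?F3"
    by (rule triv_plug) (use AB assms w u in \<open>auto intro: breadth\<close>)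
  moreover have "triv ?w ?F4"
    by (rule triv_plug) (use AB assms w u in \<open>auto intro: breadth\<close>)
  ultimately have "triv ?w (?F1 + ?F2 - ?F3 - ?F4)" by (intro triv_add triv_diff)
  also have "?F1 + ?F2 - ?F3 - ?F4 = ?h"
    unfolding lin_ext_rb_rel by (simp add: rb_rel_def u)
  finally show ?thesis .
qed

text \<open>Mirror image of the previous case, with the inner reduction in the right
  bracket.\<close>

lemma triv_including_right:
  assumes "isl l = isl m" "isl l' = isl m'" "u' \<in> bwords X" "v' \<in> bwords X" "u \<in> bwords X"
    and q: "q \<in> star_words X" and v: "v = plug q [Bracket l' u', Bracket m' v']"
  shows "triv [Bracket l u, Bracket m v]
    (rb_rel l u m v - lin_ext (plug (emb [Bracket l u] @ [Bracket m q])) (rb_rel l' u' m' v') :: ('o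
        + 'o, 'x, 'k::comm_ring_1) bpoly)"
    (is "triv ?w ?h")
proof -
  let ?A = "plug q [Bracket (opmul l' m') (Bracket (toR l') u' # v')]"
  let ?B = "plug q [Bracket (opmul l' m') (u' @ [Bracket (toS m') v'])]"
  let ?F1 = "rb_rel l u m ?A :: ('o + 'o, 'x, 'k) bpoly"
  let ?F2 = "rb_rel l u m ?B :: ('o + 'o, 'x, 'k) bpoly"
  let ?F3 = "lin_ext (plug [Bracket (opmul l m) (emb [Bracket (toR l) u] @ q)]) (rb_rel l' u' m' v') ::
      ('o + 'o, 'x, 'k) bpoly"
  let ?F4 = "lin_ext (plug [Bracket (opmul l m) (emb u @ [Bracket (toS m) q])]) (rb_rel l' u' m' v') ::
      ('o + 'o, 'x, 'k) bpoly"
  have AB: "?A \<in> bwords X" "?B \<in> bwords X" "v \<in> bwords X"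
    unfolding v by (rule star_plug_in_bwords[OF q]; use assms in simp)+
  have less: "db_less rX rL ?A v" "db_less rX rL ?B v"
    unfolding v using q by (auto intro!: db_less_plug rb_rel_less simp: star_words_def)
  have w: "?w \<in> bwords X" using AB assms by simp
  have "triv ?w ?F1"
    by (rule triv_rb_rel) (use AB assms w db_less_context[OF db_less_Bracket[OF less(1)], of
        "[Bracket l u]" m "[]"] in auto)
  moreover have "triv ?w ?F2"
    by (rule triv_rb_rel) (use AB assms w db_less_context[OF db_less_Bracket[OF less(2)], of
        "[Bracket l u]" m "[]"] in auto)
  moreover have "triv ?w ?F3"
    by (rule triv_plug) (use AB assms w v in \<open>auto intro: breadth\<close>)
  moreover have "triv ?w ?F4"
    by (rule triv_plug) (use AB assms w v in \<open>auto intro: breadth\<close>)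
  ultimately have "triv ?w (?F1 + ?F2 - ?F3 - ?F4)" by (intro triv_add triv_diff)
  also have "?F1 + ?F2 - ?F3 - ?F4 = ?h"
    unfolding lin_ext_rb_rel by (simp add: rb_rel_def v)
  finally show ?thesis .
qed

theorem GS_basis_S_SF: "GS_basis X ord (S_SF X :: ('o + 'o, 'x, 'k::comm_ring_1) bpoly set)"
  unfolding GS_basis_def
proof (intro conjI ballI impI allI)
  show "S_SF X \<subseteq> carrier (word_algebra X)" using S_SF_poly_on by simp
next
  fix s :: "('o + 'o, 'x, 'k) bpoly" assume "s \<in> S_SF X"
  then obtain l u m v where s: "s = rb_rel l u m v" "u \<in> bwords X" "v \<in> bwords X"
    unfolding S_SF_eq by blast
  then have "lookup s [Bracket l u, Bracket m v] = 1" by (simp add: lookup_rb_rel)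
  with s show "monic ord s" by (auto simp: monic_def lead_mon_rb_rel)
next
  fix f g :: "('o + 'o, 'x, 'k) bpoly" and w h
  assume "f \<in> S_SF X" "g \<in> S_SF X" "f \<noteq> g"
  then obtain l u m v l' u' m' v' where
    f: "f = rb_rel l u m v" "isl l = isl m" "u \<in> bwords X" "v \<in> bwords X" and
    g: "g = rb_rel l' u' m' v'" "isl l' = isl m'" "u' \<in> bwords X" "v' \<in> bwords X"
    unfolding S_SF_eq by blast
  note lead = lead_mon_rb_rel[OF f(3,4)] lead_mon_rb_rel[OF g(3,4)]
  assume "intersection_comp X ord f g w h \<or> including_comp X ord f g w h"
  then show "triv w h"
  proof
    assume "intersection_comp X ord f g w h"
    then obtain a b where ab: "w = [Bracket l u, Bracket m v] @ a" "w = b @ [Bracket l' u', Bracket m' v']"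
      "max (length [Bracket l u, Bracket m v]) (length [Bracket l' u', Bracket m' v']) < length w"
      "length w < length [Bracket l u, Bracket m v] + length [Bracket l' u', Bracket m' v']"
      "h = f * wmon a - wmon b * g"
      unfolding intersection_comp_def f(1) g(1) lead by blast
    have "length w = 2 + length a" "length w = length b + 2"
      using arg_cong[OF ab(1), of length] arg_cong[OF ab(2), of length] by simp_all
    \<comment> \<open>Both leading monomials have breadth two, so a proper overlap shares exactly
      one bracket.\<close>
    moreover have "2 < length w" "length w < 4" using ab(3,4) by simp_all
    ultimately have "length a = 1" "length b = 1" by linarith+
    then obtain p p' where p: "a = [p]" "b = [p']" by (auto simp: length_Suc_conv)
    then have "p' = Bracket l u" "l' = m" "u' = v" "p = Bracket m' v'" using ab by auto
    then show ?thesis using triv_intersection[of l m m' u v v'] f g ab p by simp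
  next
    assume "including_comp X ord f g w h"
    then obtain q where q: "q \<in> star_words X" "w = [Bracket l u, Bracket m v]"
      "w = plug q [Bracket l' u', Bracket m' v']" "h = f - lin_ext (plug q) g"
      unfolding including_comp_def f(1) g(1) lead by blast
    from q(1) show ?thesis
    proof (cases rule: star_words_cases)
      case (hole a b)
      then have eq: "[Bracket l u, Bracket m v] = a @ [Bracket l' u', Bracket m' v'] @ b" using q by simp
      have "length a + length b = 0" using arg_cong[OF eq, of length] by simp
      then have "a = []" "b = []" by simp_all
      \<comment> \<open>The leading monomial determines all parameters of a relation; an inclusion
        at top level is thus excluded by \<open>f \<noteq> g\<close>.\<close>
      then have "f = g" using eq f(1) g(1) by simp
      then show ?thesis using \<open>f \<noteq> g\<close> by simp
    next
      case (bracket a k q' b)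
      then have "[Bracket l u, Bracket m v] = a @ [Bracket k (plug q' [Bracket l' u', Bracket m' v'])] @ b"
        using q by simp
      \<comment> \<open>The leading monomial has two factors, and the hole lies in the content of
        one of them.\<close>
      then consider "a = []" "b = [Bracket m v]" "k = l" "u = plug q' [Bracket l' u', Bracket m' v']"
        | "a = [Bracket l u]" "b = []" "k = m" "v = plug q' [Bracket l' u', Bracket m' v']"
        by (cases a; cases "tl a") auto
      then show ?thesis
      proof cases
        case 1
        then show ?thesis
          using triv_including_left[of l m l' m' u' v' v q' u] f g q bracket by simp
      next
        case 2
        then show ?thesis
          using triv_including_right[of l m l' m' u' v' u q' v] f g q bracket by simp
      qed
    qed
  qed
qed

end


section \<open>Quotients of the algebra of bracketed words\<close>

locale word_ideal =
  fixes X :: "'x set" and I :: "('l, 'x, 'k::comm_ring_1) bpoly set"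
  assumes I: "operated_ideal X I"
begin

abbreviation A :: "('k, ('l, 'x, 'k) bpoly) module" where "A \<equiv> word_algebra X"
abbreviation Q where "Q \<equiv> quot_algebra A I"
abbreviation pr where "pr f \<equiv> I +>\<^bsub>A\<^esub> f"

lemma pr_eq: "pr f = (\<lambda>i. i + f) ` I"
  by (auto simp: a_r_coset_def')

lemma pr_eq_iff: "pr f = pr g \<longleftrightarrow> f - g \<in> I"
proof
  assume "pr f = pr g"
  moreover have "f \<in> pr f" unfolding pr_eq by (rule image_eqI[of _ _ 0]) (auto simp: operated_idealD[OF I])
  ultimately obtain i where "i \<in> I" "f = i + g" unfolding pr_eq by auto
  then show "f - g \<in> I" by simp
next
  have sub: "pr f \<subseteq> pr g" if "f - g \<in> I" for f g
  proof
    fix x assume "x \<in> pr f"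
    then obtain i where i: "i \<in> I" "x = i + f" unfolding pr_eq by auto
    then have "x = (i + (f - g)) + g" "i + (f - g) \<in> I" using that operated_idealD(3)[OF I] by auto
    then show "x \<in> pr g" unfolding pr_eq by blast
  qed
  assume "f - g \<in> I"
  moreover from this have "g - f \<in> I" using operated_idealD(7)[OF I, of "f - g"] by simp
  ultimately show "pr f = pr g" using sub by blast
qed

lemma pr_self: "f \<in> pr f"
  unfolding pr_eq by (rule image_eqI[of _ _ 0]) (auto simp: operated_idealD[OF I])

lemma pr_mem: "g \<in> pr f \<Longrightarrow> g - f \<in> I"
  unfolding pr_eq by auto

lemma pr_zero: "pr 0 = I"
  unfolding pr_eq by simp

lemma Q_carrier: "carrier Q = pr ` poly_on X"
  by (auto simp: quot_algebra_def ring.defs FactRing_def A_RCOSETS_def')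

lemma Q_one: "\<one>\<^bsub>Q\<^esub> = pr 1"
  and Q_zero: "\<zero>\<^bsub>Q\<^esub> = pr 0"
  by (simp_all add: quot_algebra_def ring.defs FactRing_def pr_zero)

lemma Q_add: "pr f \<oplus>\<^bsub>Q\<^esub> pr g = pr (f + g)"
proof -
  have "pr f \<oplus>\<^bsub>Q\<^esub> pr g = (\<Union>a\<in>pr f. \<Union>b\<in>pr g. {a + b})"
    by (simp add: quot_algebra_def ring.defs FactRing_def set_add_def')
  also have "\<dots> = pr (f + g)"
  proof (intro equalityI subsetI)
    fix x assume "x \<in> (\<Union>a\<in>pr f. \<Union>b\<in>pr g. {a + b})"
    then obtain a b where ab: "a \<in> pr f" "b \<in> pr g" "x = a + b" by blast
    then have "(a - f) + (b - g) \<in> I" by (intro operated_idealD(3)[OF I] pr_mem)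
    then have "pr x = pr (f + g)" unfolding pr_eq_iff ab(3) by (simp add: algebra_simps)
    then show "x \<in> pr (f + g)" using pr_self[of x] by simp
  next
    fix x assume "x \<in> pr (f + g)"
    then have "x - (f + g) \<in> I" by (rule pr_mem)
    then have "x - g \<in> pr f" unfolding pr_eq by (intro image_eqI[of _ _ "x - (f + g)"]) simp_all
    then show "x \<in> (\<Union>a\<in>pr f. \<Union>b\<in>pr g. {a + b})"
      by (intro UN_I[of "x - g"] UN_I[of g]) (simp_all add: pr_self)
  qed
  finally show ?thesis .
qed

text \<open>Scaling and operators on the quotient are unions over all representatives; when the
  result does not depend on the representative, the union over the nonempty coset is one
  coset.\<close>

lemma pr_cong_UN:
  assumes "\<And>a. a \<in> pr f \<Longrightarrow> pr (F a) = pr g" shows "(\<Union>a\<in>pr f. pr (F a)) = pr g"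
  using assms pr_self[of f] by blast

lemma Q_mult: assumes "f \<in> poly_on X" "g \<in> poly_on X"
  shows "pr f \<otimes>\<^bsub>Q\<^esub> pr g = pr (f * g)"
proof -
  interpret ideal I A using I by (simp add: operated_ideal_def)
  show ?thesis using rcoset_mult_add[of f g] assms
    by (simp add: quot_algebra_def ring.defs FactRing_def)
qed

lemma Q_smult: "c \<odot>\<^bsub>Q\<^esub> pr f = pr (bpoly_scale c f)"
proof -
  have "c \<odot>\<^bsub>Q\<^esub> pr f = (\<Union>a\<in>pr f. pr (bpoly_scale c a))"
    by (simp add: quot_algebra_def ring.defs module.defs)
  also have "\<dots> = pr (bpoly_scale c f)"
  proof (rule pr_cong_UN)
    fix a assume "a \<in> pr f"
    then have "bpoly_scale c (a - f) \<in> I" by (intro operated_idealD(9)[OF I] pr_mem)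
    then show "pr (bpoly_scale c a) = pr (bpoly_scale c f)" by (simp add: pr_eq_iff scale_diff)
  qed
  finally show ?thesis .
qed

lemma Q_op: "quot_op A I (bracket_op l) (pr f) = pr (bracket_op l f)"
  unfolding quot_op_def
proof (rule pr_cong_UN)
  fix a assume "a \<in> pr f"
  then have "bracket_op l (a - f) \<in> I" by (intro operated_idealD(6)[OF I] pr_mem)
  then show "pr (bracket_op l a) = pr (bracket_op l f)"
    by (simp add: pr_eq_iff lin_diff[OF lin_bracket_op[OF lin_intros(1)]])
qed

lemmas Q_simps = Q_one Q_zero Q_add Q_mult Q_smult Q_op

lemma Q_E: assumes "C \<in> carrier Q" obtains f where "f \<in> poly_on X" "C = pr f"
  using assms unfolding Q_carrier by blast

lemma pr_in_Q: "f \<in> poly_on X \<Longrightarrow> pr f \<in> carrier Q"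
  unfolding Q_carrier by blast

lemma abelian_group_Q: "abelian_group Q"
proof (rule abelian_groupI)
  fix C assume "C \<in> carrier Q"
  then obtain f where f: "f \<in> poly_on X" "C = pr f" by (rule Q_E)
  then have "pr (- f) \<oplus>\<^bsub>Q\<^esub> C = \<zero>\<^bsub>Q\<^esub>" by (simp add: Q_simps)
  then show "\<exists>D\<in>carrier Q. D \<oplus>\<^bsub>Q\<^esub> C = \<zero>\<^bsub>Q\<^esub>"
    by (rule bexI) (intro pr_in_Q poly_on_intros f)
qed (auto elim!: Q_E simp: Q_simps add_ac intro!: pr_in_Q)

lemma ring_Q: "ring Q"
proof (rule ringI)
  show "Group.monoid Q"
    by (rule monoidI) (auto elim!: Q_E simp: Q_simps mult.assoc poly_on_intros intro!: pr_in_Q)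
qed (auto elim!: Q_E simp: Q_simps abelian_group_Q distrib_left distrib_right poly_on_intros)

lemma assoc_algebra_Q: "assoc_algebra scalar_ring Q"
proof (intro assoc_algebra.intro assoc_algebra_axioms.intro ring_Q)
  show "module scalar_ring Q"
    by (rule moduleI)
      (auto elim!: Q_E simp: Q_simps cring_scalar_ring abelian_group_Q scale_add scale_add_left intro!:
          pr_in_Q)
qed (auto elim!: Q_E simp: Q_simps poly_on_intros scale_mult_left scale_mult_right)

lemma linear_op_Q: "linear_op scalar_ring Q (quot_op A I (bracket_op l))"
  unfolding linear_op_def
  by (auto elim!: Q_E simp: Q_simps lin_addD[OF lin_bracket_op[OF lin_intros(1)]]
      lin_scaleD[OF lin_bracket_op[OF lin_intros(1)]] intro!: pr_in_Q)

lemma finsum_Q: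
  assumes "finite F" "F \<subseteq> bwords X"
  shows "(\<Oplus>\<^bsub>Q\<^esub>w\<in>F. c w \<odot>\<^bsub>Q\<^esub> pr (wmon w)) = pr (\<Sum>w\<in>F. bpoly_scale (c w) (wmon w))"
  using assms
proof induction
  interpret abelian_group Q by (rule abelian_group_Q)
  case empty
  show ?case by (simp add: Q_simps)
next
  interpret abelian_group Q by (rule abelian_group_Q)
  case (insert w F)
  have *: "c v \<odot>\<^bsub>Q\<^esub> pr (wmon v) \<in> carrier Q" if "v \<in> insert w F" for v
    unfolding Q_smult by (intro pr_in_Q poly_on_intros) (use insert.prems that in auto)
  then have "(\<Oplus>\<^bsub>Q\<^esub>w\<in>insert w F. c w \<odot>\<^bsub>Q\<^esub> pr (wmon w)) =
      c w \<odot>\<^bsub>Q\<^esub> pr (wmon w) \<oplus>\<^bsub>Q\<^esub> (\<Oplus>\<^bsub>Q\<^esub>w\<in>F. c w \<odot>\<^bsub>Q\<^esub> pr (wmon w))"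
    using insert.hyps by (intro finsum_insert) auto
  then show ?case using insert by (simp add: Q_simps)
qed

end


section \<open>The free Rota-Baxter system family algebra\<close>

text \<open>Any operated ideal containing the relations yields a Rota-Baxter system family algebra;
  that it is the least one is added where maps out of the quotient or independence are at
  stake.\<close>

locale sf_ideal = word_ideal X I
  for X :: "'x set" and I :: "('o::semigroup_mult + 'o, 'x, 'k::comm_ring_1) bpoly set" +
  assumes S: "S_SF X \<subseteq> I"
begin

lemma rb_cong:
  assumes "isl l = isl m" "f \<in> poly_on X" "g \<in> poly_on X"
  shows "bracket_op l f * bracket_op m g -
    bracket_op (opmul l m) (bracket_op (toR l) f * g + f * bracket_op (toS m) g) \<in> I"
proof -
  have l: "lin (\<lambda>f. bracket_op l f * bracket_op m g - bracket_op (opmul l m) (bracket_op (toR l) f * g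
      + f * bracket_op (toS m) g))"
    "lin (\<lambda>g. bracket_op l f * bracket_op m g - bracket_op (opmul l m) (bracket_op (toR l) f * g + f
        * bracket_op (toS m) g))"
    for f g :: "('o + 'o, 'x, 'k) bpoly"
    by (intro lin_rules)+
  have rel: "bracket_op l (wmon u) * bracket_op m (wmon v) - bracket_op (opmul l m)
      (bracket_op (toR l) (wmon u) * wmon v + wmon u * bracket_op (toS m) (wmon v)) \<in> I"
    if "u \<in> bwords X" "v \<in> bwords X" for u v
  proof -
    have "rb_rel l u m v \<in> I" using S that assms(1) unfolding S_SF_eq by blast
    then show ?thesis
      by (simp add: rb_rel_def wmon_mult lin_addD[OF lin_bracket_op[OF lin_intros(1)]] algebra_simps)
  qed
  have *: "bracket_op l (wmon u) * bracket_op m g - bracket_op (opmul l m)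
      (bracket_op (toR l) (wmon u) * g + wmon u * bracket_op (toS m) g) \<in> I"
    if u: "u \<in> bwords X" and "keys g \<subseteq> bwords X" for u g
    using that(2)
  proof (induction rule: bpoly_induct)
    case (mon c w)
    show ?case unfolding lin_scaleD[OF l(2)] by (intro operated_idealD(9)[OF I] rel u mon)
  next
    case (add f g)
    then show ?case unfolding lin_addD[OF l(2)] by (intro operated_idealD(3)[OF I])
  qed (simp add: operated_idealD[OF I])
  have "keys f \<subseteq> bwords X" using assms(2) by (simp add: poly_on_def)
  then show ?thesis
  proof (induction rule: bpoly_induct)
    case (mon c w)
    show ?case unfolding lin_scaleD[OF l(1)]
      by (intro operated_idealD(9)[OF I] *) (use mon assms in \<open>auto simp: poly_on_def\<close>)
  next
    case (add f g)
    then show ?case unfolding lin_addD[OF l(1)] by (intro operated_idealD(3)[OF I])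
  qed (simp add: operated_idealD[OF I])
qed

lemma rb_system_family_Q:
  "rb_system_family scalar_ring Q (\<lambda>\<omega>. quot_op A I (bracket_op (Inl \<omega>))) (\<lambda>\<omega>. quot_op A I (bracket_op
      (Inr \<omega>)))"
proof (intro rb_system_family.intro rb_system_family_axioms.intro assoc_algebra_Q linear_op_Q)
  fix a b and \<alpha> \<beta> :: 'o assume "a \<in> carrier Q" "b \<in> carrier Q"
  then obtain f g where fg: "f \<in> poly_on X" "a = pr f" "g \<in> poly_on X" "b = pr g" by (metis Q_E)
  have ops: "opmul (Inl \<alpha>) (Inl \<beta>) = Inl (\<alpha> * \<beta>)" "opmul (Inr \<alpha>) (Inr \<beta>) = Inr (\<alpha> * \<beta>)"
    "toR (Inl \<alpha>) = Inl \<alpha>" "toR (Inr \<alpha>) = Inl \<alpha>" "toS (Inl \<beta>) = Inr \<beta>" "toS (Inr \<beta>) = Inr \<beta>"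
    by (simp_all add: opmul_def toR_def toS_def idx_def)
  have "pr (bracket_op l f * bracket_op m g) =
      pr (bracket_op (opmul l m) (bracket_op (toR l) f * g + f * bracket_op (toS m) g))"
    if "isl l = isl m" for l m
    unfolding pr_eq_iff using rb_cong[OF that fg(1,3)] .
  from this[of "Inl \<alpha>" "Inl \<beta>"] this[of "Inr \<alpha>" "Inr \<beta>"]
  show "quot_op A I (bracket_op (Inl \<alpha>)) a \<otimes>\<^bsub>Q\<^esub> quot_op A I (bracket_op (Inl \<beta>)) b =
       quot_op A I (bracket_op (Inl (\<alpha> * \<beta>)))
        (quot_op A I (bracket_op (Inl \<alpha>)) a \<otimes>\<^bsub>Q\<^esub> b \<oplus>\<^bsub>Q\<^esub> a \<otimes>\<^bsub>Q\<^esub> quot_op A I (bracket_op (Inr \<beta>)) b)"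
    and "quot_op A I (bracket_op (Inr \<alpha>)) a \<otimes>\<^bsub>Q\<^esub> quot_op A I (bracket_op (Inr \<beta>)) b =
       quot_op A I (bracket_op (Inr (\<alpha> * \<beta>)))
        (quot_op A I (bracket_op (Inl \<alpha>)) a \<otimes>\<^bsub>Q\<^esub> b \<oplus>\<^bsub>Q\<^esub> a \<otimes>\<^bsub>Q\<^esub> quot_op A I (bracket_op (Inr \<beta>)) b)"
    using fg by (simp_all add: ops Q_simps poly_on_intros)
qed

end

section \<open>Evaluation of words in a test algebra\<close>

fun eval_prime :: "('k, 'b) module \<Rightarrow> ('l \<Rightarrow> 'b \<Rightarrow> 'b) \<Rightarrow> ('x \<Rightarrow> 'b) \<Rightarrow> ('l, 'x) bprime \<Rightarrow> 'b" where
  "eval_prime B P f (Letter x) = f x"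
| "eval_prime B P f (Bracket l w) = P l (foldr (\<otimes>\<^bsub>B\<^esub>) (map (eval_prime B P f) w) \<one>\<^bsub>B\<^esub>)"

definition eval_word :: "('k, 'b) module \<Rightarrow> ('l \<Rightarrow> 'b \<Rightarrow> 'b) \<Rightarrow> ('x \<Rightarrow> 'b) \<Rightarrow> ('l, 'x) bword \<Rightarrow> 'b" where
  "eval_word B P f w = foldr (\<otimes>\<^bsub>B\<^esub>) (map (eval_prime B P f) w) \<one>\<^bsub>B\<^esub>"

lemma eval_word_simps [simp]:
  "eval_word B P f [] = \<one>\<^bsub>B\<^esub>"
  "eval_word B P f (Letter x # w) = f x \<otimes>\<^bsub>B\<^esub> eval_word B P f w"
  "eval_word B P f (Bracket l u # w) = P l (eval_word B P f u) \<otimes>\<^bsub>B\<^esub> eval_word B P f w"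
  by (simp_all add: eval_word_def)

locale rb_target = rb_system_family "scalar_ring :: 'k::comm_ring_1 ring" B R' S'
  for B :: "('k::comm_ring_1, 'b) module" and R' S' :: "'o::semigroup_mult \<Rightarrow> 'b \<Rightarrow> 'b" +
  fixes X :: "'x set" and f :: "'x \<Rightarrow> 'b"
  assumes f: "f \<in> X \<rightarrow> carrier B"
begin

abbreviation P :: "'o + 'o \<Rightarrow> 'b \<Rightarrow> 'b" where "P \<equiv> case_sum R' S'"
abbreviation ev :: "('o + 'o, 'x) bword \<Rightarrow> 'b" where "ev \<equiv> eval_word B P f"

lemma linear_P: "linear_op scalar_ring B (P l)"
  using linear_R linear_S by (cases l) auto

lemma P_closed [simp]: "a \<in> carrier B \<Longrightarrow> P l a \<in> carrier B"
  and P_add: "a \<in> carrier B \<Longrightarrow> b \<in> carrier B \<Longrightarrow> P l (a \<oplus>\<^bsub>B\<^esub> b) = P l a \<oplus>\<^bsub>B\<^esub> P l b"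
  and P_smult: "a \<in> carrier B \<Longrightarrow> P l (c \<odot>\<^bsub>B\<^esub> a) = c \<odot>\<^bsub>B\<^esub> P l a"
  using linear_P[of l] by (auto simp: linear_op_def)

lemma P_zero: "P l \<zero>\<^bsub>B\<^esub> = \<zero>\<^bsub>B\<^esub>"
  using P_smult[of "\<zero>\<^bsub>B\<^esub>" l 0] smult_l_null[of "\<zero>\<^bsub>B\<^esub>"] smult_l_null[of "P l \<zero>\<^bsub>B\<^esub>"] by simp

lemma smult_c [simp]: "a \<in> carrier B \<Longrightarrow> c \<odot>\<^bsub>B\<^esub> a \<in> carrier B"
  by (rule smult_closed) simp_all

lemma PP:
  assumes "isl l = isl m" "a \<in> carrier B" "b \<in> carrier B"
  shows "P l a \<otimes>\<^bsub>B\<^esub> P m b = P (opmul l m) (P (toR l) a \<otimes>\<^bsub>B\<^esub> b \<oplus>\<^bsub>B\<^esub> a \<otimes>\<^bsub>B\<^esub> P (toS m) b)"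
  using assms RR SS by (cases l; cases m) (auto simp: opmul_def toR_def toS_def idx_def)

lemma ev_closed [simp]: "w \<in> bwords X \<Longrightarrow> ev w \<in> carrier B"
  by (induction rule: bword_induct) (use f in auto)

lemma ev_append: "u \<in> bwords X \<Longrightarrow> v \<in> bwords X \<Longrightarrow> ev (u @ v) = ev u \<otimes>\<^bsub>B\<^esub> ev v"
  by (induction rule: bword_induct) (use f in \<open>auto simp: m_assoc Pi_iff\<close>)

definition \<Phi> :: "('o + 'o, 'x, 'k) bpoly \<Rightarrow> 'b" where
  "\<Phi> p = (\<Oplus>\<^bsub>B\<^esub>w\<in>keys p. lookup p w \<odot>\<^bsub>B\<^esub> ev w)"

lemma \<Phi>_superset:
  assumes "finite F" "keys p \<subseteq> F" "F \<subseteq> bwords X"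
  shows "\<Phi> p = (\<Oplus>\<^bsub>B\<^esub>w\<in>F. lookup p w \<odot>\<^bsub>B\<^esub> ev w)"
  unfolding \<Phi>_def
proof (rule M.add.finprod_mono_neutral_cong_left[OF assms(1,2)])
  fix w assume "w \<in> F - keys p"
  then have "lookup p w = 0" "ev w \<in> carrier B" using assms(3) by (auto simp: in_keys_iff)
  then show "lookup p w \<odot>\<^bsub>B\<^esub> ev w = \<zero>\<^bsub>B\<^esub>" using smult_l_null[of "ev w"] by simp
qed (use assms in auto)

lemma \<Phi>_closed [simp]: "p \<in> poly_on X \<Longrightarrow> \<Phi> p \<in> carrier B"
  unfolding \<Phi>_def by (rule M.finsum_closed) (auto simp: poly_on_def)

lemma \<Phi>_wmon [simp]: "w \<in> bwords X \<Longrightarrow> \<Phi> (wmon w) = ev w"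
  using M.finsum_insert[of "{}" w "\<lambda>v. lookup (wmon w :: ('o
      + 'o, 'x, 'k) bpoly) v \<odot>\<^bsub>B\<^esub> ev v"] smult_one[of "ev w"]
  by (simp add: \<Phi>_def keys_wmon lookup_wmon)

lemma \<Phi>_add:
  assumes "p \<in> poly_on X" "q \<in> poly_on X" shows "\<Phi> (p + q) = \<Phi> p \<oplus>\<^bsub>B\<^esub> \<Phi> q"
proof -
  let ?F = "keys p \<union> keys q"
  have F: "finite ?F" "?F \<subseteq> bwords X" using assms by (auto simp: poly_on_def)
  have "\<Phi> (p + q) = (\<Oplus>\<^bsub>B\<^esub>w\<in>?F. lookup (p + q) w \<odot>\<^bsub>B\<^esub> ev w)"
    using F keys_add[of p q] by (intro \<Phi>_superset) auto
  also have "\<dots> = (\<Oplus>\<^bsub>B\<^esub>w\<in>?F. lookup p w \<odot>\<^bsub>B\<^esub> ev w \<oplus>\<^bsub>B\<^esub> lookup q w \<odot>\<^bsub>B\<^esub> ev w)"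
  proof (rule M.finsum_cong')
    fix w assume "w \<in> ?F"
    then have "ev w \<in> carrier B" using F by auto
    then show "lookup (p + q) w \<odot>\<^bsub>B\<^esub> ev w = lookup p w \<odot>\<^bsub>B\<^esub> ev w \<oplus>\<^bsub>B\<^esub> lookup q w \<odot>\<^bsub>B\<^esub> ev w"
      using smult_l_distr[of "lookup p w" "lookup q w" "ev w"] by (simp add: lookup_add)
  qed (use F in auto)
  also have "\<dots> = (\<Oplus>\<^bsub>B\<^esub>w\<in>?F. lookup p w \<odot>\<^bsub>B\<^esub> ev w) \<oplus>\<^bsub>B\<^esub> (\<Oplus>\<^bsub>B\<^esub>w\<in>?F. lookup q w \<odot>\<^bsub>B\<^esub> ev w)"
    using F by (intro M.finsum_addf) auto
  also have "\<dots> = \<Phi> p \<oplus>\<^bsub>B\<^esub> \<Phi> q"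
    using F by (simp add: \<Phi>_superset[of ?F])
  finally show ?thesis .
qed

lemma \<Phi>_zero [simp]: "\<Phi> 0 = \<zero>\<^bsub>B\<^esub>"
  by (simp add: \<Phi>_def)

lemma \<Phi>_scale:
  assumes "p \<in> poly_on X" shows "\<Phi> (bpoly_scale c p) = c \<odot>\<^bsub>B\<^esub> \<Phi> p"
proof -
  have F: "finite (keys p)" "keys p \<subseteq> bwords X" using assms by (auto simp: poly_on_def)
  have "\<Phi> (bpoly_scale c p) = (\<Oplus>\<^bsub>B\<^esub>w\<in>keys p. lookup (bpoly_scale c p) w \<odot>\<^bsub>B\<^esub> ev w)"
    using F keys_scale by (intro \<Phi>_superset) auto
  also have "\<dots> = (\<Oplus>\<^bsub>B\<^esub>w\<in>keys p. c \<odot>\<^bsub>B\<^esub> (lookup p w \<odot>\<^bsub>B\<^esub> ev w))"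
  proof (rule M.finsum_cong')
    fix w assume "w \<in> keys p"
    then have "ev w \<in> carrier B" using F by auto
    then show "lookup (bpoly_scale c p) w \<odot>\<^bsub>B\<^esub> ev w = c \<odot>\<^bsub>B\<^esub> (lookup p w \<odot>\<^bsub>B\<^esub> ev w)"
      using smult_assoc1[of c "lookup p w" "ev w"] by simp
  qed (use F in auto)
  also have "\<dots> = c \<odot>\<^bsub>B\<^esub> \<Phi> p"
    unfolding \<Phi>_def using F by (intro finsum_smult_ldistr[symmetric]) auto
  finally show ?thesis .
qed

lemma \<Phi>_mult:
  assumes "p \<in> poly_on X" "q \<in> poly_on X" shows "\<Phi> (p * q) = \<Phi> p \<otimes>\<^bsub>B\<^esub> \<Phi> q"
proof -
  have *: "\<Phi> (wmon w * q) = \<Phi> (wmon w) \<otimes>\<^bsub>B\<^esub> \<Phi> q" if w: "w \<in> bwords X" for w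
    using assms(2)
  proof (induction rule: poly_on_induct)
    case (mon c v)
    then show ?case using w smult_mult_right[of c "ev w" "ev v"]
      by (simp add: scale_mult_right wmon_mult \<Phi>_scale ev_append)
  next
    case (add f g)
    then show ?case using w by (simp add: distrib_left \<Phi>_add poly_on_intros r_distr)
  qed (use w in simp)
  show ?thesis using assms(1)
  proof (induction rule: poly_on_induct)
    case (mon c w)
    then show ?case using assms(2) * smult_mult_left[of c "ev w" "\<Phi> q"]
      by (simp add: scale_mult_left \<Phi>_scale poly_on_intros)
  next
    case (add f g)
    then show ?case using assms(2) by (simp add: distrib_right \<Phi>_add poly_on_intros l_distr)
  qed (use assms in simp)
qed

lemma \<Phi>_op: "p \<in> poly_on X \<Longrightarrow> \<Phi> (bracket_op l p) = P l (\<Phi> p)"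
proof (induction rule: poly_on_induct)
  case (mon c w)
  then show ?case
    by (simp add: lin_scaleD[OF lin_bracket_op[OF lin_intros(1)]] \<Phi>_scale P_smult)
next
  case (add f g)
  then show ?case
    by (simp add: lin_addD[OF lin_bracket_op[OF lin_intros(1)]] \<Phi>_add P_add poly_on_intros)
qed (simp add: P_zero)

lemma \<Phi>_rb_rel:
  assumes "isl l = isl m" "u \<in> bwords X" "v \<in> bwords X" shows "\<Phi> (rb_rel l u m v) = \<zero>\<^bsub>B\<^esub>"
proof -
  let ?r = "rb_rel l u m v :: ('o + 'o, 'x, 'k) bpoly"
  let ?a = "bracket_op (opmul l m) (bracket_op (toR l) (wmon u) * wmon v + wmon u * bracket_op (toS m)
      (wmon v)) :: ('o + 'o, 'x, 'k) bpoly"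
  have a: "?a \<in> poly_on X" "?r \<in> poly_on X"
    by (intro poly_on_intros rb_rel_poly_on; use assms in simp)+
  \<comment> \<open>Adding the bracket terms turns the relation into an equation between products,
    so no subtraction in \<open>B\<close> is needed and the claim follows by cancellation.\<close>
  have "?r + ?a = bracket_op l (wmon u) * bracket_op m (wmon v)"
    by (simp add: rb_rel_def wmon_mult lin_addD[OF lin_bracket_op[OF lin_intros(1)]])
  then have "\<Phi> ?r \<oplus>\<^bsub>B\<^esub> \<Phi> ?a = \<Phi> (bracket_op l (wmon u) * bracket_op m (wmon v))"
    using \<Phi>_add[OF a(2,1)] by simp
  also have "\<dots> = P l (ev u) \<otimes>\<^bsub>B\<^esub> P m (ev v)"
    using assms by (simp add: \<Phi>_mult \<Phi>_op poly_on_intros del: bracket_op_wmon)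
  also have "\<dots> = \<Phi> ?a"
    using assms by (simp add: PP \<Phi>_mult \<Phi>_op \<Phi>_add poly_on_intros del: bracket_op_wmon)
  finally show ?thesis using a by (metis M.add.r_cancel_one \<Phi>_closed)
qed

text \<open>As for \<open>nf\<close>, the kernel is an operated ideal containing the
  relations.\<close>

lemma \<Phi>_op_ideal: assumes "p \<in> op_ideal X (S_SF X)" shows "\<Phi> p = \<zero>\<^bsub>B\<^esub>"
proof -
  have "operated_ideal X {p \<in> poly_on X. \<Phi> p = \<zero>\<^bsub>B\<^esub>}"
    unfolding operated_ideal_iff by (auto simp: \<Phi>_add \<Phi>_mult \<Phi>_op P_zero)
  moreover have "S_SF X \<subseteq> {p \<in> poly_on X. \<Phi> p = \<zero>\<^bsub>B\<^esub>}"
    by (auto simp: S_SF_eq \<Phi>_rb_rel rb_rel_poly_on)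
  ultimately show ?thesis using assms op_ideal_least by blast
qed

end

section \<open>Universal property and basis of the quotient\<close>

context sf_ideal
begin

lemma free_rbsf_Q:
  assumes I_eq: "I = op_ideal X (S_SF X)"
  shows "free_rbsf TYPE('b) scalar_ring Q (\<lambda>\<omega>. quot_op A I (bracket_op (Inl \<omega>)))
    (\<lambda>\<omega>. quot_op A I (bracket_op (Inr \<omega>))) X (\<lambda>x. pr (wmon [Letter x]))"
  unfolding free_rbsf_def
proof (intro conjI allI impI rb_system_family_Q)
  show "(\<lambda>x. pr (wmon [Letter x])) \<in> X \<rightarrow> carrier Q" by (auto intro!: pr_in_Q)
next
  fix B :: "('k, 'b) module" and R' S' :: "'o \<Rightarrow> 'b \<Rightarrow> 'b" and f
  assume "rb_system_family scalar_ring B R' S' \<and> f \<in> X \<rightarrow> carrier B"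
  then interpret rb_target B R' S' X f
    by (simp add: rb_target_def rb_target_axioms_def)
  let ?H = "rbsf_hom scalar_ring Q (\<lambda>\<omega>. quot_op A I (bracket_op (Inl \<omega>)))
    (\<lambda>\<omega>. quot_op A I (bracket_op (Inr \<omega>))) B R' S'"
  \<comment> \<open>\<open>\<Phi>\<close> is constant on each coset, so the image of a coset is a
    singleton and \<open>the_elem\<close> picks its value.\<close>
  define \<phi> where "\<phi> = restrict (\<lambda>C. the_elem (\<Phi> ` C)) (carrier Q)"
  have \<phi>: "\<phi> (pr p) = \<Phi> p" if p: "p \<in> poly_on X" for p
  proof -
    have "\<Phi> a = \<Phi> p" if a: "a \<in> pr p" for a
    proof -
      obtain i where "i \<in> I" "a = i + p" using a unfolding pr_eq by blast
      then show ?thesis using p \<Phi>_op_ideal[of i] operated_idealD(1)[OF I, of i] by (simp add: I_eq \<Phi>_add)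
    qed
    then have "\<Phi> ` pr p = {\<Phi> p}" using pr_self[of p] by blast
    then show ?thesis using p by (simp add: \<phi>_def pr_in_Q)
  qed
  show "\<exists>!\<phi>. \<phi> \<in> extensional (carrier Q) \<and> \<phi> \<in> ?H \<and> (\<forall>x\<in>X. \<phi> (pr (wmon [Letter x])) = f x)"
  proof (rule ex1I[of _ \<phi>])
    have "\<phi> \<in> ?H"
      unfolding rbsf_hom_def
    proof (intro CollectI conjI ballI allI)
      show "\<phi> \<in> ring_hom Q B"
      proof (rule ring_hom_memI)
        show "\<phi> \<one>\<^bsub>Q\<^esub> = \<one>\<^bsub>B\<^esub>"
          using \<phi>[of 1] \<Phi>_wmon[of "[]"] by (simp add: Q_one wmon_Nil)
      qed (auto elim!: Q_E simp: \<phi> Q_simps poly_on_intros \<Phi>_mult \<Phi>_add)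
    next
      fix c C assume "C \<in> carrier Q"
      then show "\<phi> (c \<odot>\<^bsub>Q\<^esub> C) = c \<odot>\<^bsub>B\<^esub> \<phi> C"
        by (auto elim!: Q_E simp: \<phi> Q_simps poly_on_intros \<Phi>_scale)
    next
      fix \<omega> C assume "C \<in> carrier Q"
      then show "\<phi> (quot_op A I (bracket_op (Inl \<omega>)) C) = R' \<omega> (\<phi> C)"
        and "\<phi> (quot_op A I (bracket_op (Inr \<omega>)) C) = S' \<omega> (\<phi> C)"
        by (auto elim!: Q_E simp: \<phi> Q_simps poly_on_intros \<Phi>_op)
    qed
    moreover have "\<forall>x\<in>X. \<phi> (pr (wmon [Letter x])) = f x"
      using f by (auto simp: \<phi> Pi_iff)
    ultimately show "\<phi> \<in> extensional (carrier Q) \<and> \<phi> \<in> ?H \<and> (\<forall>x\<in>X. \<phi> (pr (wmon [Letter x])) = f x)"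
      by (simp add: \<phi>_def)
  next
    fix \<psi> assume \<psi>: "\<psi> \<in> extensional (carrier Q) \<and> \<psi> \<in> ?H \<and> (\<forall>x\<in>X. \<psi> (pr (wmon [Letter x])) = f x)"
    then have hom: "\<psi> \<in> ring_hom Q B"
      and scale: "\<And>c C. C \<in> carrier Q \<Longrightarrow> \<psi> (c \<odot>\<^bsub>Q\<^esub> C) = c \<odot>\<^bsub>B\<^esub> \<psi> C"
      and op: "\<And>l C. C \<in> carrier Q \<Longrightarrow> \<psi> (quot_op A I (bracket_op l) C) = P l (\<psi> C)"
      by (auto simp: rbsf_hom_def split: sum.split)
    have mult: "\<psi> (pr (p * q)) = \<psi> (pr p) \<otimes>\<^bsub>B\<^esub> \<psi> (pr q)" if "p \<in> poly_on X" "q \<in> poly_on X" for p q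
      using ring_hom_mult[OF hom, of "pr p" "pr q"] that by (simp add: Q_mult pr_in_Q)
    \<comment> \<open>Uniqueness: letters, products and brackets generate all words, so a
      homomorphism is forced on them, and by linearity on the quotient.\<close>
    have words: "\<psi> (pr (wmon w)) = ev w" if "w \<in> bwords X" for w
      using that
    proof (induction rule: bword_induct)
      case Nil
      then show ?case using ring_hom_one[OF hom] by (simp add: Q_one wmon_Nil)
    next
      case (Letter x w)
      then show ?case using mult[of "wmon [Letter x]" "wmon w"] \<psi> by (simp add: wmon_mult)
    next
      case (Bracket l u w)
      have "\<psi> (pr (wmon [Bracket l u])) = P l (ev u)"
        using op[of "pr (wmon u)" l] Bracket by (simp add: Q_op pr_in_Q)
      then show ?case using mult[of "wmon [Bracket l u]" "wmon w"] Bracket by (simp add: wmon_mult)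
    qed
    have "\<psi> (pr p) = \<Phi> p" if "p \<in> poly_on X" for p
      using that
    proof (induction rule: poly_on_induct)
      case zero
      have "\<psi> (pr 0) \<in> carrier B" by (rule ring_hom_closed[OF hom]) (simp add: pr_in_Q)
      \<comment> \<open>The value at zero is obtained from homogeneity with the scalar 0.\<close>
      then show ?case using scale[of "pr 0" 0] smult_l_null[of "\<psi> (pr 0)"] by (simp add: Q_smult pr_in_Q)
    next
      case (mon c w)
      then show ?case using scale[of "pr (wmon w)" c] words[of w] by (simp add: Q_smult pr_in_Q \<Phi>_scale)
    next
      case (add p q)
      then show ?case using ring_hom_add[OF hom, of "pr p" "pr q"] by (simp add: Q_add pr_in_Q \<Phi>_add)
    qed
    then have eq: "\<psi> C = \<phi> C" if "C \<in> carrier Q" for C using that \<phi> by (metis Q_E)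
    have "\<psi> \<in> extensional (carrier Q)" "\<phi> \<in> extensional (carrier Q)"
      using \<psi> by (simp_all add: \<phi>_def)
    then show "\<psi> = \<phi>" by (rule extensionalityI) (rule eq)
  qed
qed

lemma module_basis_Q:
  assumes I_eq: "I = op_ideal X (S_SF X)"
  shows "module_basis scalar_ring Q (red_words X) (\<lambda>w. pr (wmon w))"
  unfolding module_basis_def
proof (intro conjI ballI allI impI)
  have red: "red_words X \<subseteq> bwords X" by (auto simp: red_words_def)
  show "(\<lambda>w. pr (wmon w)) \<in> red_words X \<rightarrow> carrier Q"
    using red by (auto intro!: pr_in_Q)
next
  fix C assume "C \<in> carrier Q"
  then obtain p where p: "p \<in> poly_on X" "C = pr p" by (rule Q_E)
  have keys: "keys (nf p) \<subseteq> red_words X" using p(1) by (intro keys_nf) (simp add: poly_on_def)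
  have "C = pr (nf p)" using nf_cong[OF I S p(1)] p(2) by (simp add: pr_eq_iff)
  also have "\<dots> = pr (\<Sum>w\<in>keys (nf p). bpoly_scale (lookup (nf p) w) (wmon w))"
    by (rule arg_cong[where f = "\<lambda>g. pr g"], rule bpoly_expand) simp_all
  also have "\<dots> = (\<Oplus>\<^bsub>Q\<^esub>w\<in>keys (nf p). lookup (nf p) w \<odot>\<^bsub>Q\<^esub> pr (wmon w))"
    by (rule finsum_Q[symmetric]) (use keys in \<open>auto simp: red_words_def\<close>)
  finally show "\<exists>F c. finite F \<and> F \<subseteq> red_words X \<and> c \<in> F \<rightarrow> carrier scalar_ring \<and> C =
      (\<Oplus>\<^bsub>Q\<^esub>w\<in>F. c w \<odot>\<^bsub>Q\<^esub> pr (wmon w))"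
    using keys by (intro exI[of _ "keys (nf p)"] exI[of _ "lookup (nf p)"]) simp
next
  fix F c assume *: "finite F \<and> F \<subseteq> red_words X \<and> c \<in> F \<rightarrow> carrier scalar_ring \<and>
    (\<Oplus>\<^bsub>Q\<^esub>w\<in>F. c w \<odot>\<^bsub>Q\<^esub> pr (wmon w)) = \<zero>\<^bsub>Q\<^esub>"
  let ?p = "\<Sum>w\<in>F. bpoly_scale (c w) (wmon w) :: ('o + 'o, 'x, 'k) bpoly"
  have "F \<subseteq> bwords X" using * by (auto simp: red_words_def)
  then have "pr ?p = pr 0" using * finsum_Q[of F c] by (simp add: Q_zero)
  then have "?p \<in> I" by (simp add: pr_eq_iff)
  then have "nf ?p = 0" using nf_op_ideal by (simp add: I_eq)
  moreover have "nf ?p = ?p"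
  proof -
    have single: "keys (bpoly_scale (c w) (wmon w :: ('o + 'o, 'x, 'k) bpoly)) \<subseteq> {w}" for w
      using keys_scale[of "c w" "wmon w :: ('o + 'o, 'x, 'k) bpoly"] by (simp only: keys_wmon)
    have "keys ?p \<subseteq> (\<Union>w\<in>F. keys (bpoly_scale (c w) (wmon w :: ('o + 'o, 'x, 'k) bpoly)))"
      by (rule keys_sum)
    also have "\<dots> \<subseteq> F" using single by blast
    also have "F \<subseteq> red_words X" using * by blast
    finally show ?thesis
      by (rule lin_eq_on[OF lin_nf[OF lin_intros(1)] lin_intros(1), rotated])
        (simp add: nf_word_red red_words_def)
  qed
  ultimately have p0: "?p = 0" by simp
  show "c w = \<zero>\<^bsub>scalar_ring\<^esub>" if "w \<in> F" for w
  proof -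
    have "lookup ?p w = (\<Sum>v\<in>F. if v = w then c v else 0)"
      unfolding lookup_sum by (intro sum.cong) (auto simp: lookup_wmon)
    also have "\<dots> = c w" using * that by simp
    finally show ?thesis using p0 by simp
  qed
qed

end

theorem proposition3p5:
  fixes X :: "'x set" and rX :: "'x rel"
    and rL :: "('o::semigroup_mult + 'o) rel"
    and \<S> :: "('o + 'o, 'x, 'k::comm_ring_1) bpoly set"
    and A :: "('k, ('o + 'o, 'x, 'k) bpoly) module"
  defines "\<S> \<equiv> S_SF X"
    and "A \<equiv> word_algebra X"
  assumes "well_order_on X rX"
    and "well_order_on UNIV rL"
  shows "monomial_order X (db_order X rX rL)
    \<and> GS_basis X (db_order X rX rL) \<S>
    \<and> free_rbsf TYPE('b) (scalar_ring :: 'k ring) (quot_algebra A (op_ideal X \<S>))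
        (\<lambda>\<omega>. quot_op A (op_ideal X \<S>) (bracket_op (Inl \<omega>)))
        (\<lambda>\<omega>. quot_op A (op_ideal X \<S>) (bracket_op (Inr \<omega>)))
        X (\<lambda>x. op_ideal X \<S> +>\<^bsub>A\<^esub> wmon [Letter x])
    \<and> module_basis (scalar_ring :: 'k ring) (quot_algebra A (op_ideal X \<S>))
        (Irr X (db_order X rX rL) \<S>) (\<lambda>w. op_ideal X \<S> +>\<^bsub>A\<^esub> wmon w)"
proof -
  interpret sf_setup X rX rL
    using assms by (simp add: sf_setup_def db_setup_def)
  interpret sf_ideal X "op_ideal X (S_SF X :: ('o + 'o, 'x, 'k) bpoly set)"
    by unfold_locales (simp_all add: operated_ideal_op_ideal S_SF_poly_on op_ideal_superset)
  show ?thesis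
    unfolding \<S>_def A_def
    using monomial_order_db GS_basis_S_SF free_rbsf_Q[OF refl] module_basis_Q[OF refl]
    by (simp add: Irr_eq_red_words)
qed

end
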